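(* Let $m_1,m_2\ge 1$ and $n_1,\dots,n_{m_1},k_1,\dots,k_{m_2}\ge 1$ be integers. If $\varphi:*_{i=1}^{m_1}\mathfrak A_{n_i}\to *_{j=1}^{m_2}\mathfrak A_{k_j}$ is a completely isometric isomorphism, then $m_1=m_2$ and there exists a permutation $\alpha\in S_{m_1}$ such that $\varphi=\times_{i=1}^{m_1}\varphi_i$, where $\varphi_i$ is a completely isometric isomorphism from $\mathfrak A_{n_i}$ onto $\mathfrak A_{k_{\alpha(i)}}$, $1\le i\le m_1$; that is, the restriction of $\varphi$ to the $i$-th free factor $\mathfrak A_{n_i}$ is a completely isometric isomorphism $\varphi_i$ onto the $\alpha(i)$-th free factor $\mathfrak A_{k_{\alpha(i)}}$.
   Context: The noncommutative disc algebra $\mathfrak A_n$ is the universal unital operator algebra generated by the identity and a row contraction $(\mathfrak s_1,\dots,\mathfrak s_n)$, i.e. $\sum_{i}\mathfrak s_i\mathfrak s_i^*\le I$ (equivalently, the norm-closed algebra generated by the identity and the left creation operators on the full Fock space over $\mathbb C^n$). The free product $*_{i=1}^m\mathfrak A_{n_i}$ is amalgamated over the identity; it is the universal unital operator algebra generated by $m$ row contractions $(\mathfrak s_{i,1},\dots,\mathfrak s_{i,n_i})$, $1\le i\le m$: for any row contractions $(T_{i,1},\dots,T_{i,n_i})$, $1\le i\le m$, on a Hilbert space there is a unique unital completely contractive homomorphism sending $\mathfrak s_{i,j}$ to $T_{i,j}$. The $i$-th free factor is the closed unital subalgebra generated by $\mathfrak s_{i,1},\dots,\mathfrak s_{i,n_i}$,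 canonically identified with $\mathfrak A_{n_i}$. *)

theory Defs
  imports "HOL-Analysis.Analysis" "HOL-Combinatorics.Permutations"
begin

section \<open>Complex Hilbert spaces and their bounded operators\<close>

text \<open>
  A complex Hilbert space is presented on top of its underlying real Hilbert space, so that the
  norm, the topology and the completeness are those of the library. The complex inner product is
  linear in the second argument.
\<close>

class complex_hilbert_space = real_inner + complete_space +
  fixes scaleC :: "complex \<Rightarrow> 'a \<Rightarrow> 'a" (infixr "*\<^sub>C" 75)
    and cinner :: "'a \<Rightarrow> 'a \<Rightarrow> complex"
  assumes scaleC_add_right: "c *\<^sub>C (x + y) = c *\<^sub>C x + c *\<^sub>C y"
    and scaleC_add_left: "(c + d) *\<^sub>C x = c *\<^sub>C x + d *\<^sub>C x"
    and scaleC_scaleC: "c *\<^sub>C d *\<^sub>C x = (c * d) *\<^sub>C x"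
    and scaleR_eq_scaleC: "r *\<^sub>R x = complex_of_real r *\<^sub>C x"
    and cinner_commute: "cinner x y = cnj (cinner y x)"
    and cinner_add_right: "cinner x (y + z) = cinner x y + cinner x z"
    and cinner_scaleC_right: "cinner x (c *\<^sub>C y) = c * cinner x y"
    and inner_eq_Re_cinner: "inner x y = Re (cinner x y)"

text \<open>
  The library type of bounded real-linear operators carries the operator norm;
  \<open>B(H)\<close> is its closed subset of complex-linear operators.
\<close>

type_synonym 'h op = "'h \<Rightarrow>\<^sub>L 'h"

definition clinear_ops :: "'h::complex_hilbert_space op set" where
  "clinear_ops = {T. \<forall>c x. blinfun_apply T (c *\<^sub>C x) = c *\<^sub>C blinfun_apply T x}"

definition scale_op :: "complex \<Rightarrow> 'h::complex_hilbert_space op \<Rightarrow> 'h op" where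
  "scale_op c T = Blinfun (\<lambda>x. c *\<^sub>C blinfun_apply T x)"

definition adjoint_op :: "'h::complex_hilbert_space op \<Rightarrow> 'h op" where
  "adjoint_op T = (THE S. \<forall>x y. cinner (blinfun_apply S x) y = cinner x (blinfun_apply T y))"

definition positive_op :: "'h::complex_hilbert_space op \<Rightarrow> bool" where
  "positive_op T \<longleftrightarrow> (\<forall>x. cinner x (blinfun_apply T x) \<in> \<real>\<^sub>\<ge>\<^sub>0)"

definition row_contraction :: "nat \<Rightarrow> (nat \<Rightarrow> 'h::complex_hilbert_space op) \<Rightarrow> bool" where
  "row_contraction n T \<longleftrightarrow> (\<forall>j<n. T j \<in> clinear_ops) \<and>
     positive_op (id_blinfun - (\<Sum>j<n. T j o\<^sub>L adjoint_op (T j)))"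


section \<open>Operator algebras\<close>

definition unital_operator_algebra :: "'h::complex_hilbert_space op set \<Rightarrow> bool" where
  "unital_operator_algebra A \<longleftrightarrow> A \<subseteq> clinear_ops \<and> closed A \<and> id_blinfun \<in> A \<and>
     (\<forall>S\<in>A. \<forall>T\<in>A. S + T \<in> A \<and> S o\<^sub>L T \<in> A) \<and> (\<forall>c. \<forall>S\<in>A. scale_op c S \<in> A)"

definition generated_algebra :: "'h::complex_hilbert_space op set \<Rightarrow> 'h op set" where
  "generated_algebra G = \<Inter>{A. unital_operator_algebra A \<and> G \<subseteq> A}"

text \<open>The norm of an \<open>N \<times> N\<close> matrix of operators, acting on the Hilbert space direct sum of \<open>N\<close> copies of \<open>H\<close>.\<close>

definition matrix_norm :: "nat \<Rightarrow> (nat \<Rightarrow> nat \<Rightarrow> 'h::complex_hilbert_space op) \<Rightarrow> real" where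
  "matrix_norm N a =
     (SUP \<xi>\<in>{\<xi>. L2_set (\<lambda>l. norm (\<xi> l)) {..<N} \<le> 1}.
        L2_set (\<lambda>k. norm (\<Sum>l<N. blinfun_apply (a k l) (\<xi> l))) {..<N})"

definition unital_hom ::
    "'h::complex_hilbert_space op set \<Rightarrow> ('h op \<Rightarrow> 'g::complex_hilbert_space op) \<Rightarrow> bool" where
  "unital_hom A \<pi> \<longleftrightarrow> \<pi> ` A \<subseteq> clinear_ops \<and> \<pi> id_blinfun = id_blinfun \<and>
     (\<forall>S\<in>A. \<forall>T\<in>A. \<pi> (S + T) = \<pi> S + \<pi> T \<and> \<pi> (S o\<^sub>L T) = \<pi> S o\<^sub>L \<pi> T) \<and>
     (\<forall>c. \<forall>S\<in>A. \<pi> (scale_op c S) = scale_op c (\<pi> S))"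

definition completely_contractive ::
    "'h::complex_hilbert_space op set \<Rightarrow> ('h op \<Rightarrow> 'g::complex_hilbert_space op) \<Rightarrow> bool" where
  "completely_contractive A \<pi> \<longleftrightarrow>
     (\<forall>N a. (\<forall>k<N. \<forall>l<N. a k l \<in> A) \<longrightarrow> matrix_norm N (\<lambda>k l. \<pi> (a k l)) \<le> matrix_norm N a)"

definition completely_isometric ::
    "'h::complex_hilbert_space op set \<Rightarrow> ('h op \<Rightarrow> 'g::complex_hilbert_space op) \<Rightarrow> bool" where
  "completely_isometric A \<pi> \<longleftrightarrow>
     (\<forall>N a. (\<forall>k<N. \<forall>l<N. a k l \<in> A) \<longrightarrow> matrix_norm N (\<lambda>k l. \<pi> (a k l)) = matrix_norm N a)"

definition completely_isometric_iso ::
    "'h::complex_hilbert_space op set \<Rightarrow> 'g::complex_hilbert_space op set \<Rightarrow> ('h op \<Rightarrow> 'g op) \<Rightarrow> bool" where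
  "completely_isometric_iso A B \<phi> \<longleftrightarrow>
     unital_hom A \<phi> \<and> completely_isometric A \<phi> \<and> bij_betw \<phi> A B"


section \<open>Free products of noncommutative disc algebras\<close>

text \<open>
  \<open>is_disc_free_product TYPE('k) m n s A\<close>: the operator algebra \<open>A\<close>, realised on the Hilbert space
  \<open>'h\<close>, is the universal unital operator algebra generated by the \<open>m\<close> row contractions
  \<open>(s i 0, \<dots>, s i (n i - 1))\<close>, \<open>i < m\<close>. The row contractions \<open>T\<close> against which universality is
  required live on the Hilbert space \<open>'k\<close>, which is unrelated to \<open>'h\<close>. The definition is meant
  for infinite-dimensional \<open>'k\<close>: the universal matrix norms of a polynomial in the generators are
  already suprema over row contractions on finite-dimensional spaces, which extend by \<open>0\<close> to
  \<open>'k\<close>, so every infinite-dimensional \<open>'k\<close> yields the same algebras. The homomorphism is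
  automatically unique, see \<open>unital_hom_unique\<close> below.
\<close>

definition is_disc_free_product ::
    "'k::complex_hilbert_space itself \<Rightarrow> nat \<Rightarrow> (nat \<Rightarrow> nat) \<Rightarrow>
     (nat \<Rightarrow> nat \<Rightarrow> 'h::complex_hilbert_space op) \<Rightarrow> 'h op set \<Rightarrow> bool" where
  "is_disc_free_product K m n s A \<longleftrightarrow>
     (\<forall>i<m. row_contraction (n i) (s i)) \<and>
     A = generated_algebra {s i j | i j. i < m \<and> j < n i} \<and>
     (\<forall>T :: nat \<Rightarrow> nat \<Rightarrow> 'k op. (\<forall>i<m. row_contraction (n i) (T i)) \<longrightarrow>
        (\<exists>\<pi>. unital_hom A \<pi> \<and> completely_contractive A \<pi> \<and> (\<forall>i<m. \<forall>j<n i. \<pi> (s i j) = T i j)))"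

definition is_nc_disc_algebra ::
    "'k::complex_hilbert_space itself \<Rightarrow> nat \<Rightarrow> (nat \<Rightarrow> 'h::complex_hilbert_space op) \<Rightarrow> 'h op set \<Rightarrow> bool" where
  "is_nc_disc_algebra K n s A \<longleftrightarrow>
     row_contraction n s \<and>
     A = generated_algebra {s j | j. j < n} \<and>
     (\<forall>T :: nat \<Rightarrow> 'k op. row_contraction n T \<longrightarrow>
        (\<exists>\<pi>. unital_hom A \<pi> \<and> completely_contractive A \<pi> \<and> (\<forall>j<n. \<pi> (s j) = T j)))"

definition free_factor ::
    "(nat \<Rightarrow> nat) \<Rightarrow> (nat \<Rightarrow> nat \<Rightarrow> 'h::complex_hilbert_space op) \<Rightarrow> nat \<Rightarrow> 'h op set" where
  "free_factor n s i = generated_algebra {s i j | j. j < n i}"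


section \<open>Well-definedness\<close>

subsection \<open>Inner products, scaling and adjoints\<close>

lemma cinner_scaleC_left: "cinner (c *\<^sub>C x) y = cnj c * cinner x y"
  by (metis cinner_commute cinner_scaleC_right complex_cnj_mult)

lemma norm_scaleC: "norm (c *\<^sub>C (x::'h::complex_hilbert_space)) = cmod c * norm x"
proof -
  have "cinner (c *\<^sub>C x) (c *\<^sub>C x) = (c * cnj c) * cinner x x"
    by (simp add: cinner_scaleC_left cinner_scaleC_right)
  also have "c * cnj c = complex_of_real ((cmod c)\<^sup>2)"
    by (rule complex_norm_square[symmetric])
  finally have "inner (c *\<^sub>C x) (c *\<^sub>C x) = (cmod c)\<^sup>2 * inner x x"
    by (simp add: inner_eq_Re_cinner del: of_real_power)
  then show ?thesis
    by (simp add: norm_eq_sqrt_inner real_sqrt_mult)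
qed

lemma bounded_linear_scaleC: "bounded_linear (\<lambda>x::'h::complex_hilbert_space. c *\<^sub>C x)"
proof (rule bounded_linear_intro[where K = "cmod c"])
  fix x y :: 'h and r :: real
  show "c *\<^sub>C (x + y) = c *\<^sub>C x + c *\<^sub>C y" by (rule scaleC_add_right)
  show "c *\<^sub>C (r *\<^sub>R x) = r *\<^sub>R (c *\<^sub>C x)"
    by (simp add: scaleR_eq_scaleC scaleC_scaleC mult.commute)
  show "norm (c *\<^sub>C x) \<le> norm x * cmod c" by (simp add: norm_scaleC mult.commute)
qed

lemma scale_op_apply: "blinfun_apply (scale_op c T) x = c *\<^sub>C blinfun_apply T x"
  unfolding scale_op_def
  by (subst bounded_linear_Blinfun_apply)
     (auto intro: bounded_linear_compose[OF bounded_linear_scaleC blinfun.bounded_linear_right])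

lemma cinner_Im: "Im (cinner x y) = - inner x (\<i> *\<^sub>C y)"
  by (simp add: inner_eq_Re_cinner cinner_scaleC_right)

lemma cinner_eqI:
  assumes "\<And>x. inner z x = inner w x" shows "z = w"
proof -
  have "inner (z - w) (z - w) = 0"
    using assms[of "z - w"] by (simp add: inner_diff_left)
  then show ?thesis by simp
qed

text \<open>The Riesz representation theorem, for the underlying real Hilbert space.\<close>

lemma riesz_representation:
  fixes f :: "'a::{real_inner,complete_space} \<Rightarrow> real"
  assumes f: "bounded_linear f"
  shows "\<exists>z. \<forall>x. inner z x = f x"
proof -
  interpret f: bounded_linear f by (rule f)
  define J where "J x = (norm x)\<^sup>2 - 2 * f x" for x
  obtain K where K: "\<And>x. norm (f x) \<le> norm x * K" using f.bounded by blast
  have J_ge: "J x \<ge> - K\<^sup>2" for x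
  proof -
    have "f x \<le> norm x * K" using K[of x] by simp
    moreover have "0 \<le> (norm x - K)\<^sup>2" by simp
    ultimately show ?thesis by (simp add: J_def power2_eq_square algebra_simps)
  qed
  then have bdd: "bdd_below (range J)" by (auto intro!: bdd_belowI)
  define I where "I = (INF x. J x)"
  have I_le: "I \<le> J x" for x unfolding I_def by (rule cINF_lower[OF bdd]) simp
  have "\<exists>x. J x < I + inverse (Suc n)" for n :: nat
    using cINF_less_iff[OF _ bdd, of "I + inverse (Suc n)"] by (auto simp: I_def)
  then obtain u where u: "\<And>n::nat. J (u n) < I + inverse (Suc n)" by metis
  have par: "(norm (a - b))\<^sup>2 \<le> 2 * (J a - I) + 2 * (J b - I)" for a b
  proof -
    have "(norm (a - b))\<^sup>2 = 2 * J a + 2 * J b - 4 * J ((1/2) *\<^sub>R (a + b))"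
      unfolding J_def power2_norm_eq_inner
      by (simp add: f.scaleR f.add inner_add_left inner_add_right inner_diff_left inner_diff_right
          inner_commute field_simps)
    then show ?thesis using I_le[of "(1/2) *\<^sub>R (a + b)"] by simp
  qed
  have "Cauchy u"
  proof (rule metric_CauchyI)
    fix e :: real assume "e > 0"
    then obtain M :: nat where M: "inverse (Suc M) < e\<^sup>2 / 4"
      using reals_Archimedean[of "e\<^sup>2 / 4"] by auto
    have "dist (u p) (u q) < e" if "p \<ge> M" "q \<ge> M" for p q
    proof -
      have "inverse (real (Suc p)) \<le> inverse (real (Suc M))" "inverse (real (Suc q)) \<le> inverse (real (Suc M))"
        using that by (auto intro!: le_imp_inverse_le)
      then have "(norm (u p - u q))\<^sup>2 < e\<^sup>2"
        using par[of "u p" "u q"] u[of p] u[of q] M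
        unfolding right_diff_distrib by argo
      then show ?thesis using \<open>e > 0\<close> by (simp add: dist_norm power2_less_imp_less)
    qed
    then show "\<exists>M. \<forall>m\<ge>M. \<forall>n\<ge>M. dist (u m) (u n) < e" by blast
  qed
  then obtain z where z: "u \<longlonglongrightarrow> z" using convergent_eq_Cauchy by blast
  have "(\<lambda>n. J (u n)) \<longlonglongrightarrow> J z"
    unfolding J_def by (intro tendsto_intros z f.tendsto)
  moreover have "(\<lambda>n. I + inverse (real (Suc n))) \<longlonglongrightarrow> I + 0"
    by (intro tendsto_intros LIMSEQ_inverse_real_of_nat)
  ultimately have "J z \<le> I + 0"
    by (rule LIMSEQ_le) (use u less_imp_le in blast)
  then have min: "J z \<le> J x" for x using I_le[of x] by simp
  have "inner z x = f x" for x
  proof (rule ccontr)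
    assume "inner z x \<noteq> f x"
    define d where "d = inner z x - f x"
    have d: "d \<noteq> 0" using \<open>inner z x \<noteq> f x\<close> by (simp add: d_def)
    define t where "t = - d / (1 + (norm x)\<^sup>2)"
    have pos: "1 + (norm x)\<^sup>2 > 0" by (simp add: add_pos_nonneg)
    have "J (z + t *\<^sub>R x) = J z + 2 * t * d + t\<^sup>2 * (norm x)\<^sup>2"
      unfolding J_def d_def power2_norm_eq_inner
      by (simp add: f.scaleR f.add inner_add_left inner_add_right inner_commute power2_eq_square
          algebra_simps)
    then have "0 \<le> 2 * t * d + t\<^sup>2 * (norm x)\<^sup>2" using min[of "z + t *\<^sub>R x"] by simp
    also have "\<dots> \<le> 2 * t * d + t\<^sup>2 * (1 + (norm x)\<^sup>2)" by (simp add: algebra_simps)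
    also have "\<dots> = t * (2 * d + t * (1 + (norm x)\<^sup>2))"
      by (simp add: power2_eq_square algebra_simps)
    also have "t * (1 + (norm x)\<^sup>2) = - d" using pos by (simp add: t_def)
    also have "t * (2 * d + - d) = - (d\<^sup>2 / (1 + (norm x)\<^sup>2))"
      by (simp add: t_def power2_eq_square)
    also have "\<dots> < 0" using pos d by simp
    finally show False by simp
  qed
  then show ?thesis by blast
qed

lemma cinner_adjoint_op:
  fixes T :: "'h::complex_hilbert_space op"
  assumes T: "T \<in> clinear_ops"
  shows "cinner (blinfun_apply (adjoint_op T) x) y = cinner x (blinfun_apply T y)"
proof -
  have "\<exists>z. \<forall>y. inner z y = inner x (blinfun_apply T y)" for x
    by (rule riesz_representation)
       (intro bounded_linear_compose[OF bounded_linear_inner_right blinfun.bounded_linear_right])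
  then obtain S where S: "\<And>x y. inner (S x) y = inner x (blinfun_apply T y)" by metis
  have "bounded_linear S"
  proof (rule bounded_linear_intro[where K = "norm T"])
    show "S (x + y) = S x + S y" for x y
      by (rule cinner_eqI) (simp add: S inner_add_left)
    show "S (r *\<^sub>R x) = r *\<^sub>R S x" for r x
      by (rule cinner_eqI) (simp add: S)
    show "norm (S x) \<le> norm x * norm T" for x
    proof (cases "S x = 0")
      case False
      have "norm (S x) * norm (S x) = inner x (blinfun_apply T (S x))"
        by (metis S power2_norm_eq_inner power2_eq_square)
      also have "\<dots> \<le> norm x * norm (blinfun_apply T (S x))" by (rule norm_cauchy_schwarz)
      also have "\<dots> \<le> norm x * (norm T * norm (S x))"
        by (intro mult_left_mono norm_blinfun) auto
      finally show ?thesis using False by simp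
    qed simp
  qed
  then have S_app: "blinfun_apply (Blinfun S) = S" by (rule bounded_linear_Blinfun_apply)
  have "\<forall>x y. cinner (blinfun_apply (Blinfun S) x) y = cinner x (blinfun_apply T y)"
  proof (intro allI complex_eqI)
    fix x y
    show "Re (cinner (blinfun_apply (Blinfun S) x) y) = Re (cinner x (blinfun_apply T y))"
      using S[of x y] by (simp add: S_app inner_eq_Re_cinner)
    show "Im (cinner (blinfun_apply (Blinfun S) x) y) = Im (cinner x (blinfun_apply T y))"
      using S[of x "\<i> *\<^sub>C y"] T by (simp add: S_app cinner_Im clinear_ops_def)
  qed
  moreover have "S' = Blinfun S"
    if "\<forall>x y. cinner (blinfun_apply S' x) y = cinner x (blinfun_apply T y)" for S'
  proof (rule blinfun_eqI, rule cinner_eqI)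
    fix x y
    have "inner (blinfun_apply S' x) y = inner x (blinfun_apply T y)"
      by (simp add: inner_eq_Re_cinner that)
    then show "inner (blinfun_apply S' x) y = inner (blinfun_apply (Blinfun S) x) y"
      by (simp add: S_app S)
  qed
  ultimately have "\<exists>!S. \<forall>x y. cinner (blinfun_apply S x) y = cinner x (blinfun_apply T y)"
    by blast
  from theI'[OF this] show ?thesis unfolding adjoint_op_def by blast
qed


subsection \<open>Generated algebras\<close>

lemma unital_operator_algebra_clinear_ops:
  "unital_operator_algebra (clinear_ops :: 'h::complex_hilbert_space op set)"
proof -
  have "clinear_ops = (\<Inter>c. \<Inter>x. {T::'h op. blinfun_apply T (c *\<^sub>C x) = c *\<^sub>C blinfun_apply T x})"
    by (auto simp: clinear_ops_def)
  also have "closed \<dots>"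
    by (intro closed_INT ballI closed_Collect_eq continuous_intros
        bounded_linear.continuous_on[OF bounded_linear_scaleC])
  finally have "closed (clinear_ops :: 'h op set)" .
  then show ?thesis
    unfolding unital_operator_algebra_def
    by (auto simp: clinear_ops_def blinfun.add_left scaleC_add_right scale_op_apply scaleC_scaleC mult.commute)
qed

lemma generated_algebra_subset: "G \<subseteq> generated_algebra G"
  by (auto simp: generated_algebra_def)

lemma generated_algebra_minimal:
  "unital_operator_algebra A \<Longrightarrow> G \<subseteq> A \<Longrightarrow> generated_algebra G \<subseteq> A"
  by (auto simp: generated_algebra_def)

lemma unital_operator_algebra_generated:
  assumes "G \<subseteq> clinear_ops"
  shows "unital_operator_algebra (generated_algebra G)"
  unfolding unital_operator_algebra_def
proof (intro conjI ballI allI)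
  show "generated_algebra G \<subseteq> clinear_ops"
    by (rule generated_algebra_minimal[OF unital_operator_algebra_clinear_ops assms])
  show "closed (generated_algebra G)"
    unfolding generated_algebra_def by (auto simp: unital_operator_algebra_def)
qed (auto simp: generated_algebra_def unital_operator_algebra_def)


subsection \<open>Uniqueness in the universal property\<close>

lemma matrix_norm_1: "matrix_norm 1 a = norm (a 0 0 :: 'h::complex_hilbert_space op)"
proof -
  have eq: "matrix_norm 1 a = (SUP \<xi>\<in>{\<xi>. norm (\<xi> (0::nat)) \<le> 1}. norm (blinfun_apply (a 0 0) (\<xi> 0)))"
    by (simp add: matrix_norm_def L2_set_def lessThan_Suc)
  have ne: "{\<xi>. norm (\<xi> (0::nat) :: 'h) \<le> 1} \<noteq> {}"
    by (auto intro!: exI[of _ "\<lambda>_. 0"])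
  have le: "norm (blinfun_apply (a 0 0) (\<xi> 0)) \<le> norm (a 0 0)" if "norm (\<xi> (0::nat)) \<le> 1" for \<xi>
    using norm_blinfun[of "a 0 0" "\<xi> 0"] mult_left_mono[OF that, of "norm (a 0 0)"] by simp
  let ?M = "matrix_norm 1 a"
  have bdd: "bdd_above ((\<lambda>\<xi>. norm (blinfun_apply (a 0 0) (\<xi> 0))) ` {\<xi>. norm (\<xi> (0::nat)) \<le> 1})"
    using le by (auto intro!: bdd_aboveI[of _ "norm (a 0 0)"])
  have ge: "norm (blinfun_apply (a 0 0) x) \<le> ?M" if "norm x \<le> 1" for x
    unfolding eq by (rule cSUP_upper2[OF bdd, of "\<lambda>_. x"]) (use that in auto)
  have "norm (a 0 0) \<le> ?M"
  proof (rule norm_blinfun_bound)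
    show "0 \<le> ?M" using ge[of 0] by simp
    fix x
    show "norm (blinfun_apply (a 0 0) x) \<le> ?M * norm x"
    proof (cases "x = 0")
      case False
      then show ?thesis
        using ge[of "inverse (norm x) *\<^sub>R x"] by (simp add: blinfun.scaleR_right field_simps)
    qed simp
  qed
  moreover have "?M \<le> norm (a 0 0)"
    unfolding eq by (rule cSUP_least[OF ne]) (use le in auto)
  ultimately show ?thesis by simp
qed

lemma completely_contractive_norm_le:
  assumes "completely_contractive A \<pi>" "a \<in> A"
  shows "norm (\<pi> a) \<le> norm a"
proof -
  have "matrix_norm 1 (\<lambda>k l. \<pi> ((\<lambda>_ _. a) k l)) \<le> matrix_norm 1 (\<lambda>_ _. a)"
    using assms(1)[unfolded completely_contractive_def, rule_format, of 1 "\<lambda>_ _. a"] assms(2)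
    by simp
  then show ?thesis by (simp only: matrix_norm_1)
qed

lemma scale_op_minus_one: "scale_op (-1) T = - T"
  by (rule blinfun_eqI)
     (metis (no_types) scale_op_apply of_real_1 of_real_minus scaleR_eq_scaleC scaleR_minus1_left blinfun.minus_left)

lemma unital_hom_unique:
  fixes \<pi> \<pi>' :: "'h::complex_hilbert_space op \<Rightarrow> 'g::complex_hilbert_space op"
  assumes G: "G \<subseteq> clinear_ops"
    and hom: "unital_hom (generated_algebra G) \<pi>" "unital_hom (generated_algebra G) \<pi>'"
    and cc: "completely_contractive (generated_algebra G) \<pi>"
      "completely_contractive (generated_algebra G) \<pi>'"
    and gens: "\<And>g. g \<in> G \<Longrightarrow> \<pi> g = \<pi>' g"
    and a: "a \<in> generated_algebra G"
  shows "\<pi> a = \<pi>' a"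
proof -
  let ?A = "generated_algebra G"
  note alg = unital_operator_algebra_generated[OF G, unfolded unital_operator_algebra_def]
  have cont: "continuous_on ?A \<rho>" if "unital_hom ?A \<rho>" "completely_contractive ?A \<rho>"
    for \<rho> :: "'h op \<Rightarrow> 'g op"
  proof (rule continuous_on_iff[THEN iffD2], intro ballI allI impI)
    fix x and e :: real assume x: "x \<in> ?A" and e: "0 < e"
    have "dist (\<rho> y) (\<rho> x) \<le> dist y x" if y: "y \<in> ?A" for y
    proof -
      have mx: "- x \<in> ?A" using alg x by (metis scale_op_minus_one)
      have "\<rho> (- x) = - \<rho> x"
        using \<open>unital_hom ?A \<rho>\<close> x unfolding unital_hom_def by (metis scale_op_minus_one)
      then have "\<rho> (y - x) = \<rho> y - \<rho> x"
        using \<open>unital_hom ?A \<rho>\<close> mx y unfolding unital_hom_def by (metis diff_conv_add_uminus)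
      moreover have "y - x \<in> ?A" using alg mx y by (metis diff_conv_add_uminus)
      ultimately show ?thesis
        using completely_contractive_norm_le[OF \<open>completely_contractive ?A \<rho>\<close>, of "y - x"]
        by (simp add: dist_norm)
    qed
    then show "\<exists>d>0. \<forall>y\<in>?A. dist y x < d \<longrightarrow> dist (\<rho> y) (\<rho> x) < e"
      using e by (meson le_less_trans)
  qed
  define E where "E = {x \<in> ?A. \<pi> x - \<pi>' x = 0}"
  have "closed E"
  proof -
    have "continuous_on ?A (\<lambda>x. \<pi> x - \<pi>' x)"
      by (intro continuous_on_diff cont hom cc)
    moreover have "closed ?A" using alg by blast
    ultimately show ?thesis unfolding E_def by (rule continuous_closed_preimage_constant)
  qed
  moreover have "E \<subseteq> ?A" by (auto simp: E_def)
  moreover have "id_blinfun \<in> E"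
    using alg hom by (simp add: E_def unital_hom_def)
  moreover have "S + T \<in> E \<and> S o\<^sub>L T \<in> E" if "S \<in> E" "T \<in> E" for S T
    using alg hom that by (simp add: E_def unital_hom_def)
  moreover have "scale_op c S \<in> E" if "S \<in> E" for c S
    using alg hom that by (simp add: E_def unital_hom_def)
  ultimately have "unital_operator_algebra E"
    unfolding unital_operator_algebra_def using alg by (meson subset_trans)
  moreover have "G \<subseteq> E" using gens generated_algebra_subset by (auto simp: E_def)
  ultimately show ?thesis
    using generated_algebra_minimal[of E G] a by (auto simp: E_def)
qed


subsection \<open>The free factors are noncommutative disc algebras\<close>

lemma row_contraction_0: "row_contraction n (\<lambda>_. 0 :: 'h::complex_hilbert_space op)"
proof -
  have "cinner x x \<in> \<real>\<^sub>\<ge>\<^sub>0" for x :: 'h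
  proof -
    have "Im (cinner x x) = 0" using cinner_commute[of x x] by (metis cnj.simps(2) equal_neg_zero)
    moreover have "Re (cinner x x) \<ge> 0" by (simp flip: inner_eq_Re_cinner)
    ultimately show ?thesis by (simp add: complex_nonneg_Reals_iff)
  qed
  moreover have "c *\<^sub>C (0::'h) = 0" for c
    using norm_scaleC[of c "0::'h"] by simp
  ultimately show ?thesis
    by (simp add: row_contraction_def positive_op_def clinear_ops_def)
qed

lemma free_factor_is_nc_disc_algebra:
  fixes s :: "nat \<Rightarrow> nat \<Rightarrow> 'h::complex_hilbert_space op"
  assumes fp: "is_disc_free_product (K :: 'k::complex_hilbert_space itself) m n s A" and i: "i < m"
  shows "is_nc_disc_algebra K (n i) (s i) (free_factor n s i)"
proof -
  let ?G = "{s i j | i j. i < m \<and> j < n i}"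
  have A: "A = generated_algebra ?G" and rows: "\<forall>i<m. row_contraction (n i) (s i)"
    using fp by (auto simp: is_disc_free_product_def)
  have "?G \<subseteq> clinear_ops" using rows by (auto simp: row_contraction_def)
  then have "unital_operator_algebra A" unfolding A by (rule unital_operator_algebra_generated)
  then have sub: "free_factor n s i \<subseteq> A"
    unfolding free_factor_def
    by (rule generated_algebra_minimal) (use A i generated_algebra_subset[of ?G] in auto)
  have "\<exists>\<pi>. unital_hom (free_factor n s i) \<pi> \<and> completely_contractive (free_factor n s i) \<pi> \<and>
          (\<forall>j<n i. \<pi> (s i j) = T j)"
    if T: "row_contraction (n i) T" for T :: "nat \<Rightarrow> 'k op"
  proof -
    let ?T = "\<lambda>i'. if i' = i then T else (\<lambda>_. 0)"
    have "\<forall>i'<m. row_contraction (n i') (?T i')" using T row_contraction_0 by auto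
    then obtain \<pi> where \<pi>: "unital_hom A \<pi>" "completely_contractive A \<pi>"
      "\<forall>i'<m. \<forall>j<n i'. \<pi> (s i' j) = ?T i' j"
      using fp[unfolded is_disc_free_product_def, THEN conjunct2, THEN conjunct2, THEN spec, of ?T]
      by blast
    have "unital_hom (free_factor n s i) \<pi>"
      using \<pi>(1) sub unfolding unital_hom_def by blast
    moreover have "completely_contractive (free_factor n s i) \<pi>"
      using \<pi>(2) sub unfolding completely_contractive_def by blast
    ultimately show ?thesis using \<pi>(3) i by auto
  qed
  then show ?thesis
    using rows i by (auto simp: is_nc_disc_algebra_def free_factor_def)
qed

end

theory Submission
  imports Defs "HOL-Complex_Analysis.Complex_Analysis"
begin

text \<open>
  Compressing row contractions to finite-dimensional spaces shows that universality on one
  infinite-dimensional Hilbert space implies universality on all of them, so the free product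
  carries the gauge endomorphisms \<open>s \<mapsto> z s\<close>, Moebius automorphisms of the single factors, and the
  characters given by the points of a product of closed balls. By the maximum modulus principle, an
  isomorphism \<open>\<phi>\<close> pulls the character \<open>\<epsilon>\<close> killing all generators back to an interior point, and
  composing with Moebius automorphisms we may assume \<open>\<epsilon> \<circ> \<phi> = \<epsilon>\<close>. Cartan's uniqueness argument,
  applied to the powers of \<open>ker \<epsilon>\<close>, then shows that \<open>\<phi>\<close> commutes with the gauge action, hence is linear on the
  span of the generators. That span is the \<open>\<ell>\<^sup>1\<close>-sum of the Hilbert spaces spanned by the rows, and
  the isometries of such a sum permute the summands.
\<close>

section \<open>Hilbert space preliminaries\<close>

text \<open>The argument runs on norms of single operators; matrix norms return only at the end,
  where complete isometry is inherited by restrictions. The obstacle is that an isomorphism knows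
  nothing of generators or degrees. What it carries along, once it preserves the base character
  \<open>eps\<close>, is the filtration \<open>ipow\<close>, made from \<open>eps\<close>, products,
  spans and closures alone. Cartan's argument takes place in this filtration and needs it to be
  separated. That comes from the gauge action: averaging over roots of unity bounds each homogeneous
  component by the norm of the whole, hence \<open>gauge r\<close> with \<open>r < 1\<close> decays
  geometrically on terms of high degree. The base point is moved one generator at a time, because a
  Moebius map in one coordinate keeps the coordinates that already vanish; the strict inequality
  \<open>cmod (eps X) < 1\<close> is what makes this map available. These maps preserve every free
  factor, so inclusions of factors proved for the corrected isomorphism go back to the given one.
  The same inclusions for the inverse turn them into equalities and the assignment of factors into a
  bijection.\<close>

instance complex_hilbert_space \<subseteq> banach ..

lemma scaleC_one [simp]: "1 *\<^sub>C (x::'h::complex_hilbert_space) = x"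
  by (metis of_real_1 scaleR_eq_scaleC scaleR_one)

lemma scaleC_zero_left [simp]: "0 *\<^sub>C (x::'h::complex_hilbert_space) = 0"
  by (metis norm_eq_zero norm_scaleC norm_zero mult_zero_left)

lemma scaleC_zero_right [simp]: "c *\<^sub>C (0::'h::complex_hilbert_space) = 0"
  by (metis norm_eq_zero norm_scaleC norm_zero mult_zero_right)

lemma scaleC_diff_right: "c *\<^sub>C (x - y) = c *\<^sub>C x - c *\<^sub>C (y::'h::complex_hilbert_space)"
  by (rule linear_diff[OF bounded_linear.linear[OF bounded_linear_scaleC]])

lemma scaleC_sum_right: "c *\<^sub>C sum f S = (\<Sum>i\<in>S. c *\<^sub>C (f i::'h::complex_hilbert_space))"
  by (rule linear_sum[OF bounded_linear.linear[OF bounded_linear_scaleC]])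

lemma cinner_add_left: "cinner (x + y) z = cinner x z + cinner y z"
  by (metis cinner_add_right cinner_commute complex_cnj_add)

lemma cinner_zero_right [simp]: "cinner x 0 = 0"
  using cinner_add_right[of x 0 0] by simp

lemma cinner_zero_left [simp]: "cinner 0 x = 0"
  using cinner_add_left[of 0 0 x] by simp

lemma cinner_diff_right: "cinner x (y - z) = cinner x y - cinner x z"
  using cinner_add_right[of x "y - z" z] by simp

lemma cinner_diff_left: "cinner (x - y) z = cinner x z - cinner y z"
  using cinner_add_left[of "x - y" y z] by simp

lemma cinner_sum_right: "cinner x (sum f S) = (\<Sum>i\<in>S. cinner x (f i))"
  by (induction S rule: infinite_finite_induct) (auto simp: cinner_add_right)

lemma cinner_sum_left: "cinner (sum f S) x = (\<Sum>i\<in>S. cinner (f i) x)"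
  by (induction S rule: infinite_finite_induct) (auto simp: cinner_add_left)

lemma cinner_self: "cinner x x = complex_of_real ((norm (x::'h::complex_hilbert_space))\<^sup>2)"
proof (rule complex_eqI)
  show "Re (cinner x x) = Re (complex_of_real ((norm x)\<^sup>2))"
    by (simp add: power2_norm_eq_inner inner_eq_Re_cinner)
  show "Im (cinner x x) = Im (complex_of_real ((norm x)\<^sup>2))"
    using cinner_commute[of x x] by (metis Im_complex_of_real cnj.simps(2) equal_neg_zero)
qed

lemma norm_cinner_le: "cmod (cinner x y) \<le> norm x * norm (y::'h::complex_hilbert_space)"
proof (cases "cinner x y = 0")
  case False
  \<comment> \<open>A phase: multiplying \<open>y\<close> by \<open>u\<close> makes the inner
    product equal to its modulus, which reduces the claim to the real Cauchy-Schwarz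
    inequality.\<close>
  define u where "u = cnj (cinner x y) / cmod (cinner x y)"
  have u: "cmod u = 1" using False by (simp add: u_def norm_divide)
  have "complex_of_real (cmod (cinner x y)) = u * cinner x y"
    using False complex_norm_square[of "cinner x y"]
    by (simp add: u_def field_simps power2_eq_square)
  then have "cmod (cinner x y) = inner x (u *\<^sub>C y)"
    by (metis Re_complex_of_real cinner_scaleC_right inner_eq_Re_cinner)
  also have "\<dots> \<le> norm x * norm (u *\<^sub>C y)" by (rule norm_cauchy_schwarz)
  finally show ?thesis by (simp add: norm_scaleC u)
qed simp

lemma norm_le_cinner_bound:
  fixes x :: "'h::complex_hilbert_space"
  assumes "\<And>y. cmod (cinner y x) \<le> C * norm y" "0 \<le> C"
  shows "norm x \<le> C"
proof (cases "x = 0")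
  case False
  have "norm x * norm x \<le> C * norm x"
    using assms(1)[of x] by (simp add: cinner_self norm_power power2_eq_square norm_mult)
  then show ?thesis using False by simp
qed (use assms in simp)

section \<open>Finite orthonormal families and transport between Hilbert spaces\<close>

definition orthonormal :: "nat \<Rightarrow> (nat \<Rightarrow> 'h::complex_hilbert_space) \<Rightarrow> bool" where
  "orthonormal M e \<longleftrightarrow> (\<forall>k<M. \<forall>l<M. cinner (e k) (e l) = (if k = l then 1 else 0))"

text \<open>For orthonormal families this is the partial isometry carrying \<open>e l\<close> to
  \<open>f l\<close>. With \<open>f = e\<close> it is the orthogonal projection onto the complex
  span of \<open>e\<close>, so \<open>onb_map M e e x = x\<close> is how membership in that span is
  expressed throughout.\<close>

definition onb_map :: "nat \<Rightarrow> (nat \<Rightarrow> 'h::complex_hilbert_space) \<Rightarrow> (nat \<Rightarrow> 'g::complex_hilbert_space) \<Rightarrow> 'h \<Rightarrow> 'g" where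
  "onb_map M e f x = (\<Sum>l<M. cinner (e l) x *\<^sub>C f l)"

lemma onb_map_add: "onb_map M e f (x + y) = onb_map M e f x + onb_map M e f y"
  by (simp add: onb_map_def cinner_add_right scaleC_add_left sum.distrib)

lemma onb_map_scaleC: "onb_map M e f (c *\<^sub>C x) = c *\<^sub>C onb_map M e f x"
  by (simp add: onb_map_def cinner_scaleC_right scaleC_sum_right scaleC_scaleC)

lemma cinner_onb_map: "cinner (onb_map M e f x) y = cinner x (onb_map M f e y)"
  by (simp add: onb_map_def cinner_sum_left cinner_sum_right cinner_scaleC_left cinner_scaleC_right)
    (metis (no_types, lifting) cinner_commute mult.commute)

lemma cinner_orthonormal_onb_map:
  assumes "orthonormal M f" "k < M"
  shows "cinner (f k) (onb_map M e f x) = cinner (e k) x"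
proof -
  have "cinner (f k) (onb_map M e f x) = (\<Sum>l<M. cinner (e l) x * (if k = l then 1 else 0))"
    unfolding onb_map_def cinner_sum_right cinner_scaleC_right
    by (rule sum.cong) (use assms in \<open>auto simp: orthonormal_def\<close>)
  also have "\<dots> = (\<Sum>l<M. if l = k then cinner (e l) x else 0)"
    by (rule sum.cong) auto
  finally show ?thesis using assms(2) by simp
qed

lemma onb_map_comp:
  assumes "orthonormal M f"
  shows "onb_map M f g (onb_map M e f x) = onb_map M e g x"
  unfolding onb_map_def[of M f g] onb_map_def[of M e g]
  by (rule sum.cong) (simp_all add: cinner_orthonormal_onb_map[OF assms])

lemma norm_onb_map_eq:
  assumes "orthonormal M f" "onb_map M e e x = x"
  shows "norm (onb_map M e f x) = norm x"
proof -
  have "complex_of_real ((norm (onb_map M e f x))\<^sup>2) = complex_of_real ((norm x)\<^sup>2)"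
    unfolding cinner_self[symmetric] cinner_onb_map onb_map_comp[OF assms(1)] assms(2) ..
  then show ?thesis unfolding of_real_eq_iff by simp
qed

text \<open>The map factors through the projection \<open>p\<close> of \<open>x\<close> onto the
  span of \<open>e\<close>, where it is isometric, and \<open>cinner p p = cinner p x\<close> makes
  \<open>p\<close> no longer than \<open>x\<close>.\<close>

lemma norm_onb_map_le:
  assumes e: "orthonormal M e" and f: "orthonormal M f"
  shows "norm (onb_map M e f x) \<le> norm x"
proof -
  define p where "p = onb_map M e e x"
  have pp: "onb_map M e e p = p" unfolding p_def by (rule onb_map_comp[OF e])
  have "cinner p p = cinner p x"
    unfolding p_def by (metis cinner_onb_map p_def pp)
  then have "(norm p)\<^sup>2 = inner p x"
    by (metis Re_complex_of_real cinner_self inner_eq_Re_cinner)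
  also have "\<dots> \<le> norm p * norm x" by (rule norm_cauchy_schwarz)
  finally have "norm p \<le> norm x"
    by (cases "norm p = 0") (auto simp: power2_eq_square)
  moreover have "onb_map M e f x = onb_map M e f p"
    unfolding p_def by (rule onb_map_comp[OF e, symmetric])
  ultimately show ?thesis using norm_onb_map_eq[OF f pp] by simp
qed

lemma bounded_linear_onb_map:
  assumes "orthonormal M e" "orthonormal M f"
  shows "bounded_linear (onb_map M e f)"
  by (rule bounded_linear_intro[where K = 1])
    (use norm_onb_map_le[OF assms] in \<open>auto simp: onb_map_add scaleR_eq_scaleC onb_map_scaleC\<close>)

text \<open>One Gram-Schmidt step. The middle conjunct keeps the vectors that already lie in the
  span, so that vectors can be absorbed one after another.\<close>

lemma orthonormal_extend:
  fixes v :: "'h::complex_hilbert_space"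
  assumes e: "orthonormal M e" and v: "onb_map M e e v \<noteq> v"
  shows "\<exists>u. orthonormal (Suc M) (e(M := u)) \<and>
           (\<forall>x. onb_map M e e x = x \<longrightarrow> onb_map (Suc M) (e(M := u)) (e(M := u)) x = x) \<and>
           onb_map (Suc M) (e(M := u)) (e(M := u)) v = v"
proof -
  define p where "p = onb_map M e e v"
  define r where "r = v - p"
  define u where "u = complex_of_real (inverse (norm r)) *\<^sub>C r"
  let ?e = "e(M := u)"
  have r0: "r \<noteq> 0" using v by (simp add: r_def p_def)
  have er: "cinner (e k) r = 0" if "k < M" for k
    using cinner_orthonormal_onb_map[OF e that, of e v] by (simp add: r_def p_def cinner_diff_right)
  then have eu: "cinner (e k) u = 0" if "k < M" for k
    using that by (simp add: u_def cinner_scaleC_right)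
  then have ue: "cinner u (e k) = 0" if "k < M" for k
    using that by (metis cinner_commute complex_cnj_zero)
  have "norm u = 1" using r0 by (simp add: u_def norm_scaleC norm_inverse)
  then have uu: "cinner u u = 1" by (simp add: cinner_self)
  have on: "orthonormal (Suc M) ?e"
    using e eu ue uu by (auto simp: orthonormal_def less_Suc_eq)
  have expand: "onb_map (Suc M) ?e ?e x = onb_map M e e x + cinner u x *\<^sub>C u" for x
    by (simp add: onb_map_def)
  have ux: "cinner u x = 0" if "onb_map M e e x = x" for x
  proof -
    have "cinner u (onb_map M e e x) = 0"
      unfolding onb_map_def by (simp add: cinner_sum_right cinner_scaleC_right ue)
    then show ?thesis using that by simp
  qed
  have fixp: "onb_map M e e p = p" unfolding p_def by (rule onb_map_comp[OF e])
  have "r = complex_of_real (norm r) *\<^sub>C u"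
    using r0 by (simp add: u_def scaleC_scaleC)
  then have "cinner u r *\<^sub>C u = r"
    by (metis cinner_scaleC_right mult.right_neutral uu)
  then have "cinner u v *\<^sub>C u = r"
    using ux[OF fixp] by (simp add: r_def cinner_diff_right)
  then have "onb_map (Suc M) ?e ?e v = v"
    by (simp add: expand p_def[symmetric] r_def)
  then show ?thesis using on ux expand by (intro exI[of _ u]) auto
qed

lemma finite_orthonormal_span:
  fixes S :: "'h::complex_hilbert_space set"
  assumes "finite S"
  shows "\<exists>M e. orthonormal M e \<and> (\<forall>x\<in>S. onb_map M e e x = x)"
  using assms
proof (induction S)
  case empty
  then show ?case by (intro exI[of _ 0]) (simp add: orthonormal_def)
next
  case (insert v S)
  then obtain M e where e: "orthonormal M e" "\<forall>x\<in>S. onb_map M e e x = x" by blast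
  show ?case
  proof (cases "onb_map M e e v = v")
    case False
    then obtain u where "orthonormal (Suc M) (e(M := u))"
      "\<forall>x. onb_map M e e x = x \<longrightarrow> onb_map (Suc M) (e(M := u)) (e(M := u)) x = x"
      "onb_map (Suc M) (e(M := u)) (e(M := u)) v = v"
      using orthonormal_extend[OF e(1) False] by blast
    then have "orthonormal (Suc M) (e(M := u)) \<and>
        (\<forall>x\<in>insert v S. onb_map (Suc M) (e(M := u)) (e(M := u)) x = x)"
      using e(2) by blast
    then show ?thesis by blast
  qed (use e in blast)
qed

lemma infinite_dim_orthonormal:
  assumes "\<forall>S::'k::complex_hilbert_space set. finite S \<longrightarrow> span S \<noteq> UNIV"
  shows "\<exists>f::nat \<Rightarrow> 'k. orthonormal M f"
proof (induction M)
  case 0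
  then show ?case by (simp add: orthonormal_def)
next
  case (Suc M)
  then obtain f :: "nat \<Rightarrow> 'k" where f: "orthonormal M f" by blast
  \<comment> \<open>\<open>span\<close> is the real span, so each \<open>f l\<close> is accompanied
    by its multiple by the imaginary unit.\<close>
  define S where "S = f ` {..<M} \<union> (\<lambda>l. \<i> *\<^sub>C f l) ` {..<M}"
  have "onb_map M f f x \<in> span S" for x
  proof -
    have "cinner (f l) x *\<^sub>C f l =
        Re (cinner (f l) x) *\<^sub>R f l + Im (cinner (f l) x) *\<^sub>R (\<i> *\<^sub>C f l)" for l
      unfolding scaleR_eq_scaleC scaleC_scaleC scaleC_add_left[symmetric]
      by (metis complex_eq mult.commute)
    moreover have "f l \<in> span S" "\<i> *\<^sub>C f l \<in> span S" if "l < M" for l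
      using that by (auto intro!: span_base simp: S_def)
    ultimately show ?thesis
      unfolding onb_map_def by (auto intro!: span_sum span_add intro: span_scale)
  qed
  moreover have "finite S" by (simp add: S_def)
  then obtain v where "v \<notin> span S" using assms by blast
  ultimately have "onb_map M f f v \<noteq> v" by metis
  then show ?case using orthonormal_extend[OF f] by blast
qed

section \<open>Bounded operators and row contractions\<close>

lemma clinear_opsD: "T \<in> clinear_ops \<Longrightarrow> T (c *\<^sub>C x) = c *\<^sub>C T x"
  by (simp add: clinear_ops_def)

lemma adjoint_op_eqI:
  assumes "\<And>x y. cinner (blinfun_apply S x) y = cinner x (blinfun_apply T y)"
  shows "adjoint_op T = S"
  unfolding adjoint_op_def
proof (rule the_equality)
  fix S' assume S': "\<forall>x y. cinner (blinfun_apply S' x) y = cinner x (blinfun_apply T y)"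
  show "S' = S"
    by (rule blinfun_eqI, rule cinner_eqI) (simp add: inner_eq_Re_cinner S' assms)
qed (use assms in blast)

text \<open>Pairing \<open>T j (adjoint_op (T j) x)\<close> with \<open>x\<close> gives the square
  of the norm of \<open>adjoint_op (T j) x\<close>, so positivity says that the column of adjoints
  is a contraction. This is the form in which row contractions are checked and used below.\<close>

lemma row_contraction_iff:
  fixes T :: "nat \<Rightarrow> 'h::complex_hilbert_space op"
  shows "row_contraction n T \<longleftrightarrow> (\<forall>j<n. T j \<in> clinear_ops) \<and>
     (\<forall>x. (\<Sum>j<n. (norm (adjoint_op (T j) x))\<^sup>2) \<le> (norm x)\<^sup>2)"
proof -
  have "positive_op (id_blinfun - (\<Sum>j<n. T j o\<^sub>L adjoint_op (T j))) \<longleftrightarrow>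
      (\<forall>x. (\<Sum>j<n. (norm (adjoint_op (T j) x))\<^sup>2) \<le> (norm x)\<^sup>2)" if T: "\<forall>j<n. T j \<in> clinear_ops"
  proof -
    have "cinner x (blinfun_apply (id_blinfun - (\<Sum>j<n. T j o\<^sub>L adjoint_op (T j))) x) =
        complex_of_real ((norm x)\<^sup>2 - (\<Sum>j<n. (norm (adjoint_op (T j) x))\<^sup>2))" for x
    proof -
      have "cinner x (T j (adjoint_op (T j) x)) = complex_of_real ((norm (adjoint_op (T j) x))\<^sup>2)"
        if "j < n" for j
        using T that by (metis cinner_adjoint_op cinner_self)
      then show ?thesis
        by (simp add: blinfun.diff_left blinfun.sum_left cinner_diff_right cinner_sum_right cinner_self)
    qed
    then show ?thesis
      unfolding positive_op_def
      by (simp add: complex_nonneg_Reals_iff del: of_real_diff)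
  qed
  then show ?thesis unfolding row_contraction_def by blast
qed

section \<open>Complex scaling of operators and closed operator algebras\<close>

lemma scale_op_add_right: "scale_op c (S + T) = scale_op c S + scale_op c T"
  by (rule blinfun_eqI) (simp add: scale_op_apply blinfun.add_left scaleC_add_right)

lemma scale_op_diff_right: "scale_op c (S - T) = scale_op c S - scale_op c T"
  by (rule blinfun_eqI) (simp add: scale_op_apply blinfun.diff_left scaleC_diff_right)

lemma scale_op_add_left: "scale_op (c + d) T = scale_op c T + scale_op d T"
  by (rule blinfun_eqI) (simp add: scale_op_apply blinfun.add_left scaleC_add_left)

lemma scale_op_scale_op [simp]: "scale_op c (scale_op d T) = scale_op (c * d) T"
  by (rule blinfun_eqI) (simp add: scale_op_apply scaleC_scaleC)

lemma scale_op_one [simp]: "scale_op 1 T = T"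
  by (rule blinfun_eqI) (simp add: scale_op_apply)

lemma scale_op_zero_left [simp]: "scale_op 0 T = 0"
  by (rule blinfun_eqI) (simp add: scale_op_apply)

lemma scale_op_zero_right [simp]: "scale_op c 0 = 0"
  by (rule blinfun_eqI) (simp add: scale_op_apply)

lemma scale_op_minus_left: "scale_op (- c) T = - scale_op c T"
  by (metis mult_minus1 scale_op_minus_one scale_op_scale_op)

lemma scale_op_diff_left: "scale_op (c - d) T = scale_op c T - scale_op d T"
  by (metis diff_conv_add_uminus scale_op_add_left scale_op_minus_left)

lemma scale_op_sum_right: "scale_op c (sum f S) = (\<Sum>i\<in>S. scale_op c (f i))"
  by (induction S rule: infinite_finite_induct) (auto simp: scale_op_add_right)

lemma scale_op_sum_left: "scale_op (sum f S) T = (\<Sum>i\<in>S. scale_op (f i) T)"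
  by (induction S rule: infinite_finite_induct) (auto simp: scale_op_add_left)

lemma scaleR_eq_scale_op: "r *\<^sub>R T = scale_op (complex_of_real r) T"
  by (rule blinfun_eqI) (simp add: scale_op_apply blinfun.scaleR_left scaleR_eq_scaleC)

lemma norm_scale_op: "norm (scale_op c T) = cmod c * norm (T::'h::complex_hilbert_space op)"
proof -
  have le: "norm (scale_op c T) \<le> cmod c * norm T" for c and T :: "'h op"
  proof (rule norm_blinfun_bound)
    show "norm (scale_op c T x) \<le> cmod c * norm T * norm x" for x
      using mult_left_mono[OF norm_blinfun[of T x], of "cmod c"]
      by (simp add: scale_op_apply norm_scaleC mult.assoc)
  qed simp
  show ?thesis
  proof (cases "c = 0")
    case False
    have "norm T = norm (scale_op (inverse c) (scale_op c T))" using False by simp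
    also have "\<dots> \<le> inverse (cmod c) * norm (scale_op c T)"
      using le[of "inverse c" "scale_op c T"] by (simp add: norm_inverse)
    finally have "cmod c * norm T \<le> norm (scale_op c T)" using False by (simp add: field_simps)
    then show ?thesis using le[of c T] by simp
  qed simp
qed

lemma bounded_linear_scale_op: "bounded_linear (scale_op c :: 'h::complex_hilbert_space op \<Rightarrow> _)"
  by (rule bounded_linear_intro[where K = "cmod c"])
    (auto simp: scale_op_add_right scaleR_eq_scale_op norm_scale_op mult.commute)

lemma bounded_linear_scale_op_left: "bounded_linear (\<lambda>c. scale_op c (T :: 'h::complex_hilbert_space op))"
  by (rule bounded_linear_intro[where K = "norm T"])
    (auto simp: scale_op_add_left scaleR_eq_scale_op norm_scale_op scaleR_conv_of_real)

lemma scale_op_compose_left [simp]: "scale_op c S o\<^sub>L T = scale_op c (S o\<^sub>L T)"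
  by (rule blinfun_eqI) (simp add: scale_op_apply)

text \<open>Elements of \<open>'h op\<close> are only real-linear, so complex linearity of the outer
  factor has to be assumed here, unlike in \<open>scale_op_compose_left\<close>.\<close>

lemma scale_op_compose_right: "S \<in> clinear_ops \<Longrightarrow> S o\<^sub>L scale_op c T = scale_op c (S o\<^sub>L T)"
  by (rule blinfun_eqI) (simp add: scale_op_apply clinear_opsD)

lemmas compose_algebra =
  bounded_bilinear.add_left[OF bounded_bilinear_blinfun_compose]
  bounded_bilinear.add_right[OF bounded_bilinear_blinfun_compose]
  bounded_bilinear.diff_left[OF bounded_bilinear_blinfun_compose]
  bounded_bilinear.diff_right[OF bounded_bilinear_blinfun_compose]

lemma blinfun_compose_id [simp]: "id_blinfun o\<^sub>L T = T" "T o\<^sub>L id_blinfun = T"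
  by (auto intro: blinfun_eqI)

lemma uoa_clinear: "unital_operator_algebra A \<Longrightarrow> a \<in> A \<Longrightarrow> a \<in> clinear_ops"
  and uoa_closed: "unital_operator_algebra A \<Longrightarrow> closed A"
  and uoa_id: "unital_operator_algebra A \<Longrightarrow> id_blinfun \<in> A"
  and uoa_add: "unital_operator_algebra A \<Longrightarrow> a \<in> A \<Longrightarrow> b \<in> A \<Longrightarrow> a + b \<in> A"
  and uoa_compose: "unital_operator_algebra A \<Longrightarrow> a \<in> A \<Longrightarrow> b \<in> A \<Longrightarrow> a o\<^sub>L b \<in> A"
  and uoa_scale: "unital_operator_algebra A \<Longrightarrow> a \<in> A \<Longrightarrow> scale_op c a \<in> A"
  unfolding unital_operator_algebra_def by blast+

lemma uoa_zero: "unital_operator_algebra A \<Longrightarrow> 0 \<in> A"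
  using uoa_scale[where c = 0, OF _ uoa_id] by fastforce

lemma uoa_diff: "unital_operator_algebra A \<Longrightarrow> a \<in> A \<Longrightarrow> b \<in> A \<Longrightarrow> a - b \<in> A"
  by (metis diff_conv_add_uminus scale_op_minus_one uoa_add uoa_scale)

lemma uoa_subspace: "unital_operator_algebra A \<Longrightarrow> subspace A"
  by (simp add: subspace_def uoa_zero uoa_add uoa_scale scaleR_eq_scale_op)

lemma uoa_sum: "unital_operator_algebra A \<Longrightarrow> (\<And>i. i \<in> S \<Longrightarrow> f i \<in> A) \<Longrightarrow> sum f S \<in> A"
  by (rule subspace_sum[OF uoa_subspace])

text \<open>The three sets are kept apart so that degrees can add up: products of two tails of the
  grading lie in a deeper tail.\<close>

lemma compose_closure:
  fixes X Y Z :: "'h::real_normed_vector op set"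
  assumes "\<And>x y. x \<in> X \<Longrightarrow> y \<in> Y \<Longrightarrow> x o\<^sub>L y \<in> Z" "a \<in> closure X" "b \<in> closure Y"
  shows "a o\<^sub>L b \<in> closure Z"
proof -
  obtain x y where x: "\<And>k. x k \<in> X" "x \<longlonglongrightarrow> a" and y: "\<And>k. y k \<in> Y" "y \<longlonglongrightarrow> b"
    using assms(2,3) unfolding closure_sequential by blast
  have "(\<lambda>k. x k o\<^sub>L y k) \<longlonglongrightarrow> (a o\<^sub>L b)"
    by (rule bounded_bilinear.tendsto[OF bounded_bilinear_blinfun_compose x(2) y(2)])
  then show ?thesis
    unfolding closure_sequential using assms(1) x(1) y(1) by (intro exI[of _ "\<lambda>k. x k o\<^sub>L y k"]) auto
qed

lemma scale_op_closure:
  assumes "\<And>x. x \<in> X \<Longrightarrow> scale_op c x \<in> Z" "a \<in> closure X"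
  shows "scale_op c a \<in> closure Z"
proof -
  obtain x where x: "\<And>k. x k \<in> X" "x \<longlonglongrightarrow> a"
    using assms(2) unfolding closure_sequential by blast
  have "(\<lambda>k. scale_op c (x k)) \<longlonglongrightarrow> scale_op c a"
    by (rule bounded_linear.tendsto[OF bounded_linear_scale_op x(2)])
  then show ?thesis
    unfolding closure_sequential using assms(1) x(1) by (intro exI[of _ "\<lambda>k. scale_op c (x k)"]) auto
qed

lemma add_closure:
  fixes X :: "'a::real_normed_vector set"
  assumes "\<And>x y. x \<in> X \<Longrightarrow> y \<in> Y \<Longrightarrow> x + y \<in> Z" "a \<in> closure X" "b \<in> closure Y"
  shows "a + b \<in> closure Z"
proof -
  obtain x y where x: "\<And>k. x k \<in> X" "x \<longlonglongrightarrow> a" and y: "\<And>k. y k \<in> Y" "y \<longlonglongrightarrow> b"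
    using assms(2,3) unfolding closure_sequential by blast
  have "(\<lambda>k. x k + y k) \<longlonglongrightarrow> a + b" by (intro tendsto_add x y)
  then show ?thesis
    unfolding closure_sequential using assms(1) x(1) y(1) by (intro exI[of _ "\<lambda>k. x k + y k"]) auto
qed

lemma unital_operator_algebra_closure:
  assumes "D \<subseteq> clinear_ops" "id_blinfun \<in> D" "\<And>x y. x \<in> D \<Longrightarrow> y \<in> D \<Longrightarrow> x + y \<in> D"
    "\<And>x y. x \<in> D \<Longrightarrow> y \<in> D \<Longrightarrow> x o\<^sub>L y \<in> D" "\<And>c x. x \<in> D \<Longrightarrow> scale_op c x \<in> D"
  shows "unital_operator_algebra (closure D)"
  unfolding unital_operator_algebra_def
proof (intro conjI ballI allI)
  show "closure D \<subseteq> clinear_ops"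
    by (rule closure_minimal[OF assms(1) uoa_closed[OF unital_operator_algebra_clinear_ops]])
  show "id_blinfun \<in> closure D" using assms(2) closure_subset by blast
qed (auto intro: add_closure compose_closure scale_op_closure assms)

lemma adjoint_op_scale_id: "adjoint_op (scale_op c id_blinfun) = scale_op (cnj c) id_blinfun"
  by (rule adjoint_op_eqI) (simp add: scale_op_apply cinner_scaleC_left cinner_scaleC_right)

text \<open>Pairing with \<open>y\<close> moves each \<open>T j\<close> to its adjoint on
  \<open>y\<close>; the Cauchy-Schwarz inequality for finite sums then meets the contractive column
  of adjoints. This is the upper half of the norm formula \<open>norm_lin_comb\<close>.\<close>

lemma norm_row_combination_le:
  fixes T :: "nat \<Rightarrow> 'h::complex_hilbert_space op"
  assumes "row_contraction n T"
  shows "norm (\<Sum>j<n. scale_op (c j) (T j)) \<le> L2_set (\<lambda>j. cmod (c j)) {..<n}"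
proof (rule norm_blinfun_bound)
  have T: "T j \<in> clinear_ops" if "j < n" for j
    using assms that by (auto simp: row_contraction_iff)
  have row: "(\<Sum>j<n. (norm (adjoint_op (T j) x))\<^sup>2) \<le> (norm x)\<^sup>2" for x
    using assms by (auto simp: row_contraction_iff)
  fix x :: 'h
  show "norm ((\<Sum>j<n. scale_op (c j) (T j)) x) \<le> L2_set (\<lambda>j. cmod (c j)) {..<n} * norm x"
  proof (rule norm_le_cinner_bound)
    fix y
    have "cinner y ((\<Sum>j<n. scale_op (c j) (T j)) x) = (\<Sum>j<n. c j * cinner (adjoint_op (T j) y) x)"
      by (simp add: blinfun.sum_left scale_op_apply cinner_sum_right cinner_scaleC_right
          cinner_adjoint_op T)
    also have "cmod \<dots> \<le> (\<Sum>j<n. cmod (c j) * (norm (adjoint_op (T j) y) * norm x))"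
      by (intro order.trans[OF norm_sum] sum_mono) (simp add: norm_mult mult_left_mono norm_cinner_le)
    also have "\<dots> = (\<Sum>j<n. cmod (c j) * norm (adjoint_op (T j) y)) * norm x"
      by (simp add: sum_distrib_right mult.assoc)
    also have "\<dots> \<le> (L2_set (\<lambda>j. cmod (c j)) {..<n} * L2_set (\<lambda>j. norm (adjoint_op (T j) y)) {..<n}) * norm x"
      using L2_set_mult_ineq[of "\<lambda>j. cmod (c j)" "\<lambda>j. norm (adjoint_op (T j) y)" "{..<n}"]
      by (intro mult_right_mono) auto
    also have "\<dots> \<le> (L2_set (\<lambda>j. cmod (c j)) {..<n} * norm y) * norm x"
      using row[of y] by (intro mult_right_mono mult_left_mono)
        (auto simp: L2_set_def sum_nonneg intro: real_le_lsqrt)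
    finally show "cmod (cinner y ((\<Sum>j<n. scale_op (c j) (T j)) x)) \<le>
        L2_set (\<lambda>j. cmod (c j)) {..<n} * norm x * norm y" by (simp add: algebra_simps)
  qed simp
qed simp

text \<open>Points of the closed unit ball become rows of scalar operators;
  \<open>ex_character\<close> obtains its characters from them.\<close>

lemma row_contraction_scalar:
  assumes "(\<Sum>j<n. (cmod (c j))\<^sup>2) \<le> 1"
  shows "row_contraction n (\<lambda>j. scale_op (c j) (id_blinfun :: 'h::complex_hilbert_space op))"
proof -
  have "(\<Sum>j<n. (cmod (c j))\<^sup>2) * (norm x)\<^sup>2 \<le> (norm x)\<^sup>2" for x :: 'h
    using mult_right_mono[OF assms, of "(norm x)\<^sup>2"] by simp
  then show ?thesis
    by (auto simp: row_contraction_iff clinear_ops_def scale_op_apply scaleC_scaleC mult.commute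
        adjoint_op_scale_id norm_scaleC power_mult_distrib sum_distrib_left)
qed

lemma row_contraction_scale:
  assumes "row_contraction n T" "cmod z \<le> 1"
  shows "row_contraction n (\<lambda>j. scale_op z (T j :: 'h::complex_hilbert_space op))"
proof -
  have T: "T j \<in> clinear_ops" if "j < n" for j
    using assms that by (auto simp: row_contraction_iff)
  have row: "(\<Sum>j<n. (norm (adjoint_op (T j) x))\<^sup>2) \<le> (norm x)\<^sup>2" for x
    using assms by (auto simp: row_contraction_iff)
  have adj: "adjoint_op (scale_op z (T j)) = scale_op (cnj z) (adjoint_op (T j))" if "j < n" for j
    by (rule adjoint_op_eqI)
      (simp add: scale_op_apply cinner_scaleC_left cinner_scaleC_right cinner_adjoint_op T that)
  have "(\<Sum>j<n. (norm (adjoint_op (scale_op z (T j)) x))\<^sup>2) \<le> (norm x)\<^sup>2" for x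
  proof -
    have "(\<Sum>j<n. (norm (adjoint_op (scale_op z (T j)) x))\<^sup>2) =
        (cmod z)\<^sup>2 * (\<Sum>j<n. (norm (adjoint_op (T j) x))\<^sup>2)"
      by (simp add: adj scale_op_apply norm_scaleC power_mult_distrib sum_distrib_left)
    also have "\<dots> \<le> 1 * (norm x)\<^sup>2"
      using assms(2) row by (intro mult_mono) (auto simp: power_le_one_iff intro: sum_nonneg)
    finally show ?thesis by simp
  qed
  then show ?thesis
    using T uoa_scale[OF unital_operator_algebra_clinear_ops]
    by (auto simp: row_contraction_iff)
qed

section \<open>Universality over arbitrary Hilbert spaces\<close>

text \<open>Formal expressions instead of a quotient ring: one expression is evaluated at tuples on
  different Hilbert spaces and only the values are compared. That a value may be assigned to an
  operator, independently of the expression representing it, is settled in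
  \<open>contractive_extension\<close>.\<close>

datatype (vars: 'x) ncpoly = NGen 'x | NConst complex | NAdd "'x ncpoly" "'x ncpoly" | NMul "'x ncpoly" "'x ncpoly"

primrec nc_eval :: "('x \<Rightarrow> 'h::complex_hilbert_space op) \<Rightarrow> 'x ncpoly \<Rightarrow> 'h op" where
  "nc_eval T (NGen x) = T x"
| "nc_eval T (NConst c) = scale_op c id_blinfun"
| "nc_eval T (NAdd p q) = nc_eval T p + nc_eval T q"
| "nc_eval T (NMul p q) = nc_eval T p o\<^sub>L nc_eval T q"

text \<open>The finitely many vectors to which operators get applied when \<open>p\<close> is
  evaluated at \<open>v\<close>, together with the results at the leaves. Sums and scalar multiples
  are left out, since they stay in the span.\<close>

primrec orbit :: "('x \<Rightarrow> 'h::complex_hilbert_space op) \<Rightarrow> 'x ncpoly \<Rightarrow> 'h \<Rightarrow> 'h set" where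
  "orbit T (NGen x) v = {v, T x v}"
| "orbit T (NConst c) v = {v}"
| "orbit T (NAdd p q) v = orbit T p v \<union> orbit T q v"
| "orbit T (NMul p q) v = orbit T q v \<union> orbit T p (nc_eval T q v)"

lemma finite_orbit: "finite (orbit T p v)"
  by (induction p arbitrary: v) auto

text \<open>\<open>W\<close> plays the part of an isometry and \<open>V\<close> that of its adjoint.
  \<open>V\<close> has to undo \<open>W\<close> only on the orbit, because the evaluation applies
  the operators to no other vectors.\<close>

lemma nc_eval_intertwine:
  assumes "\<And>x y. W (x + y) = W x + W y" "\<And>c x. W (c *\<^sub>C x) = c *\<^sub>C W x"
    and "\<And>u. u \<in> orbit T p v \<Longrightarrow> V (W u) = u"
    and "\<And>x u. x \<in> vars p \<Longrightarrow> blinfun_apply (T' x) u = W (T x (V u))"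
  shows "blinfun_apply (nc_eval T' p) (W v) = W (nc_eval T p v)"
  using assms(3,4)
proof (induction p arbitrary: v)
  case (NMul p q)
  then show ?case by simp
qed (auto simp: scale_op_apply assms(1,2) blinfun.add_left)

lemma nc_eval_mem:
  assumes "unital_operator_algebra A" "\<And>x. x \<in> vars p \<Longrightarrow> T x \<in> A"
  shows "nc_eval T p \<in> A"
  using assms(2) by (induction p) (auto intro: uoa_add uoa_compose uoa_scale uoa_id assms(1))

lemma unital_hom_add: "unital_hom A \<pi> \<Longrightarrow> a \<in> A \<Longrightarrow> b \<in> A \<Longrightarrow> \<pi> (a + b) = \<pi> a + \<pi> b"
  and unital_hom_compose: "unital_hom A \<pi> \<Longrightarrow> a \<in> A \<Longrightarrow> b \<in> A \<Longrightarrow> \<pi> (a o\<^sub>L b) = \<pi> a o\<^sub>L \<pi> b"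
  and unital_hom_scale: "unital_hom A \<pi> \<Longrightarrow> a \<in> A \<Longrightarrow> \<pi> (scale_op c a) = scale_op c (\<pi> a)"
  and unital_hom_id: "unital_hom A \<pi> \<Longrightarrow> \<pi> id_blinfun = id_blinfun"
  unfolding unital_hom_def by blast+

lemma unital_hom_nc_eval:
  assumes A: "unital_operator_algebra A" and hom: "unital_hom A \<pi>"
    and T: "\<And>x. x \<in> vars p \<Longrightarrow> T x \<in> A"
  shows "\<pi> (nc_eval T p) = nc_eval (\<lambda>x. \<pi> (T x)) p"
  using T
proof (induction p)
  case (NConst c)
  then show ?case
    by (simp add: unital_hom_scale[OF hom uoa_id[OF A]] unital_hom_id[OF hom])
next
  case (NAdd p q)
  then have "nc_eval T p \<in> A" "nc_eval T q \<in> A" by (auto intro!: nc_eval_mem[OF A])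
  then show ?case using NAdd unital_hom_add[OF hom] by simp
next
  case (NMul p q)
  then have "nc_eval T p \<in> A" "nc_eval T q \<in> A" by (auto intro!: nc_eval_mem[OF A])
  then show ?case using NMul unital_hom_compose[OF hom] by simp
qed simp

lemma generated_algebra_eq_closure_nc_eval:
  assumes s: "s ` I \<subseteq> clinear_ops"
  shows "generated_algebra (s ` I) = closure (nc_eval s ` {p. vars p \<subseteq> I})" (is "?A = closure ?D")
proof (rule equalityI)
  note A = unital_operator_algebra_generated[OF s]
  have gen: "s x \<in> ?A" if "x \<in> I" for x using generated_algebra_subset[of "s ` I"] that by blast
  have D: "?D \<subseteq> ?A" using gen by (auto intro!: nc_eval_mem[OF A])
  show "closure ?D \<subseteq> ?A" by (rule closure_minimal[OF D uoa_closed[OF A]])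
  have "unital_operator_algebra (closure ?D)"
  proof (rule unital_operator_algebra_closure)
    show "?D \<subseteq> clinear_ops" using D uoa_clinear[OF A] by blast
    show "id_blinfun \<in> ?D" by (rule image_eqI[of _ _ "NConst 1"]) auto
    show "scale_op c x \<in> ?D" if "x \<in> ?D" for c x
    proof -
      from that obtain p where "x = nc_eval s p" "vars p \<subseteq> I" by auto
      then show ?thesis by (intro image_eqI[of _ _ "NMul (NConst c) p"]) auto
    qed
    fix x y assume "x \<in> ?D" "y \<in> ?D"
    then obtain p q where "x = nc_eval s p" "vars p \<subseteq> I" "y = nc_eval s q" "vars q \<subseteq> I" by blast
    then show "x + y \<in> ?D" "x o\<^sub>L y \<in> ?D"
      by (simp_all add: image_eqI[of _ _ "NAdd p q"] image_eqI[of _ _ "NMul p q"])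
  qed
  moreover have "s ` I \<subseteq> ?D"
  proof
    fix x assume "x \<in> s ` I"
    then obtain i where "i \<in> I" "x = s i" by blast
    then show "x \<in> ?D" by (intro image_eqI[of _ _ "NGen i"]) auto
  qed
  then have "s ` I \<subseteq> closure ?D" using closure_subset by blast
  ultimately show "?A \<subseteq> closure ?D" by (rule generated_algebra_minimal)
qed

text \<open>The norm inequality, applied to the expression \<open>p + (-1) q\<close>, shows that the
  value of \<open>p\<close> at \<open>T\<close> depends only on its value at \<open>s\<close> and
  that the resulting map on the dense subalgebra is contractive. It extends by uniform continuity,
  and the algebraic identities pass to the limit.\<close>

lemma contractive_extension:
  fixes s :: "'x \<Rightarrow> 'h::complex_hilbert_space op" and T :: "'x \<Rightarrow> 'g::complex_hilbert_space op"
  assumes s: "s ` I \<subseteq> clinear_ops" and T: "T ` I \<subseteq> clinear_ops"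
    and le: "\<And>p. vars p \<subseteq> I \<Longrightarrow> norm (nc_eval T p) \<le> norm (nc_eval s p)"
  shows "\<exists>\<pi>. unital_hom (generated_algebra (s ` I)) \<pi> \<and>
     (\<forall>a\<in>generated_algebra (s ` I). norm (\<pi> a) \<le> norm a) \<and> (\<forall>x\<in>I. \<pi> (s x) = T x)"
proof -
  define D where "D = nc_eval s ` {p. vars p \<subseteq> I}"
  define f where "f a = nc_eval T (SOME p. vars p \<subseteq> I \<and> nc_eval s p = a)" for a
  have A: "generated_algebra (s ` I) = closure D"
    unfolding D_def by (rule generated_algebra_eq_closure_nc_eval[OF s])
  have diff: "norm (nc_eval T p - nc_eval T q) \<le> norm (nc_eval s p - nc_eval s q)"
    if "vars p \<subseteq> I" "vars q \<subseteq> I" for p q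
    using le[of "NAdd p (NMul (NConst (-1)) q)"] that
    by (simp add: scale_op_minus_one bounded_bilinear.minus_left[OF bounded_bilinear_blinfun_compose])
  have f: "f (nc_eval s p) = nc_eval T p" if "vars p \<subseteq> I" for p
  proof -
    define q where "q = (SOME q. vars q \<subseteq> I \<and> nc_eval s q = nc_eval s p)"
    have "vars q \<subseteq> I \<and> nc_eval s q = nc_eval s p"
      unfolding q_def by (rule someI[of _ p]) (use that in simp)
    then show ?thesis using diff[of q p] that by (simp add: f_def q_def)
  qed
  have fD: "f (x + y) = f x + f y \<and> f (x o\<^sub>L y) = f x o\<^sub>L f y \<and> f (scale_op c x) = scale_op c (f x) \<and>
      norm (f x - f y) \<le> norm (x - y) \<and> x + y \<in> D \<and> x o\<^sub>L y \<in> D \<and> scale_op c x \<in> D \<and> f x \<in> clinear_ops"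
    if xy: "x \<in> D" "y \<in> D" for x y c
  proof -
    obtain p q where pq: "x = nc_eval s p" "vars p \<subseteq> I" "y = nc_eval s q" "vars q \<subseteq> I"
      using xy unfolding D_def by blast
    have "x + y = nc_eval s (NAdd p q)" "x o\<^sub>L y = nc_eval s (NMul p q)"
      "scale_op c x = nc_eval s (NMul (NConst c) p)" using pq by auto
    moreover have "vars (NAdd p q) \<subseteq> I" "vars (NMul p q) \<subseteq> I" "vars (NMul (NConst c) p) \<subseteq> I"
      using pq by auto
    ultimately have "f (x + y) = f x + f y" "f (x o\<^sub>L y) = f x o\<^sub>L f y" "f (scale_op c x) = scale_op c (f x)"
      "x + y \<in> D" "x o\<^sub>L y \<in> D" "scale_op c x \<in> D"
      unfolding D_def by (simp_all only: f) (use pq f in \<open>auto simp del: nc_eval.simps\<close>, auto)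
    moreover have "f x \<in> clinear_ops"
      using nc_eval_mem[OF unital_operator_algebra_clinear_ops, of p T] pq T by (auto simp: f)
    ultimately show ?thesis using diff pq by (simp add: f)
  qed
  have ucf: "uniformly_continuous_on D f"
    unfolding uniformly_continuous_on_def dist_norm using fD by (meson le_less_trans)
  obtain g where uc: "uniformly_continuous_on (closure D) g" and gf: "\<And>x. x \<in> D \<Longrightarrow> f x = g x"
    by (rule uniformly_continuous_on_extension_on_closure[OF ucf]) blast
  then have cont: "continuous_on (closure D) g" using uniformly_continuous_imp_continuous by blast
  have lim: "(\<lambda>k. f (x k)) \<longlonglongrightarrow> g a" if "\<And>k. x k \<in> D" "x \<longlonglongrightarrow> a" for x a
  proof -
    have "a \<in> closure D" using that closure_sequential by blast
    moreover have "x k \<in> closure D" for k using that(1) closure_subset by blast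
    ultimately have "(\<lambda>k. g (x k)) \<longlonglongrightarrow> g a"
      using cont that(2) continuous_on_sequentially[of "closure D" g] by (auto simp: o_def)
    then show ?thesis using gf that(1) by simp
  qed
  have idD: "id_blinfun \<in> D" unfolding D_def by (rule image_eqI[of _ _ "NConst 1"]) auto
  have "unital_hom (closure D) g"
    unfolding unital_hom_def
  proof (intro conjI ballI allI)
    show "g id_blinfun = id_blinfun"
      using f[of "NConst 1"] gf[OF idD] by simp
    show "g ` closure D \<subseteq> clinear_ops"
    proof
      fix y assume "y \<in> g ` closure D"
      then obtain a where "a \<in> closure D" "y = g a" by blast
      then obtain x where x: "\<And>k. x k \<in> D" "x \<longlonglongrightarrow> a" using closure_sequential by blast
      have "f (x k) \<in> clinear_ops" for k using fD[OF x(1) x(1)] by blast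
      then show "y \<in> clinear_ops" unfolding \<open>y = g a\<close>
        by (rule closed_sequentially[OF uoa_closed[OF unital_operator_algebra_clinear_ops] _ lim[OF x]])
    qed
    fix a assume "a \<in> closure D"
    then obtain x where x: "\<And>k. x k \<in> D" "x \<longlonglongrightarrow> a" using closure_sequential by blast
    show "g (scale_op c a) = scale_op c (g a)" for c
    proof (rule LIMSEQ_unique)
      show "(\<lambda>k. f (scale_op c (x k))) \<longlonglongrightarrow> g (scale_op c a)"
        using fD x by (intro lim bounded_linear.tendsto[OF bounded_linear_scale_op]) auto
      show "(\<lambda>k. f (scale_op c (x k))) \<longlonglongrightarrow> scale_op c (g a)"
        using fD[OF x(1) x(1)] by (simp add: lim[OF x] bounded_linear.tendsto[OF bounded_linear_scale_op])
    qed
    fix b assume "b \<in> closure D"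
    then obtain y where y: "\<And>k. y k \<in> D" "y \<longlonglongrightarrow> b" using closure_sequential by blast
    show "g (a + b) = g a + g b"
    proof (rule LIMSEQ_unique)
      show "(\<lambda>k. f (x k + y k)) \<longlonglongrightarrow> g (a + b)"
        using fD x y by (intro lim tendsto_add) auto
      show "(\<lambda>k. f (x k + y k)) \<longlonglongrightarrow> g a + g b"
        using fD[OF x(1) y(1)] by (simp add: tendsto_add lim[OF x] lim[OF y])
    qed
    show "g (a o\<^sub>L b) = g a o\<^sub>L g b"
    proof (rule LIMSEQ_unique)
      show "(\<lambda>k. f (x k o\<^sub>L y k)) \<longlonglongrightarrow> g (a o\<^sub>L b)"
        using fD x y by (intro lim bounded_bilinear.tendsto[OF bounded_bilinear_blinfun_compose]) auto
      show "(\<lambda>k. f (x k o\<^sub>L y k)) \<longlonglongrightarrow> (g a o\<^sub>L g b)"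
        using fD[OF x(1) y(1)]
        by (simp add: bounded_bilinear.tendsto[OF bounded_bilinear_blinfun_compose] lim[OF x] lim[OF y])
    qed
  qed
  moreover have "norm (g a) \<le> norm a" if "a \<in> closure D" for a
  proof -
    obtain x where x: "\<And>k. x k \<in> D" "x \<longlonglongrightarrow> a" using \<open>a \<in> closure D\<close> closure_sequential by blast
    have "norm (f (x k)) \<le> norm (x k)" for k
      using x(1)[of k] le f unfolding D_def by auto
    then show ?thesis
      by (intro LIMSEQ_le[OF tendsto_norm[OF lim[OF x]] tendsto_norm[OF x(2)]]) auto
  qed
  moreover have "g (s x) = T x" if "x \<in> I" for x
  proof -
    have "s x \<in> D" unfolding D_def using that by (intro image_eqI[of _ _ "NGen x"]) auto
    then show ?thesis using gf f[of "NGen x"] that by simp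
  qed
  ultimately show ?thesis unfolding A by blast
qed

text \<open>
  Compressing a row contraction to the finite-dimensional space spanned by the orbit of a vector
  does not change the value of the polynomial at that vector; the compression lives on \<open>'k\<close>.
\<close>

lemma norm_nc_eval_le:
  fixes s :: "nat \<Rightarrow> nat \<Rightarrow> 'h::complex_hilbert_space op"
    and T :: "nat \<Rightarrow> nat \<Rightarrow> 'g::complex_hilbert_space op"
  assumes inf: "\<forall>S::'k::complex_hilbert_space set. finite S \<longrightarrow> span S \<noteq> UNIV"
    and fp: "is_disc_free_product TYPE('k) m n s A"
    and T: "\<And>i. i < m \<Longrightarrow> row_contraction (n i) (T i)"
    and p: "vars p \<subseteq> {(i, j). i < m \<and> j < n i}"
  shows "norm (nc_eval (case_prod T) p) \<le> norm (nc_eval (case_prod s) p)"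
proof (rule norm_blinfun_bound)
  fix v :: 'g
  obtain M and e :: "nat \<Rightarrow> 'g" where e: "orthonormal M e"
    and fixed: "\<forall>x\<in>orbit (case_prod T) p v. onb_map M e e x = x"
    using finite_orthonormal_span[OF finite_orbit] by blast
  obtain f :: "nat \<Rightarrow> 'k" where f: "orthonormal M f" using infinite_dim_orthonormal[OF inf] by blast
  define W where "W = onb_map M e f"
  define V where "V = onb_map M f e"
  define T' where "T' i j = Blinfun (\<lambda>z. W (T i j (V z)))" for i j
  have T': "blinfun_apply (T' i j) z = W (T i j (V z))" for i j z
    unfolding T'_def W_def V_def
    by (subst bounded_linear_Blinfun_apply)
      (auto intro!: bounded_linear_compose[OF bounded_linear_onb_map[OF e f]]
        bounded_linear_compose[OF blinfun.bounded_linear_right] bounded_linear_onb_map[OF f e])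
  have "row_contraction (n i) (T' i)" if i: "i < m" for i
  proof -
    have lin: "T i j \<in> clinear_ops" if "j < n i" for j
      using T[OF i] that by (auto simp: row_contraction_iff)
    \<comment> \<open>\<open>V\<close> and \<open>W\<close> are adjoint to each other, so the
      adjoint of the compression is the compression of the adjoint, and the column inequality for
      \<open>T i\<close> passes to \<open>T' i\<close>.\<close>
    have adj: "blinfun_apply (adjoint_op (T' i j)) z = W (adjoint_op (T i j) (V z))" if "j < n i" for j z
    proof -
      let ?S = "Blinfun (\<lambda>z. W (adjoint_op (T i j) (V z)))"
      have S: "blinfun_apply ?S z = W (adjoint_op (T i j) (V z))" for z
        unfolding W_def V_def
        by (subst bounded_linear_Blinfun_apply)
          (auto intro!: bounded_linear_compose[OF bounded_linear_onb_map[OF e f]]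
            bounded_linear_compose[OF blinfun.bounded_linear_right] bounded_linear_onb_map[OF f e])
      have "adjoint_op (T' i j) = ?S"
      proof (rule adjoint_op_eqI)
        fix x y
        have "cinner (?S x) y = cinner (adjoint_op (T i j) (V x)) (V y)"
          unfolding S unfolding W_def V_def by (rule cinner_onb_map)
        also have "\<dots> = cinner (V x) (T i j (V y))" by (rule cinner_adjoint_op[OF lin[OF that]])
        also have "\<dots> = cinner x (T' i j y)" unfolding T' unfolding W_def V_def by (rule cinner_onb_map)
        finally show "cinner (?S x) y = cinner x (T' i j y)" .
      qed
      then show ?thesis by (simp add: S)
    qed
    have "(\<Sum>j<n i. (norm (adjoint_op (T' i j) z))\<^sup>2) \<le> (norm z)\<^sup>2" for z
    proof -
      have "(\<Sum>j<n i. (norm (adjoint_op (T' i j) z))\<^sup>2) \<le> (\<Sum>j<n i. (norm (adjoint_op (T i j) (V z)))\<^sup>2)"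
        by (intro sum_mono power_mono) (auto simp: adj W_def norm_onb_map_le[OF e f])
      also have "\<dots> \<le> (norm (V z))\<^sup>2" using T[OF i] by (simp add: row_contraction_iff)
      also have "\<dots> \<le> (norm z)\<^sup>2" by (intro power_mono) (auto simp: V_def norm_onb_map_le[OF f e])
      finally show ?thesis .
    qed
    moreover have "T' i j \<in> clinear_ops" if "j < n i" for j
      using lin[OF that] by (simp add: clinear_ops_def T' W_def V_def onb_map_scaleC)
    ultimately show ?thesis by (simp add: row_contraction_iff)
  qed
  then obtain \<pi> :: "'h op \<Rightarrow> 'k op" where \<pi>: "unital_hom A \<pi>" "completely_contractive A \<pi>"
    "\<forall>i<m. \<forall>j<n i. \<pi> (s i j) = T' i j"
    using fp[unfolded is_disc_free_product_def, THEN conjunct2, THEN conjunct2, THEN spec, of T'] by blast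
  let ?G = "{s i j | i j. i < m \<and> j < n i}"
  have A: "A = generated_algebra ?G" and "\<forall>i<m. row_contraction (n i) (s i)"
    using fp by (auto simp: is_disc_free_product_def)
  then have uoa: "unital_operator_algebra A"
    unfolding A by (intro unital_operator_algebra_generated) (auto simp: row_contraction_def)
  have sA: "case_prod s x \<in> A" if "x \<in> vars p" for x
    using that p generated_algebra_subset[of ?G] unfolding A by fastforce
  have "nc_eval (case_prod T') p = nc_eval (\<lambda>x. \<pi> (case_prod s x)) p"
    using \<pi>(3) p by (induction p) auto
  also have "\<dots> = \<pi> (nc_eval (case_prod s) p)"
    by (rule unital_hom_nc_eval[OF uoa \<pi>(1) sA, symmetric])
  finally have T's: "norm (nc_eval (case_prod T') p) \<le> norm (nc_eval (case_prod s) p)"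
    using completely_contractive_norm_le[OF \<pi>(2) nc_eval_mem[OF uoa sA]] by simp
  have VW: "V (W u) = u" if "u \<in> orbit (case_prod T) p v" for u
    using fixed that unfolding V_def W_def onb_map_comp[OF f] by simp
  have W_add: "W (x + y) = W x + W y" and W_scale: "W (c *\<^sub>C x) = c *\<^sub>C W x" for x y c
    by (simp_all add: W_def onb_map_add onb_map_scaleC)
  have inter: "blinfun_apply (nc_eval (case_prod T') p) (W v) = W (nc_eval (case_prod T) p v)"
    by (rule nc_eval_intertwine[where V = V])
      (auto simp: VW T' W_add W_scale split: prod.split)
  \<comment> \<open>The value of \<open>p\<close> at \<open>v\<close> need not belong to the orbit,
    but by induction it lies in every complex subspace containing the orbit, in particular in the
    span of \<open>e\<close>.\<close>
  have "onb_map M e e (nc_eval (case_prod T) p v) = nc_eval (case_prod T) p v"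
  proof -
    have "nc_eval S q v \<in> U" if "orbit S q v \<subseteq> U" "subspace U" "\<And>c u. u \<in> U \<Longrightarrow> c *\<^sub>C u \<in> U"
      for S :: "nat \<times> nat \<Rightarrow> 'g op" and q U v
      using that(1)
      by (induction q arbitrary: v) (auto simp: blinfun.add_left scale_op_apply that intro: subspace_add[OF that(2)])
    from this[of "case_prod T" p v "{u. onb_map M e e u = u}"] show ?thesis
      using fixed bounded_linear.linear[OF bounded_linear_onb_map[OF e e]]
      by (auto simp: subspace_def onb_map_add onb_map_scaleC linear_0 linear_scale)
  qed
  then have "norm (nc_eval (case_prod T) p v) = norm (W (nc_eval (case_prod T) p v))"
    unfolding W_def by (rule norm_onb_map_eq[OF f, symmetric])
  also have "\<dots> \<le> norm (nc_eval (case_prod T') p) * norm (W v)"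
    unfolding inter[symmetric] by (rule norm_blinfun)
  also have "\<dots> \<le> norm (nc_eval (case_prod s) p) * norm v"
    by (intro mult_mono T's) (auto simp: W_def norm_onb_map_le[OF e f])
  finally show "norm (nc_eval (case_prod T) p v) \<le> norm (nc_eval (case_prod s) p) * norm v" .
qed simp

text \<open>Universality is stated over \<open>'h\<close> itself: every homomorphism constructed
  from it, even a character (by way of scalar operators), takes its values there, and the auxiliary
  space \<open>'k\<close> disappears. Contractivity on single operators replaces complete
  contractivity.\<close>

locale free_rows =
  fixes m :: nat and n :: "nat \<Rightarrow> nat"
    and s :: "nat \<Rightarrow> nat \<Rightarrow> 'h::complex_hilbert_space op" and A :: "'h op set"
  assumes A_eq: "A = generated_algebra {s i j | i j. i < m \<and> j < n i}"
    and row: "i < m \<Longrightarrow> row_contraction (n i) (s i)"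
    and id_nonzero: "(id_blinfun :: 'h op) \<noteq> 0"
    and universal: "(\<And>i. i < m \<Longrightarrow> row_contraction (n i) (T i)) \<Longrightarrow>
      \<exists>\<pi> :: 'h op \<Rightarrow> 'h op. unital_hom A \<pi> \<and> (\<forall>a\<in>A. norm (\<pi> a) \<le> norm a) \<and> (\<forall>i<m. \<forall>j<n i. \<pi> (s i j) = T i j)"

lemma free_rows_disc_free_product:
  fixes s :: "nat \<Rightarrow> nat \<Rightarrow> 'h::complex_hilbert_space op"
  assumes inf: "\<forall>S::'k::complex_hilbert_space set. finite S \<longrightarrow> span S \<noteq> UNIV"
    and fp: "is_disc_free_product TYPE('k) m n s A"
  shows "free_rows m n s A"
proof
  let ?I = "{(i, j). i < m \<and> j < n i}"
  show A: "A = generated_algebra {s i j | i j. i < m \<and> j < n i}"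
    and row: "i < m \<Longrightarrow> row_contraction (n i) (s i)" for i
    using fp by (auto simp: is_disc_free_product_def)
  have G: "{s i j | i j. i < m \<and> j < n i} = case_prod s ` ?I" by force
  have lin: "case_prod s ` ?I \<subseteq> clinear_ops" using row by (force simp: row_contraction_def)
  then have uoa: "unital_operator_algebra A"
    unfolding A G by (rule unital_operator_algebra_generated)
  show "(id_blinfun :: 'h op) \<noteq> 0"
  proof
    \<comment> \<open>The zero tuple on \<open>'k\<close> consists of row contractions, so there is
      a unital homomorphism into the operators on \<open>'k\<close>; it would carry
      \<open>id_blinfun = 0\<close> over and make \<open>'k\<close> trivial.\<close>
    assume 0: "(id_blinfun :: 'h op) = 0"
    have "\<forall>i<m. row_contraction (n i) (\<lambda>_. 0 :: 'k op)" by (simp add: row_contraction_0)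
    then obtain \<pi> :: "'h op \<Rightarrow> 'k op" where \<pi>: "unital_hom A \<pi>"
      using fp[unfolded is_disc_free_product_def, THEN conjunct2, THEN conjunct2, THEN spec, of "\<lambda>_ _. 0"]
      by blast
    have "\<pi> 0 = 0" using unital_hom_scale[OF \<pi> uoa_zero[OF uoa], of 0] by simp
    then have "(id_blinfun :: 'k op) = 0" using unital_hom_id[OF \<pi>] 0 by simp
    then have "x = 0" for x :: 'k by (metis blinfun_apply_id_blinfun zero_blinfun.rep_eq id_apply)
    then have "span {} = (UNIV :: 'k set)" by auto
    then show False using inf by blast
  qed
  fix T :: "nat \<Rightarrow> nat \<Rightarrow> 'h op"
  assume T: "\<And>i. i < m \<Longrightarrow> row_contraction (n i) (T i)"
  have "case_prod T ` ?I \<subseteq> clinear_ops" using T by (force simp: row_contraction_def)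
  from contractive_extension[OF lin this norm_nc_eval_le[OF inf fp T]]
  obtain \<pi> where "unital_hom A \<pi>" "\<forall>a\<in>A. norm (\<pi> a) \<le> norm a" "\<forall>x\<in>?I. \<pi> (case_prod s x) = case_prod T x"
    unfolding A G by blast
  then show "\<exists>\<pi> :: 'h op \<Rightarrow> 'h op. unital_hom A \<pi> \<and> (\<forall>a\<in>A. norm (\<pi> a) \<le> norm a) \<and>
      (\<forall>i<m. \<forall>j<n i. \<pi> (s i j) = T i j)" by auto
qed

section \<open>Contractive homomorphisms and characters\<close>

lemma subspace_closure:
  fixes S :: "'a::real_normed_vector set"
  assumes "subspace S" shows "subspace (closure S)"
proof -
  have "0 \<in> closure S" using subspace_0[OF assms] closure_subset by blast
  moreover have "x + y \<in> closure S" if "x \<in> closure S" "y \<in> closure S" for x y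
    by (rule add_closure[OF _ that]) (rule subspace_add[OF assms])
  moreover have "c *\<^sub>R x \<in> closure S" if "x \<in> closure S" for c x
  proof -
    have "(\<lambda>x. c *\<^sub>R x) ` S \<subseteq> S" using subspace_scale[OF assms] by blast
    then have "(\<lambda>x. c *\<^sub>R x) ` closure S \<subseteq> closure S"
      using closure_mono[of "(*\<^sub>R) c ` S" S] closure_scaleR[of c S] by simp
    then show ?thesis using that by blast
  qed
  ultimately show ?thesis by (simp add: subspace_def)
qed

definition contractive_hom ::
    "'h::complex_hilbert_space op set \<Rightarrow> ('h op \<Rightarrow> 'g::complex_hilbert_space op) \<Rightarrow> bool" where
  "contractive_hom A \<pi> \<longleftrightarrow> unital_hom A \<pi> \<and> (\<forall>a\<in>A. norm (\<pi> a) \<le> norm a)"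

context
  fixes A :: "'h::complex_hilbert_space op set" and \<pi> :: "'h op \<Rightarrow> 'g::complex_hilbert_space op"
  assumes A: "unital_operator_algebra A" and \<pi>: "contractive_hom A \<pi>"
begin

lemma hom_add: "a \<in> A \<Longrightarrow> b \<in> A \<Longrightarrow> \<pi> (a + b) = \<pi> a + \<pi> b"
  and hom_compose: "a \<in> A \<Longrightarrow> b \<in> A \<Longrightarrow> \<pi> (a o\<^sub>L b) = \<pi> a o\<^sub>L \<pi> b"
  and hom_scale: "a \<in> A \<Longrightarrow> \<pi> (scale_op c a) = scale_op c (\<pi> a)"
  and hom_id: "\<pi> id_blinfun = id_blinfun"
  and hom_norm: "a \<in> A \<Longrightarrow> norm (\<pi> a) \<le> norm a"
  and hom_clinear: "a \<in> A \<Longrightarrow> \<pi> a \<in> clinear_ops"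
  using \<pi> by (auto simp: contractive_hom_def unital_hom_def)

lemma hom_zero: "\<pi> 0 = 0"
  using hom_scale[of 0 0] uoa_zero[OF A] by simp

lemma hom_diff: "a \<in> A \<Longrightarrow> b \<in> A \<Longrightarrow> \<pi> (a - b) = \<pi> a - \<pi> b"
  using hom_add[of a "scale_op (-1) b"] hom_scale[of b "-1"] uoa_scale[OF A, of b "-1"]
  by (simp add: scale_op_minus_one)

lemma hom_scaleR: "a \<in> A \<Longrightarrow> \<pi> (r *\<^sub>R a) = r *\<^sub>R \<pi> a"
  by (simp add: scaleR_eq_scale_op hom_scale)

lemma hom_sum: "(\<And>i. i \<in> S \<Longrightarrow> f i \<in> A) \<Longrightarrow> \<pi> (sum f S) = (\<Sum>i\<in>S. \<pi> (f i))"
proof (induction S rule: infinite_finite_induct)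
  case (insert x F)
  then have "f x \<in> A" "sum f F \<in> A" by (auto intro: uoa_sum[OF A])
  then show ?case using insert by (simp add: hom_add)
qed (auto simp: hom_zero)

lemma hom_norm_diff: "a \<in> A \<Longrightarrow> b \<in> A \<Longrightarrow> norm (\<pi> a - \<pi> b) \<le> norm (a - b)"
  using hom_norm[of "a - b"] by (simp add: hom_diff uoa_diff[OF A])

lemma hom_tendsto:
  assumes "\<And>k. x k \<in> A" "a \<in> A" "x \<longlonglongrightarrow> a"
  shows "(\<lambda>k. \<pi> (x k)) \<longlonglongrightarrow> \<pi> a"
proof -
  have "(\<lambda>k. \<pi> (x k) - \<pi> a) \<longlonglongrightarrow> 0"
    by (rule Lim_null_comparison[OF always_eventually tendsto_norm_zero[OF LIM_zero[OF assms(3)]]])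
      (use assms hom_norm_diff in blast)
  then show ?thesis by (rule LIM_zero_cancel)
qed

lemma hom_closed_preimage:
  assumes "closed B" shows "closed {a \<in> A. \<pi> a \<in> B}"
  unfolding closed_sequential_limits
proof (intro allI impI)
  fix x a assume x: "(\<forall>k. x k \<in> {a \<in> A. \<pi> a \<in> B}) \<and> x \<longlonglongrightarrow> a"
  then have "a \<in> A" using closed_sequentially[OF uoa_closed[OF A], of x a] by blast
  moreover have "\<pi> a \<in> B"
  proof (rule closed_sequentially[OF assms])
    show "\<pi> (x k) \<in> B" for k using x by blast
    show "(\<lambda>k. \<pi> (x k)) \<longlonglongrightarrow> \<pi> a" using x \<open>a \<in> A\<close> by (intro hom_tendsto) auto
  qed
  ultimately show "a \<in> {a \<in> A. \<pi> a \<in> B}" by blast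
qed

lemma hom_preimage_subspace:
  assumes "subspace B" shows "subspace {a \<in> A. \<pi> a \<in> B}"
  using uoa_subspace[OF A] assms by (auto simp: subspace_def hom_zero hom_add hom_scaleR)

text \<open>Since the generated algebra is minimal, this lemma and the equalizer lemmas reduce
  claims about all of \<open>A\<close> to claims about the generators.\<close>

lemma hom_preimage_uoa:
  assumes "unital_operator_algebra B" shows "unital_operator_algebra {a \<in> A. \<pi> a \<in> B}"
  unfolding unital_operator_algebra_def
proof (intro conjI ballI allI)
  show "{a \<in> A. \<pi> a \<in> B} \<subseteq> clinear_ops" using uoa_clinear[OF A] by blast
  show "closed {a \<in> A. \<pi> a \<in> B}" by (rule hom_closed_preimage[OF uoa_closed[OF assms]])
qed (auto simp: hom_id hom_add hom_compose hom_scale uoa_id uoa_add uoa_compose uoa_scale A assms)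

lemma hom_equalizer_uoa:
  assumes \<rho>: "contractive_hom A (\<rho> :: 'h op \<Rightarrow> 'g op)"
  shows "unital_operator_algebra {a \<in> A. \<pi> a = \<rho> a}"
  unfolding unital_operator_algebra_def
proof (intro conjI ballI allI)
  have r: "\<rho> (a + b) = \<rho> a + \<rho> b" "\<rho> (a o\<^sub>L b) = \<rho> a o\<^sub>L \<rho> b" "\<rho> (scale_op c a) = scale_op c (\<rho> a)"
    "\<rho> id_blinfun = id_blinfun" if "a \<in> A" "b \<in> A" for a b c
    using \<rho> that by (auto simp: contractive_hom_def unital_hom_def)
  show "{a \<in> A. \<pi> a = \<rho> a} \<subseteq> clinear_ops" using uoa_clinear[OF A] by blast
  show "id_blinfun \<in> {a \<in> A. \<pi> a = \<rho> a}" using r uoa_id[OF A] by (simp add: hom_id)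
  show "a + b \<in> {a \<in> A. \<pi> a = \<rho> a}" "a o\<^sub>L b \<in> {a \<in> A. \<pi> a = \<rho> a}"
    if "a \<in> {a \<in> A. \<pi> a = \<rho> a}" "b \<in> {a \<in> A. \<pi> a = \<rho> a}" for a b
    using that r by (auto simp: hom_add hom_compose uoa_add[OF A] uoa_compose[OF A])
  show "scale_op c a \<in> {a \<in> A. \<pi> a = \<rho> a}" if "a \<in> {a \<in> A. \<pi> a = \<rho> a}" for c a
    using that r by (auto simp: hom_scale uoa_scale[OF A])
  show "closed {a \<in> A. \<pi> a = \<rho> a}"
    unfolding closed_sequential_limits
  proof (intro allI impI)
    fix x a assume x: "(\<forall>k. x k \<in> {a \<in> A. \<pi> a = \<rho> a}) \<and> x \<longlonglongrightarrow> a"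
    then have a: "a \<in> A" using closed_sequentially[OF uoa_closed[OF A], of x a] by blast
    have nd: "norm (\<rho> (x k) - \<rho> a) \<le> norm (x k - a)" for k
    proof -
      have "x k \<in> A" using x by blast
      then have "\<rho> (x k - a) = \<rho> (x k) - \<rho> a"
        using r(1)[of "x k" "scale_op (-1) a"] r(3)[OF a a, of "-1"] uoa_scale[OF A a, of "-1"]
        by (simp add: scale_op_minus_one)
      then show ?thesis using \<rho> uoa_diff[OF A \<open>x k \<in> A\<close> a] by (metis contractive_hom_def)
    qed
    have xa: "x \<longlonglongrightarrow> a" using x by blast
    have "(\<lambda>k. \<rho> (x k) - \<rho> a) \<longlonglongrightarrow> 0"
      by (rule Lim_null_comparison[OF always_eventually tendsto_norm_zero[OF LIM_zero[OF xa]]])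
        (use nd in blast)
    then have "(\<lambda>k. \<rho> (x k)) \<longlonglongrightarrow> \<rho> a" by (rule LIM_zero_cancel)
    moreover have "(\<lambda>k. \<pi> (x k)) \<longlonglongrightarrow> \<pi> a" using x a by (intro hom_tendsto) auto
    moreover have "(\<lambda>k. \<pi> (x k)) = (\<lambda>k. \<rho> (x k))" using x by auto
    ultimately show "a \<in> {a \<in> A. \<pi> a = \<rho> a}" using a LIMSEQ_unique by fastforce
  qed
qed

end

lemma contractive_hom_comp:
  assumes "contractive_hom A \<pi>" "\<pi> ` A \<subseteq> B" "contractive_hom B \<rho>"
  shows "contractive_hom A (\<lambda>a. \<rho> (\<pi> a))"
proof -
  have "\<pi> a \<in> B" if "a \<in> A" for a using assms(2) that by blast
  moreover from this have "norm (\<rho> (\<pi> a)) \<le> norm a" if "a \<in> A" for a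
    using assms(1,3) that unfolding contractive_hom_def by (meson order_trans)
  ultimately show ?thesis
    using assms(1,3) unfolding contractive_hom_def unital_hom_def by auto
qed

definition character :: "'h::complex_hilbert_space op set \<Rightarrow> ('h op \<Rightarrow> complex) \<Rightarrow> bool" where
  "character A \<kappa> \<longleftrightarrow> \<kappa> id_blinfun = 1 \<and> (\<forall>a\<in>A. cmod (\<kappa> a) \<le> norm a) \<and>
     (\<forall>a\<in>A. \<forall>b\<in>A. \<kappa> (a + b) = \<kappa> a + \<kappa> b \<and> \<kappa> (a o\<^sub>L b) = \<kappa> a * \<kappa> b) \<and>
     (\<forall>c. \<forall>a\<in>A. \<kappa> (scale_op c a) = c * \<kappa> a)"

lemma character_comp:
  assumes "contractive_hom A \<pi>" "\<pi> ` A \<subseteq> B" "character B \<kappa>"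
  shows "character A (\<lambda>a. \<kappa> (\<pi> a))"
proof -
  have "\<pi> a \<in> B" if "a \<in> A" for a using assms(2) that by blast
  moreover from this have "cmod (\<kappa> (\<pi> a)) \<le> norm a" if "a \<in> A" for a
    using assms(1,3) that unfolding contractive_hom_def character_def by (meson order_trans)
  ultimately show ?thesis
    using assms(1,3) unfolding contractive_hom_def unital_hom_def character_def by auto
qed

context
  fixes A :: "'h::complex_hilbert_space op set" and \<kappa> :: "'h op \<Rightarrow> complex"
  assumes A: "unital_operator_algebra A" and \<kappa>: "character A \<kappa>"
begin

lemma char_add: "a \<in> A \<Longrightarrow> b \<in> A \<Longrightarrow> \<kappa> (a + b) = \<kappa> a + \<kappa> b"
  and char_compose: "a \<in> A \<Longrightarrow> b \<in> A \<Longrightarrow> \<kappa> (a o\<^sub>L b) = \<kappa> a * \<kappa> b"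
  and char_scale: "a \<in> A \<Longrightarrow> \<kappa> (scale_op c a) = c * \<kappa> a"
  and char_id: "\<kappa> id_blinfun = 1"
  and char_norm: "a \<in> A \<Longrightarrow> cmod (\<kappa> a) \<le> norm a"
  using \<kappa> by (auto simp: character_def)

lemma char_zero: "\<kappa> 0 = 0"
  using char_scale[of 0 0] uoa_zero[OF A] by simp

lemma char_diff: "a \<in> A \<Longrightarrow> b \<in> A \<Longrightarrow> \<kappa> (a - b) = \<kappa> a - \<kappa> b"
  using char_add[of a "scale_op (-1) b"] char_scale[of b "-1"] uoa_scale[OF A, of b "-1"]
  by (simp add: scale_op_minus_one)

lemma char_sum: "(\<And>i. i \<in> S \<Longrightarrow> f i \<in> A) \<Longrightarrow> \<kappa> (sum f S) = (\<Sum>i\<in>S. \<kappa> (f i))"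
proof (induction S rule: infinite_finite_induct)
  case (insert x F)
  then have "f x \<in> A" "sum f F \<in> A" by (auto intro: uoa_sum[OF A])
  then show ?case using insert by (simp add: char_add)
qed (auto simp: char_zero)

lemma char_norm_diff: "a \<in> A \<Longrightarrow> b \<in> A \<Longrightarrow> cmod (\<kappa> a - \<kappa> b) \<le> norm (a - b)"
  using char_norm[of "a - b"] by (simp add: char_diff uoa_diff[OF A])

lemma char_tendsto:
  assumes "\<And>k. x k \<in> A" "a \<in> A" "x \<longlonglongrightarrow> a"
  shows "(\<lambda>k. \<kappa> (x k)) \<longlonglongrightarrow> \<kappa> a"
proof -
  have "(\<lambda>k. \<kappa> (x k) - \<kappa> a) \<longlonglongrightarrow> 0"
    by (rule Lim_null_comparison[OF always_eventually tendsto_norm_zero[OF LIM_zero[OF assms(3)]]])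
      (use assms char_norm_diff in blast)
  then show ?thesis by (rule LIM_zero_cancel)
qed

lemma char_equalizer_uoa:
  assumes \<psi>: "character A \<psi>"
    and tend: "\<And>x a. (\<And>k. x k \<in> A) \<Longrightarrow> a \<in> A \<Longrightarrow> x \<longlonglongrightarrow> a \<Longrightarrow> (\<lambda>k. \<psi> (x k)) \<longlonglongrightarrow> \<psi> a"
  shows "unital_operator_algebra {a \<in> A. \<kappa> a = \<psi> a}"
  unfolding unital_operator_algebra_def
proof (intro conjI ballI allI)
  show "{a \<in> A. \<kappa> a = \<psi> a} \<subseteq> clinear_ops" using uoa_clinear[OF A] by blast
  show "closed {a \<in> A. \<kappa> a = \<psi> a}"
    unfolding closed_sequential_limits
  proof (intro allI impI)
    fix x a assume x: "(\<forall>k. x k \<in> {a \<in> A. \<kappa> a = \<psi> a}) \<and> x \<longlonglongrightarrow> a"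
    then have a: "a \<in> A" using closed_sequentially[OF uoa_closed[OF A], of x a] by blast
    have "(\<lambda>k. \<kappa> (x k)) \<longlonglongrightarrow> \<kappa> a" using x a by (intro char_tendsto) auto
    moreover have "(\<lambda>k. \<psi> (x k)) \<longlonglongrightarrow> \<psi> a" using x a by (intro tend) auto
    moreover have "(\<lambda>k. \<kappa> (x k)) = (\<lambda>k. \<psi> (x k))" using x by auto
    ultimately show "a \<in> {a \<in> A. \<kappa> a = \<psi> a}" using a LIMSEQ_unique by fastforce
  qed
qed (use \<psi> in \<open>auto simp: character_def char_id char_add char_compose char_scale uoa_id uoa_add
  uoa_compose uoa_scale A\<close>)

end

section \<open>The grading of a universal row algebra\<close>

context free_rows
begin

abbreviation "gens \<equiv> {s i j | i j. i < m \<and> j < n i}"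

lemma gen_clinear: "i < m \<Longrightarrow> j < n i \<Longrightarrow> s i j \<in> clinear_ops"
  using row by (auto simp: row_contraction_def)

lemma uoa: "unital_operator_algebra A"
  unfolding A_eq by (rule unital_operator_algebra_generated) (use gen_clinear in auto)

lemmas A_mem = uoa_id[OF uoa] uoa_zero[OF uoa] uoa_add[OF uoa] uoa_diff[OF uoa] uoa_compose[OF uoa]
  uoa_scale[OF uoa] uoa_sum[OF uoa]
lemmas A_clinear = uoa_clinear[OF uoa]
lemmas A_closed = uoa_closed[OF uoa]

lemma gen_mem: "i < m \<Longrightarrow> j < n i \<Longrightarrow> s i j \<in> A"
  unfolding A_eq using generated_algebra_subset[of gens] by blast

lemma A_subset:
  "unital_operator_algebra V \<Longrightarrow> (\<And>i j. i < m \<Longrightarrow> j < n i \<Longrightarrow> s i j \<in> V) \<Longrightarrow> A \<subseteq> V"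
  unfolding A_eq by (rule generated_algebra_minimal) auto

lemma hom_eqI:
  assumes "contractive_hom A \<pi>" "contractive_hom A (\<rho> :: 'h op \<Rightarrow> 'g::complex_hilbert_space op)"
    and "\<And>i j. i < m \<Longrightarrow> j < n i \<Longrightarrow> \<pi> (s i j) = \<rho> (s i j)" and "a \<in> A"
  shows "\<pi> a = \<rho> a"
  using A_subset[OF hom_equalizer_uoa[OF uoa assms(1,2)]] assms(3,4) gen_mem by blast

lemma character_eqI:
  assumes "character A \<kappa>" "character A \<psi>"
    and "\<And>i j. i < m \<Longrightarrow> j < n i \<Longrightarrow> \<kappa> (s i j) = \<psi> (s i j)" and "a \<in> A"
  shows "\<kappa> a = \<psi> a"
  using A_subset[OF char_equalizer_uoa[OF uoa assms(1,2) char_tendsto[OF uoa assms(2)]]]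
    assms(3,4) gen_mem by blast

text \<open>Universality alone gives values somewhere in \<open>'h op\<close>; the preimage of
  \<open>A\<close> is a closed algebra containing the generators, which confines the values to
  \<open>A\<close>.\<close>

lemma ex_endo:
  assumes "\<And>i. i < m \<Longrightarrow> row_contraction (n i) (T i)" "\<And>i j. i < m \<Longrightarrow> j < n i \<Longrightarrow> T i j \<in> A"
  shows "\<exists>\<pi>. contractive_hom A \<pi> \<and> \<pi> ` A \<subseteq> A \<and> (\<forall>i<m. \<forall>j<n i. \<pi> (s i j) = T i j)"
proof -
  obtain \<pi> where \<pi>: "contractive_hom A \<pi>" "\<forall>i<m. \<forall>j<n i. \<pi> (s i j) = T i j"
    using universal[of T] assms(1) unfolding contractive_hom_def by blast
  have "A \<subseteq> {a \<in> A. \<pi> a \<in> A}"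
    by (rule A_subset[OF hom_preimage_uoa[OF uoa \<pi>(1) uoa]]) (use \<pi>(2) assms(2) gen_mem in simp)
  then show ?thesis using \<pi> by blast
qed

lemma norm_id_ge_1: "1 \<le> norm (id_blinfun :: 'h op)"
proof -
  have "norm (id_blinfun :: 'h op) \<le> norm (id_blinfun :: 'h op) * norm (id_blinfun :: 'h op)"
    using norm_blinfun_compose[of "id_blinfun :: 'h op" id_blinfun] by simp
  then show ?thesis using id_nonzero by simp
qed

text \<open>Universality at a row of scalar operators gives a homomorphism whose values are all
  scalar, since the scalar operators form a closed algebra. The character reads off the
  scalar.\<close>

lemma ex_character:
  assumes "\<And>i. i < m \<Longrightarrow> (\<Sum>j<n i. (cmod (c i j))\<^sup>2) \<le> 1"
  shows "\<exists>\<kappa>. character A \<kappa> \<and> (\<forall>i<m. \<forall>j<n i. \<kappa> (s i j) = c i j)"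
proof -
  define S where "S = range (\<lambda>c. scale_op c (id_blinfun :: 'h op))"
  obtain \<pi> :: "'h op \<Rightarrow> 'h op" where \<pi>: "contractive_hom A \<pi>"
    "\<forall>i<m. \<forall>j<n i. \<pi> (s i j) = scale_op (c i j) id_blinfun"
    using universal[of "\<lambda>i j. scale_op (c i j) id_blinfun"] row_contraction_scalar[OF assms]
    unfolding contractive_hom_def by blast
  \<comment> \<open>The scalar operators are the image of the complete plane under a linear map that
    multiplies norms by the constant \<open>norm id_blinfun\<close>, hence closed.\<close>
  have "complete S"
    unfolding S_def
    by (rule complete_isometric_image[OF _ subspace_UNIV bounded_linear_scale_op_left _ complete_UNIV,
          of "norm (id_blinfun :: 'h op)"])
      (use id_nonzero in \<open>auto simp: norm_scale_op\<close>)
  then have "closed S" by (rule complete_imp_closed)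
  moreover have "scale_op c id_blinfun \<in> (clinear_ops :: 'h op set)" for c
    using uoa_scale uoa_id unital_operator_algebra_clinear_ops by blast
  moreover have "id_blinfun \<in> S" unfolding S_def by (rule image_eqI[of _ _ 1]) auto
  ultimately have "unital_operator_algebra S"
    unfolding unital_operator_algebra_def S_def
    by (auto simp: scale_op_add_left[symmetric])
  then have "A \<subseteq> {a \<in> A. \<pi> a \<in> S}"
    by (intro A_subset[OF hom_preimage_uoa[OF uoa \<pi>(1)]]) (use \<pi>(2) gen_mem in \<open>auto simp: S_def\<close>)
  then have "\<forall>a\<in>A. \<exists>c. \<pi> a = scale_op c id_blinfun" unfolding S_def by blast
  then obtain \<kappa> where \<kappa>: "\<And>a. a \<in> A \<Longrightarrow> \<pi> a = scale_op (\<kappa> a) id_blinfun" by metis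
  have inj: "c = d" if "scale_op c (id_blinfun :: 'h op) = scale_op d id_blinfun" for c d
  proof -
    have "scale_op (c - d) (id_blinfun :: 'h op) = 0" using that by (simp add: scale_op_diff_left)
    then have "cmod (c - d) * norm (id_blinfun :: 'h op) = 0" by (metis norm_scale_op norm_zero)
    then show ?thesis using id_nonzero by simp
  qed
  have "character A \<kappa>"
    unfolding character_def
  proof (intro conjI ballI allI)
    show "\<kappa> id_blinfun = 1"
      by (rule inj) (use \<kappa>[OF A_mem(1)] hom_id[OF uoa \<pi>(1)] in simp)
    show "\<kappa> (a + b) = \<kappa> a + \<kappa> b" "\<kappa> (a o\<^sub>L b) = \<kappa> a * \<kappa> b" if "a \<in> A" "b \<in> A" for a b
      using that \<kappa>[of "a + b"] \<kappa>[of "a o\<^sub>L b"] \<kappa>[of a] \<kappa>[of b]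
      by (auto intro!: inj simp: A_mem scale_op_add_left hom_add[OF uoa \<pi>(1)] hom_compose[OF uoa \<pi>(1)])
    show "\<kappa> (scale_op c a) = c * \<kappa> a" if "a \<in> A" for c a
      using that \<kappa>[of "scale_op c a"] \<kappa>[of a]
      by (auto intro!: inj simp: A_mem hom_scale[OF uoa \<pi>(1)])
    show "cmod (\<kappa> a) \<le> norm a" if "a \<in> A" for a
    proof -
      have "cmod (\<kappa> a) * 1 \<le> cmod (\<kappa> a) * norm (id_blinfun :: 'h op)"
        by (intro mult_left_mono norm_id_ge_1) simp
      also have "\<dots> = norm (\<pi> a)" using \<kappa>[OF that] by (simp add: norm_scale_op)
      also have "\<dots> \<le> norm a" by (rule hom_norm[OF uoa \<pi>(1) that])
      finally show ?thesis by simp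
    qed
  qed
  moreover have "\<kappa> (s i j) = c i j" if "i < m" "j < n i" for i j
    using that \<pi>(2) by (intro inj) (simp flip: \<kappa> add: gen_mem)
  ultimately show ?thesis by blast
qed

text \<open>The constant term, that is, evaluation at the centre of the product of balls. By
  \<open>character_eqI\<close> the choice is unique on \<open>A\<close>.\<close>

definition eps :: "'h op \<Rightarrow> complex" where
  "eps = (SOME \<kappa>. character A \<kappa> \<and> (\<forall>i<m. \<forall>j<n i. \<kappa> (s i j) = 0))"

lemma eps: "character A eps" and eps_gen: "i < m \<Longrightarrow> j < n i \<Longrightarrow> eps (s i j) = 0"
  using someI_ex[OF ex_character[of "\<lambda>_ _. 0"]] unfolding eps_def by auto

definition gauge :: "complex \<Rightarrow> 'h op \<Rightarrow> 'h op" where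
  "gauge z = (SOME \<pi>. contractive_hom A \<pi> \<and> \<pi> ` A \<subseteq> A \<and> (\<forall>i<m. \<forall>j<n i. \<pi> (s i j) = scale_op z (s i j)))"

lemma gauge:
  assumes "cmod z \<le> 1"
  shows "contractive_hom A (gauge z)" "a \<in> A \<Longrightarrow> gauge z a \<in> A"
    "i < m \<Longrightarrow> j < n i \<Longrightarrow> gauge z (s i j) = scale_op z (s i j)"
proof -
  have "\<exists>\<pi>. contractive_hom A \<pi> \<and> \<pi> ` A \<subseteq> A \<and> (\<forall>i<m. \<forall>j<n i. \<pi> (s i j) = scale_op z (s i j))"
    by (rule ex_endo) (auto intro: row_contraction_scale[OF row assms] A_mem gen_mem)
  from someI_ex[OF this] show "contractive_hom A (gauge z)" "a \<in> A \<Longrightarrow> gauge z a \<in> A"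
    "i < m \<Longrightarrow> j < n i \<Longrightarrow> gauge z (s i j) = scale_op z (s i j)"
    unfolding gauge_def by auto
qed

lemmas gauge_simps = hom_add[OF uoa gauge(1)] hom_compose[OF uoa gauge(1)] hom_scale[OF uoa gauge(1)]
  hom_id[OF uoa gauge(1)] hom_zero[OF uoa gauge(1)] hom_diff[OF uoa gauge(1)] hom_scaleR[OF uoa gauge(1)]
  hom_sum[OF uoa gauge(1)]

section \<open>Homogeneous elements and the filtration by degree\<close>

primrec homog :: "nat \<Rightarrow> 'h op set" where
  "homog 0 = range (\<lambda>c. scale_op c id_blinfun)"
| "homog (Suc d) = span {s i j o\<^sub>L h | i j h. i < m \<and> j < n i \<and> h \<in> homog d}"

lemma homog_subspace: "subspace (homog d)"
proof (cases d)
  case 0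
  have "homog d = range (\<lambda>c. scale_op c id_blinfun)" using 0 by simp
  moreover have "subspace (range (\<lambda>c. scale_op c (id_blinfun :: 'h op)))"
    by (rule linear_subspace_image[OF bounded_linear.linear[OF bounded_linear_scale_op_left] subspace_UNIV])
  ultimately show ?thesis by simp
qed auto

lemma homog_subset: "homog d \<subseteq> A"
proof (induction d)
  case 0 then show ?case using A_mem by auto
next
  case (Suc d)
  then show ?case
    unfolding homog.simps by (intro span_minimal[OF _ uoa_subspace[OF uoa]]) (auto intro: A_mem gen_mem)
qed

lemma homog_mem: "x \<in> homog d \<Longrightarrow> x \<in> A" using homog_subset by blast

lemma homog_mult_gen: "i < m \<Longrightarrow> j < n i \<Longrightarrow> h \<in> homog d \<Longrightarrow> s i j o\<^sub>L h \<in> homog (Suc d)"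
  unfolding homog.simps by (rule span_base) blast

text \<open>\<open>span\<close> is real, but degree 0 already contains all complex scalars, and a
  scalar can be moved through the generators to the innermost factor.\<close>

lemma homog_scale: "x \<in> homog d \<Longrightarrow> scale_op c x \<in> homog d"
proof (induction d arbitrary: x)
  case 0 then show ?case by auto
next
  case (Suc d)
  let ?S = "{s i j o\<^sub>L h | i j h. i < m \<and> j < n i \<and> h \<in> homog d}"
  have "scale_op c (r *\<^sub>R x) = r *\<^sub>R scale_op c x" for r and x :: "'h op"
    by (simp add: scaleR_eq_scale_op mult.commute)
  then have "subspace {x. scale_op c x \<in> span ?S}"
    unfolding subspace_def by (simp add: scale_op_add_right span_zero span_add span_scale)
  moreover have "?S \<subseteq> {x. scale_op c x \<in> span ?S}"
  proof safe
    fix i j h assume h: "i < m" "j < n i" "h \<in> homog d"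
    then have "s i j o\<^sub>L scale_op c h \<in> span ?S" using Suc.IH by (intro span_base) blast
    then show "scale_op c (s i j o\<^sub>L h) \<in> span ?S"
      using h by (simp add: scale_op_compose_right[OF gen_clinear])
  qed
  ultimately have "span ?S \<subseteq> {x. scale_op c x \<in> span ?S}" by (rule span_minimal[rotated])
  then show ?case using Suc.prems by auto
qed

lemma homog_mult: "x \<in> homog d \<Longrightarrow> y \<in> homog e \<Longrightarrow> x o\<^sub>L y \<in> homog (d + e)"
proof (induction d arbitrary: x)
  case 0 then show ?case by (auto simp: homog_scale)
next
  case (Suc d)
  let ?S = "{s i j o\<^sub>L h | i j h. i < m \<and> j < n i \<and> h \<in> homog d}"
  let ?V = "{x. x o\<^sub>L y \<in> homog (Suc d + e)}"
  have "subspace ?V"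
    using homog_subspace[of "Suc d + e"]
    by (auto simp: subspace_def compose_algebra bounded_bilinear.zero_left[OF bounded_bilinear_blinfun_compose]
        bounded_bilinear.scaleR_left[OF bounded_bilinear_blinfun_compose])
  moreover have "?S \<subseteq> ?V"
  proof
    fix x assume "x \<in> ?S"
    then obtain i j h where x: "x = s i j o\<^sub>L h" "i < m" "j < n i" "h \<in> homog d" by blast
    have "x o\<^sub>L y = s i j o\<^sub>L (h o\<^sub>L y)" unfolding x(1) by (rule blinfun_eqI) simp
    then show "x \<in> ?V"
      using homog_mult_gen[OF x(2,3) Suc.IH[OF x(4) Suc.prems(2)]] by (simp del: homog.simps)
  qed
  ultimately have "span ?S \<subseteq> ?V" by (rule span_minimal[rotated])
  then show ?case using Suc.prems(1) by auto
qed

lemma gauge_homog: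
  assumes z: "cmod z \<le> 1"
  shows "x \<in> homog d \<Longrightarrow> gauge z x = scale_op (z ^ d) x"
proof (induction d arbitrary: x)
  case 0
  then show ?case using z by (auto simp: gauge_simps A_mem)
next
  case (Suc d)
  let ?S = "{s i j o\<^sub>L h | i j h. i < m \<and> j < n i \<and> h \<in> homog d}"
  let ?V = "{x \<in> A. gauge z x = scale_op (z ^ Suc d) x}"
  have "subspace ?V"
    using z by (auto simp: subspace_def A_mem gauge_simps scale_op_add_right scaleR_eq_scale_op mult.commute)
  moreover have "?S \<subseteq> ?V"
  proof
    fix x assume "x \<in> ?S"
    then obtain i j h where x: "x = s i j o\<^sub>L h" "i < m" "j < n i" "h \<in> homog d" by blast
    then show "x \<in> ?V"
      using z by (simp add: gauge_simps gauge(3) A_mem gen_mem homog_mem Suc.IH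
          scale_op_compose_right[OF gen_clinear] mult.commute)
  qed
  ultimately have "span ?S \<subseteq> ?V" by (rule span_minimal[rotated])
  then show ?case using Suc.prems by auto
qed

definition tail :: "nat \<Rightarrow> 'h op set" where
  "tail d = span (\<Union>e\<in>{d..}. homog e)"

lemma tail_subspace: "subspace (tail d)"
  by (simp add: tail_def)

lemma homog_subset_tail: "d \<le> e \<Longrightarrow> x \<in> homog e \<Longrightarrow> x \<in> tail d"
  unfolding tail_def by (rule span_base) auto

lemma tail_subset: "tail d \<subseteq> A"
  unfolding tail_def by (rule span_minimal[OF _ uoa_subspace[OF uoa]]) (use homog_subset in blast)

lemma tail_mem: "x \<in> tail d \<Longrightarrow> x \<in> A" using tail_subset by blast

lemma tail_mult: "x \<in> tail d \<Longrightarrow> y \<in> tail e \<Longrightarrow> x o\<^sub>L y \<in> tail (d + e)"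
proof -
  have 1: "x o\<^sub>L y \<in> tail (d + e)" if x: "x \<in> homog d'" "d \<le> d'" and y: "y \<in> tail e" for x d' y
  proof -
    have "tail e \<subseteq> {y. x o\<^sub>L y \<in> tail (d + e)}"
      unfolding tail_def[of e]
    proof (rule span_minimal)
      show "subspace {y. x o\<^sub>L y \<in> tail (d + e)}"
        using tail_subspace[of "d + e"]
        by (auto simp: subspace_def compose_algebra bounded_bilinear.zero_right[OF bounded_bilinear_blinfun_compose]
          bounded_bilinear.scaleR_right[OF bounded_bilinear_blinfun_compose])
      show "(\<Union>e\<in>{e..}. homog e) \<subseteq> {y. x o\<^sub>L y \<in> tail (d + e)}"
      proof safe
        fix e' y assume "e \<le> e'" "y \<in> homog e'"
        then show "x o\<^sub>L y \<in> tail (d + e)"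
          using x(2) by (intro homog_subset_tail[OF _ homog_mult[OF x(1)]]) auto
      qed
    qed
    then show ?thesis using y by blast
  qed
  assume "x \<in> tail d" "y \<in> tail e"
  have "tail d \<subseteq> {x. x o\<^sub>L y \<in> tail (d + e)}"
    unfolding tail_def[of d]
  proof (rule span_minimal)
    show "subspace {x. x o\<^sub>L y \<in> tail (d + e)}"
      using tail_subspace[of "d + e"]
      by (auto simp: subspace_def compose_algebra bounded_bilinear.zero_left[OF bounded_bilinear_blinfun_compose]
        bounded_bilinear.scaleR_left[OF bounded_bilinear_blinfun_compose])
    show "(\<Union>e\<in>{d..}. homog e) \<subseteq> {x. x o\<^sub>L y \<in> tail (d + e)}"
      using 1[OF _ _ \<open>y \<in> tail e\<close>] by auto
  qed
  then show ?thesis using \<open>x \<in> tail d\<close> by blast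
qed

text \<open>The components form a sequence on all degrees, zero below \<open>d\<close> and from
  \<open>N\<close> on, so that the cut-off can be raised freely when expansions are added or
  averaged.\<close>

lemma tail_expansion:
  assumes "x \<in> tail d"
  shows "\<exists>N P. (\<forall>e. P e \<in> homog e) \<and> (\<forall>e<d. P e = 0) \<and> (\<forall>e\<ge>N. P e = 0) \<and> x = (\<Sum>e<N. P e)"
  using assms unfolding tail_def
proof (induction rule: span_induct_alt)
  case base
  then show ?case by (intro exI[of _ 0] exI[of _ "\<lambda>_. 0"]) (auto simp: subspace_0[OF homog_subspace])
next
  case (step c x y)
  then obtain N P where P: "\<forall>e. P e \<in> homog e" "\<forall>e<d. P e = 0" "\<forall>e\<ge>N. P e = 0" "y = (\<Sum>e<N. P e)"
    by blast
  obtain e where e: "d \<le> e" "x \<in> homog e" using step by auto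
  define P' where "P' = P(e := P e + c *\<^sub>R x)"
  define N' where "N' = max N (Suc e)"
  have "(\<Sum>k<N'. P' k) = (\<Sum>k<N'. P k + (if k = e then c *\<^sub>R x else 0))"
    by (rule sum.cong) (auto simp: P'_def)
  also have "\<dots> = (\<Sum>k<N'. P k) + c *\<^sub>R x" by (auto simp: sum.distrib N'_def)
  also have "(\<Sum>k<N'. P k) = (\<Sum>k<N. P k)"
    using P(3) by (intro sum.mono_neutral_right) (auto simp: N'_def)
  finally have "c *\<^sub>R x + y = (\<Sum>k<N'. P' k)" using P(4) by (simp add: add.commute)
  moreover have "\<forall>k. P' k \<in> homog k" using P(1) e homog_subspace
    by (auto simp: P'_def intro: subspace_add subspace_scale)
  moreover have "\<forall>k<d. P' k = 0" "\<forall>k\<ge>N'. P' k = 0" using P(2,3) e by (auto simp: P'_def N'_def)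
  ultimately show ?case by blast
qed

lemma closure_tail_0: "closure (tail 0) = A"
proof (rule equalityI)
  show "closure (tail 0) \<subseteq> A" by (rule closure_minimal[OF tail_subset A_closed])
  have "scale_op c x \<in> tail 0" if "x \<in> tail 0" for c x
    using tail_mult[OF homog_subset_tail[of 0 0 "scale_op c id_blinfun"] that] by simp
  moreover have "id_blinfun \<in> tail 0"
    by (rule homog_subset_tail[of 0 0]) (auto intro: image_eqI[of _ _ 1])
  ultimately have "unital_operator_algebra (closure (tail 0))"
    using tail_mult[of _ 0 _ 0] subspace_add[OF tail_subspace] A_clinear tail_subset
    by (intro unital_operator_algebra_closure) (auto dest: tail_mem)
  moreover have "s i j \<in> closure (tail 0)" if "i < m" "j < n i" for i j
  proof -
    have "s i j o\<^sub>L id_blinfun \<in> homog (Suc 0)"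
      by (rule homog_mult_gen[OF that]) (auto intro: image_eqI[of _ _ 1])
    then show ?thesis using homog_subset_tail[of 0 "Suc 0"] closure_subset by auto
  qed
  ultimately show "A \<subseteq> closure (tail 0)" by (rule A_subset)
qed

lemma tail_approx:
  assumes "a \<in> closure (tail d)" "0 < (\<epsilon>::real)"
  obtains N P where "\<And>e. P e \<in> homog e" "\<And>e. e < d \<Longrightarrow> P e = 0" "\<And>e. e \<ge> N \<Longrightarrow> P e = 0"
    "norm ((\<Sum>e<N. P e) - a) < \<epsilon>"
proof -
  obtain q where "q \<in> tail d" "dist q a < \<epsilon>" using assms closure_approachable by blast
  then show ?thesis using tail_expansion[of q d] that by (metis dist_norm)
qed

end

section \<open>Fourier coefficients\<close>

text \<open>The base \<open>q\<close> of the powers satisfies \<open>q ^ N = 1\<close>, so the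
  geometric sum is annihilated by \<open>1 - q\<close>; and \<open>q = 1\<close> exactly when
  \<open>N\<close> divides \<open>j\<close>.\<close>

lemma sum_roots_of_unity_power:
  assumes "0 < N"
  shows "(\<Sum>k<N. exp (2 * of_real pi * \<i> * of_nat j / of_nat N) ^ k) =
    (if N dvd j then of_nat N else (0::complex))"
proof -
  define q where "q = exp (2 * of_real pi * \<i> * of_nat j / of_nat N :: complex)"
  have q1: "q = 1 \<longleftrightarrow> N dvd j"
    unfolding q_def using assms by (intro complex_root_unity_eq_1) simp
  have "q ^ N = exp (of_nat N * (2 * of_real pi * \<i> * of_nat j / of_nat N))"
    unfolding q_def by (rule exp_of_nat_mult[symmetric])
  also have "of_nat N * (2 * of_real pi * \<i> * of_nat j / of_nat N) = 2 * of_real pi * \<i> * of_nat j"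
    using assms by simp
  also have "exp (2 * of_real pi * \<i> * of_nat j) = (1::complex)"
    using complex_root_unity_eq_1[of 1 j] by simp
  finally have "q ^ N = 1" .
  then have "(1 - q) * (\<Sum>k<N. q ^ k) = 0"
    using power_diff_1_eq[of q N] by (simp add: algebra_simps)
  then show ?thesis using q1 by (auto simp: q_def[symmetric])
qed

context free_rows
begin

text \<open>The \<open>e\<close>-th Fourier coefficient of the gauge action, with the integral over
  the circle replaced by the mean over the \<open>N\<close>-th roots of unity. The exponent
  \<open>N - e\<close> stands for \<open>- e\<close>, which is the same modulo \<open>N\<close> for
  \<open>e \<le> N\<close>. On sums of components of degree below \<open>N\<close> the mean is
  exact.\<close>

definition average :: "nat \<Rightarrow> nat \<Rightarrow> 'h op \<Rightarrow> 'h op" where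
  "average N e a = scale_op (1 / of_nat N) (\<Sum>k<N. scale_op (exp (2 * of_real pi * \<i> / of_nat N) ^ (k * (N - e)))
     (gauge (exp (2 * of_real pi * \<i> / of_nat N) ^ k) a))"

lemma norm_root_of_unity: "cmod (exp (2 * of_real pi * \<i> / of_nat N)) = 1"
  by (simp add: norm_exp_eq_Re)

lemma norm_average_le:
  assumes "a \<in> A" "0 < N" shows "norm (average N e a) \<le> norm a"
proof -
  let ?w = "exp (2 * of_real pi * \<i> / of_nat N) :: complex"
  have "norm (\<Sum>k<N. scale_op (?w ^ (k * (N - e))) (gauge (?w ^ k) a)) \<le> (\<Sum>k<N. norm a)"
  proof (intro order.trans[OF norm_sum] sum_mono)
    fix k
    have "cmod (?w ^ k) \<le> 1" by (simp add: norm_power norm_root_of_unity)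
    from hom_norm[OF uoa gauge(1)[OF this] assms(1)]
    show "norm (scale_op (?w ^ (k * (N - e))) (gauge (?w ^ k) a)) \<le> norm a"
      by (simp add: norm_scale_op norm_power norm_root_of_unity)
  qed
  then show ?thesis
    using assms(2) by (simp add: average_def norm_scale_op norm_divide field_simps)
qed

lemma average_diff:
  assumes "a \<in> A" "b \<in> A" shows "average N e (a - b) = average N e a - average N e b"
proof -
  let ?w = "exp (2 * of_real pi * \<i> / of_nat N) :: complex"
  have "gauge (?w ^ k) (a - b) = gauge (?w ^ k) a - gauge (?w ^ k) b" for k
    using assms by (intro gauge_simps) (simp_all add: norm_power norm_root_of_unity)
  then show ?thesis
    by (simp add: average_def scale_op_diff_right sum_subtractf)
qed

lemma average_graded:
  assumes P: "\<And>e. P e \<in> homog e" and e: "e < N"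
  shows "average N e (\<Sum>e<N. P e) = P e"
proof -
  let ?w = "exp (2 * of_real pi * \<i> / of_nat N) :: complex"
  have w: "cmod (?w ^ k) \<le> 1" for k by (simp add: norm_power norm_root_of_unity)
  have "gauge (?w ^ k) (\<Sum>e<N. P e) = (\<Sum>d<N. scale_op ((?w ^ k) ^ d) (P d))" for k
    using gauge_homog[OF w P] by (simp add: gauge_simps(8)[OF w] homog_mem[OF P])
  then have "(\<Sum>k<N. scale_op (?w ^ (k * (N - e))) (gauge (?w ^ k) (\<Sum>e<N. P e))) =
      (\<Sum>k<N. \<Sum>d<N. scale_op (?w ^ (k * (N - e)) * (?w ^ k) ^ d) (P d))"
    by (simp add: scale_op_sum_right)
  also have "\<dots> = (\<Sum>d<N. scale_op (\<Sum>k<N. ?w ^ (k * (N - e)) * (?w ^ k) ^ d) (P d))"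
    by (subst sum.swap) (simp add: scale_op_sum_left)
  also have "\<dots> = (\<Sum>d<N. if d = e then scale_op (of_nat N) (P e) else 0)"
  proof (rule sum.cong[OF refl])
    fix d assume "d \<in> {..<N}"
    have wp: "?w ^ (k * (N - e)) * (?w ^ k) ^ d = exp (2 * of_real pi * \<i> * of_nat (N - e + d) / of_nat N) ^ k" for k
    proof -
      have "?w ^ (k * (N - e)) * (?w ^ k) ^ d = (?w ^ (N - e + d)) ^ k"
        by (simp add: power_mult[symmetric] power_add[symmetric] algebra_simps)
      also have "?w ^ (N - e + d) = exp (of_nat (N - e + d) * (2 * of_real pi * \<i> / of_nat N))"
        by (rule exp_of_nat_mult[symmetric])
      finally show ?thesis by (simp add: algebra_simps)
    qed
    have "N dvd (N - e + d) \<longleftrightarrow> d = e"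
    proof
      assume "N dvd N - e + d"
      then obtain c where c: "N - e + d = N * c" by blast
      have "0 < N * c" "N * c < N * 2" unfolding c[symmetric] using e \<open>d \<in> {..<N}\<close> by auto
      then have "c = 1" by (cases c) auto
      then show "d = e" using c e by simp
    qed (use e in auto)
    then show "scale_op (\<Sum>k<N. ?w ^ (k * (N - e)) * (?w ^ k) ^ d) (P d) =
        (if d = e then scale_op (of_nat N) (P e) else 0)"
      unfolding wp using sum_roots_of_unity_power[of N "N - e + d"] e by auto
  qed
  also have "\<dots> = scale_op (of_nat N) (P e)" using e by simp
  finally show ?thesis using e by (simp add: average_def)
qed

text \<open>The analogue of Cauchy's estimate: averaging is contractive and isolates the component
  of degree \<open>e\<close>.\<close>

lemma norm_homog_component_le:
  assumes P: "\<And>e. P e \<in> homog e" and "\<And>e. e \<ge> N \<Longrightarrow> P e = 0"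
  shows "norm (P e) \<le> norm (\<Sum>e<N. P e)"
proof (cases "e < N")
  case True
  then show ?thesis
    using norm_average_le[of "\<Sum>e<N. P e" N e] average_graded[OF P True]
    by (simp add: A_mem homog_mem[OF P])
qed (use assms in simp)

lemma gauge_graded:
  assumes "\<And>e. P e \<in> homog e" "cmod z \<le> 1"
  shows "gauge z (\<Sum>e<N. P e) = (\<Sum>e<N. scale_op (z ^ e) (P e))"
  using gauge_homog[OF assms(2,1)] by (simp add: gauge_simps(8)[OF assms(2)] homog_mem[OF assms(1)])

text \<open>For a finite sum of components of degree at least \<open>d\<close>, the component of
  degree \<open>e\<close> is multiplied by \<open>r ^ e\<close> and bounded by the norm of the
  whole; summing the geometric series from \<open>d\<close> on gives the constant. Approximation
  extends the bound to the closure.\<close>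

lemma norm_gauge_closure_tail:
  assumes a: "a \<in> closure (tail d)" and r: "0 \<le> r" "r < 1"
  shows "norm (gauge (complex_of_real r) a) \<le> r ^ d / (1 - r) * norm a"
proof (rule field_le_epsilon)
  fix \<epsilon> :: real assume "0 < \<epsilon>"
  define K where "K = r ^ d / (1 - r)"
  have K: "0 \<le> K" using r by (simp add: K_def)
  have aA: "a \<in> A" using a closure_mono[OF tail_subset, of d] A_closed by (auto simp: closure_closed)
  have z: "cmod (complex_of_real r) \<le> 1" using r by simp
  \<comment> \<open>An approximation error \<delta> enters twice, once multiplied by
    \<open>K\<close> through \<open>norm q\<close> and once through the contraction
    \<open>gauge r\<close>, so \<open>K + 1\<close> is the total cost.\<close>
  define \<delta> where "\<delta> = \<epsilon> / (K + 1)"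
  have \<delta>: "0 < \<delta>" using \<open>0 < \<epsilon>\<close> K by (simp add: \<delta>_def)
  obtain N P where P: "\<And>e. P e \<in> homog e" "\<And>e. e < d \<Longrightarrow> P e = 0" "\<And>e. e \<ge> N \<Longrightarrow> P e = 0"
    and close: "norm ((\<Sum>e<N. P e) - a) < \<delta>"
    using tail_approx[OF a \<delta>] by metis
  define q where "q = (\<Sum>e<N. P e)"
  have qA: "q \<in> A" unfolding q_def by (intro A_mem homog_mem[OF P(1)])
  have "norm (gauge (complex_of_real r) q) \<le> (\<Sum>e<N. norm (scale_op (complex_of_real r ^ e) (P e)))"
    unfolding q_def gauge_graded[OF P(1) z] by (rule norm_sum)
  also have "\<dots> \<le> (\<Sum>e<N. (if e < d then 0 else r ^ e) * norm q)"
  proof (rule sum_mono)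
    fix e
    have "norm (P e) \<le> norm q" unfolding q_def by (rule norm_homog_component_le[OF P(1,3)])
    then show "norm (scale_op (complex_of_real r ^ e) (P e)) \<le> (if e < d then 0 else r ^ e) * norm q"
      using P(2)[of e] r by (auto simp: norm_scale_op norm_power intro: mult_left_mono)
  qed
  also have "\<dots> = (\<Sum>e<N. if e < d then 0 else r ^ e) * norm q" by (simp add: sum_distrib_right)
  also have "(\<Sum>e<N. if e < d then 0 else r ^ e) \<le> K"
  proof -
    have "(\<Sum>e<N. if e < d then 0 else r ^ e) \<le> (\<Sum>e<d + N. if e < d then 0 else r ^ e)"
      using r by (intro sum_mono2) auto
    also have "\<dots> = (\<Sum>e=d..<d + N. r ^ e)"
      by (rule sum.mono_neutral_cong_right) auto
    also have "\<dots> = r ^ d * (\<Sum>e<N. r ^ e)"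
      by (simp add: sum_distrib_left power_add sum.atLeastLessThan_shift_0[of _ d] lessThan_atLeast0)
    also have "(\<Sum>e<N. r ^ e) \<le> 1 / (1 - r)"
      using sum_le_suminf[of "\<lambda>e. r ^ e" "{..<N}"] r by (simp add: suminf_geometric summable_geometric)
    finally show ?thesis using r by (simp add: K_def mult_left_mono)
  qed
  finally have q: "norm (gauge (complex_of_real r) q) \<le> K * norm q" by (simp add: mult_right_mono)
  have qa: "norm (q - a) < \<delta>" using close by (simp add: q_def)
  have "norm (gauge (complex_of_real r) a) \<le>
      norm (gauge (complex_of_real r) q) + norm (gauge (complex_of_real r) q - gauge (complex_of_real r) a)"
    by norm
  also have "\<dots> \<le> K * norm q + norm (q - a)"
    by (intro add_mono q hom_norm_diff[OF uoa gauge(1)[OF z] qA aA])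
  also have "\<dots> \<le> K * (norm a + \<delta>) + \<delta>"
  proof (intro add_mono mult_left_mono K)
    show "norm q \<le> norm a + \<delta>" using qa norm_triangle_sub[of q a] by linarith
  qed (use qa in simp)
  also have "\<dots> = K * norm a + \<epsilon>"
  proof -
    have "(K + 1) * \<delta> = \<epsilon>" using K by (simp add: \<delta>_def)
    then show ?thesis by (simp add: algebra_simps)
  qed
  finally show "norm (gauge (complex_of_real r) a) \<le> r ^ d / (1 - r) * norm a + \<epsilon>"
    unfolding K_def .
qed

text \<open>On a finite sum of homogeneous elements \<open>gauge r\<close> is a polynomial in
  \<open>r\<close> and tends to the identity as \<open>r\<close> tends to 1. Approximating
  \<open>a\<close> by such a sum costs half of \<epsilon> in the vanishing of
  \<open>gauge r a\<close> and half in the norm of \<open>a\<close>.\<close>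

lemma gauge_radial_limit_zero:
  assumes a: "a \<in> A" and 0: "\<And>r. 0 \<le> r \<Longrightarrow> r < 1 \<Longrightarrow> gauge (complex_of_real r) a = 0"
  shows "a = 0"
proof -
  have "norm a \<le> 0 + \<epsilon>" if "0 < \<epsilon>" for \<epsilon> :: real
  proof -
    have "a \<in> closure (tail 0)" using a closure_tail_0 by simp
    then obtain N P where P: "\<And>e. P e \<in> homog e"
      and close: "norm ((\<Sum>e<N. P e) - a) < \<epsilon> / 2"
      using tail_approx[of a 0 "\<epsilon> / 2"] \<open>0 < \<epsilon>\<close> by (metis half_gt_zero)
    define q where "q = (\<Sum>e<N. P e)"
    have qA: "q \<in> A" unfolding q_def by (intro A_mem homog_mem[OF P(1)])
    have *: "norm (\<Sum>e<N. scale_op (complex_of_real r ^ e) (P e)) \<le> \<epsilon> / 2" if r: "0 \<le> r" "r < 1" for r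
    proof -
      have z: "cmod (complex_of_real r) \<le> 1" using r by simp
      have "norm (gauge (complex_of_real r) q - gauge (complex_of_real r) a) \<le> norm (q - a)"
        by (rule hom_norm_diff[OF uoa gauge(1)[OF z] qA a])
      then show ?thesis using 0[OF r] close by (simp add: q_def gauge_graded[OF P z])
    qed
    have "norm (\<Sum>e<N. scale_op (complex_of_real (1 - inverse (real (Suc k))) ^ e) (P e)) \<le> \<epsilon> / 2" for k
    proof -
      have "0 \<le> 1 - inverse (real (Suc k))" "1 - inverse (real (Suc k)) < 1" by (simp_all add: field_simps)
      then show ?thesis by (rule *)
    qed
    moreover have "(\<lambda>k. norm (\<Sum>e<N. scale_op (complex_of_real (1 - inverse (real (Suc k))) ^ e) (P e)))
        \<longlonglongrightarrow> norm (\<Sum>e<N. scale_op (complex_of_real (1 - 0) ^ e) (P e))"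
      by (intro tendsto_intros bounded_linear.tendsto[OF bounded_linear_scale_op_left]
          LIMSEQ_inverse_real_of_nat)
    ultimately have "norm (\<Sum>e<N. scale_op (complex_of_real (1 - 0) ^ e) (P e)) \<le> \<epsilon> / 2"
      by (intro LIMSEQ_le_const2) blast+
    then have "norm q \<le> \<epsilon> / 2" by (simp add: q_def)
    moreover have "norm a \<le> norm q + norm (q - a)" by norm
    ultimately show ?thesis using close by (simp add: q_def)
  qed
  then have "norm a \<le> 0" by (rule field_le_epsilon)
  then show ?thesis by simp
qed

text \<open>For fixed \<open>r < 1\<close> the bound \<open>r ^ d / (1 - r) * norm a\<close> holds
  for every \<open>d\<close> and tends to 0, so \<open>gauge r\<close> kills \<open>a\<close>; then
  \<open>r\<close> tends to 1.\<close>

lemma closure_tail_separated: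
  assumes "\<And>d. a \<in> closure (tail d)"
  shows "a = 0"
proof (rule gauge_radial_limit_zero)
  show "a \<in> A" using assms[of 0] closure_tail_0 by simp
  fix r :: real assume r: "0 \<le> r" "r < 1"
  have "(\<lambda>d. r ^ d / (1 - r) * norm a) \<longlonglongrightarrow> 0 / (1 - r) * norm a"
    using r by (intro tendsto_intros LIMSEQ_power_zero) auto
  then have "norm (gauge (complex_of_real r) a) \<le> 0 / (1 - r) * norm a"
    by (rule LIMSEQ_le_const) (use norm_gauge_closure_tail[OF assms r] in blast)
  then show "gauge (complex_of_real r) a = 0" by simp
qed

text \<open>Averaging in degree 1 fixes the eigenvector \<open>X\<close> and sends an approximating
  finite sum to its component of degree 1. Since averaging is contractive, that component
  approximates \<open>X\<close> equally well.\<close>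

lemma gauge_eigenvector_closure_homog:
  assumes X: "X \<in> A" and ev: "\<And>w. cmod w = 1 \<Longrightarrow> gauge w X = scale_op w X"
  shows "X \<in> closure (homog 1)"
  unfolding closure_approachable
proof (intro allI impI)
  fix \<epsilon> :: real assume "0 < \<epsilon>"
  have "X \<in> closure (tail 0)" using X closure_tail_0 by simp
  then obtain N P where P: "\<And>e. P e \<in> homog e" "\<And>e. e \<ge> N \<Longrightarrow> P e = 0"
    and close: "norm ((\<Sum>e<N. P e) - X) < \<epsilon>"
    using tail_approx[of X 0 \<epsilon>] \<open>0 < \<epsilon>\<close> by metis
  \<comment> \<open>Adding 2 ensures \<open>1 < N'\<close>, so that degree 1 is among those
    separated by the \<open>N'\<close>-th roots of unity.\<close>
  define N' where "N' = N + 2"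
  have "(\<Sum>e<N'. P e) = (\<Sum>e<N. P e)"
    using P(2) by (intro sum.mono_neutral_right) (auto simp: N'_def)
  then have close': "norm ((\<Sum>e<N'. P e) - X) < \<epsilon>" using close by simp
  have N': "1 < N'" by (simp add: N'_def)
  let ?w = "exp (2 * of_real pi * \<i> / of_nat N') :: complex"
  have wN: "?w ^ N' = 1"
    using exp_of_nat_mult[of N' "2 * of_real pi * \<i> / of_nat N' :: complex"] N' by (simp add: exp_eq_1)
  have "average N' 1 X = X"
  proof -
    have "scale_op (?w ^ (k * (N' - 1))) (gauge (?w ^ k) X) = X" for k
    proof -
      have "?w ^ (k * (N' - 1)) * ?w ^ k = (?w ^ N') ^ k"
        using N' by (simp add: power_mult[symmetric] power_add[symmetric] algebra_simps)
      then show ?thesis using ev[of "?w ^ k"] by (simp add: norm_power norm_root_of_unity wN)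
    qed
    then show ?thesis using N' by (simp add: average_def sum_constant_scaleR scaleR_eq_scale_op)
  qed
  moreover have "average N' 1 (\<Sum>e<N'. P e) = P 1" by (rule average_graded[OF P(1) N'])
  ultimately have "P 1 - X = average N' 1 ((\<Sum>e<N'. P e) - X)"
    by (simp add: average_diff A_mem homog_mem[OF P(1)] X)
  then have "norm (P 1 - X) < \<epsilon>"
    using norm_average_le[of "(\<Sum>e<N'. P e) - X" N' 1] close' N'
    by (simp add: A_mem homog_mem[OF P(1)] X)
  then show "\<exists>y\<in>homog 1. dist y X < \<epsilon>" using P(1)[of 1] by (auto simp: dist_norm)
qed

section \<open>The degree-one part: coefficients and norm\<close>

definition lin_comb :: "(nat \<Rightarrow> nat \<Rightarrow> complex) \<Rightarrow> 'h op" where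
  "lin_comb c = (\<Sum>i<m. \<Sum>j<n i. scale_op (c i j) (s i j))"

lemma lin_comb_mem: "lin_comb c \<in> A"
  unfolding lin_comb_def by (intro A_mem gen_mem) auto

text \<open>Coefficients are read off by the characters at the unit vectors. The resulting map
  \<open>F\<close> is continuous and fixes degree one, hence also its closure, while every value of
  \<open>F\<close> is a linear combination of generators.\<close>

lemma closure_homog_1:
  assumes X: "X \<in> closure (homog 1)"
  shows "\<exists>c. X = lin_comb c"
proof -
  define \<delta> where "\<delta> i j i' j' = (if i' = i \<and> j' = j then 1 else 0 :: complex)" for i j i' j' :: nat
  have "\<exists>\<kappa>. character A \<kappa> \<and> (\<forall>i'<m. \<forall>j'<n i'. \<kappa> (s i' j') = \<delta> i j i' j')" for i j
  proof (rule ex_character)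
    fix i'
    have "(\<Sum>j'<n i'. (cmod (\<delta> i j i' j'))\<^sup>2) = (\<Sum>j'<n i'. if j' = j then (if i' = i then 1 else 0) else 0)"
      by (rule sum.cong) (auto simp: \<delta>_def)
    also have "\<dots> \<le> 1" by simp
    finally show "(\<Sum>j'<n i'. (cmod (\<delta> i j i' j'))\<^sup>2) \<le> 1" .
  qed
  then obtain \<kappa> where \<kappa>: "\<And>i j. character A (\<kappa> i j)"
    "\<And>i j i' j'. i' < m \<Longrightarrow> j' < n i' \<Longrightarrow> \<kappa> i j (s i' j') = \<delta> i j i' j'" by metis
  define F where "F x = lin_comb (\<lambda>i j. \<kappa> i j x)" for x
  have F_gen: "F (s i' j') = s i' j'" if "i' < m" "j' < n i'" for i' j'
  proof -
    have "F (s i' j') = (\<Sum>i<m. \<Sum>j<n i. if j = j' then (if i = i' then s i' j' else 0) else 0)"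
      unfolding F_def lin_comb_def using that by (intro sum.cong) (auto simp: \<kappa>(2) \<delta>_def)
    also have "\<dots> = (\<Sum>i<m. if i = i' then s i' j' else 0)"
      by (rule sum.cong) (use that in auto)
    finally show ?thesis using that by simp
  qed
  have "subspace {x \<in> A. F x = x}"
    by (simp add: subspace_def A_mem F_def lin_comb_def char_zero[OF uoa \<kappa>(1)] char_add[OF uoa \<kappa>(1)]
        char_scale[OF uoa \<kappa>(1)] scale_op_add_left sum.distrib scaleR_eq_scale_op)
      (simp add: scale_op_scale_op[symmetric] scale_op_sum_right[symmetric] del: scale_op_scale_op)
  moreover have "{s i j o\<^sub>L h | i j h. i < m \<and> j < n i \<and> h \<in> homog 0} \<subseteq> {x \<in> A. F x = x}"
  proof safe
    fix i j h assume "i < m" "j < n i" "h \<in> homog 0"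
    then obtain c where c: "s i j o\<^sub>L h = scale_op c (s i j)"
      by (auto simp: scale_op_compose_right[OF gen_clinear])
    have "F (scale_op c (s i j)) = scale_op c (F (s i j))"
      using \<open>i < m\<close> \<open>j < n i\<close> by (simp add: F_def lin_comb_def char_scale[OF uoa \<kappa>(1)] gen_mem scale_op_sum_right)
    then show "s i j o\<^sub>L h \<in> A" "F (s i j o\<^sub>L h) = s i j o\<^sub>L h"
      unfolding c using \<open>i < m\<close> \<open>j < n i\<close> by (auto simp: F_gen A_mem gen_mem)
  qed
  ultimately have h1: "homog 1 \<subseteq> {x \<in> A. F x = x}"
    unfolding One_nat_def homog.simps(2) by (rule span_minimal[rotated])
  obtain x where x: "\<And>k. x k \<in> homog 1" "x \<longlonglongrightarrow> X" using X unfolding closure_sequential by blast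
  have xA: "x k \<in> A" for k using x(1) homog_mem by blast
  have XA: "X \<in> A" by (rule closed_sequentially[OF A_closed xA x(2)])
  have "(\<lambda>k. F (x k)) \<longlonglongrightarrow> F X"
    unfolding F_def lin_comb_def
    by (intro tendsto_sum bounded_linear.tendsto[OF bounded_linear_scale_op_left]
        char_tendsto[OF uoa \<kappa>(1) xA XA x(2)])
  moreover have "F (x k) = x k" for k using x(1)[of k] h1 by blast
  ultimately have "F X = X" using x(2) LIMSEQ_unique by auto
  then show ?thesis unfolding F_def by metis
qed

text \<open>The upper bound adds the estimates for the single rows. For the lower bound one
  character is optimal in all rows at once, because characters are indexed by a product of balls and
  the point can be chosen in each ball separately.\<close>

lemma norm_lin_comb: "norm (lin_comb c) = (\<Sum>i<m. L2_set (\<lambda>j. cmod (c i j)) {..<n i})"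
proof (rule antisym)
  show "norm (lin_comb c) \<le> (\<Sum>i<m. L2_set (\<lambda>j. cmod (c i j)) {..<n i})"
    unfolding lin_comb_def
    by (intro order.trans[OF norm_sum] sum_mono norm_row_combination_le row) auto
  let ?L = "\<lambda>i. L2_set (\<lambda>j. cmod (c i j)) {..<n i}"
  have L2: "(\<Sum>j<n i. (cmod (c i j))\<^sup>2) = (?L i)\<^sup>2" for i
    by (simp add: L2_set_def sum_nonneg)
  \<comment> \<open>In each row the point is the conjugate of the normalised coefficient vector,
    where Cauchy-Schwarz is an equality. For a zero row, division by zero gives the centre of the
    ball.\<close>
  have "\<exists>\<kappa>. character A \<kappa> \<and> (\<forall>i<m. \<forall>j<n i. \<kappa> (s i j) = cnj (c i j) / of_real (?L i))"
  proof (rule ex_character)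
    fix i
    have "(\<Sum>j<n i. (cmod (cnj (c i j) / complex_of_real (?L i)))\<^sup>2) = (?L i)\<^sup>2 / (?L i)\<^sup>2"
      by (simp add: norm_divide power_divide sum_divide_distrib[symmetric] L2)
    also have "\<dots> \<le> 1" by simp
    finally show "(\<Sum>j<n i. (cmod (cnj (c i j) / complex_of_real (?L i)))\<^sup>2) \<le> 1" .
  qed
  then obtain \<kappa> where \<kappa>: "character A \<kappa>" "\<forall>i<m. \<forall>j<n i. \<kappa> (s i j) = cnj (c i j) / of_real (?L i)"
    by blast
  have "\<kappa> (lin_comb c) = (\<Sum>i<m. \<kappa> (\<Sum>j<n i. scale_op (c i j) (s i j)))"
    unfolding lin_comb_def by (intro char_sum[OF uoa \<kappa>(1)] A_mem gen_mem) auto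
  also have "\<dots> = (\<Sum>i<m. \<Sum>j<n i. \<kappa> (scale_op (c i j) (s i j)))"
    by (intro sum.cong char_sum[OF uoa \<kappa>(1)] A_mem gen_mem) auto
  also have "\<dots> = (\<Sum>i<m. \<Sum>j<n i. c i j * (cnj (c i j) / of_real (?L i)))"
    using \<kappa>(2) by (intro sum.cong) (auto simp: char_scale[OF uoa \<kappa>(1)] gen_mem)
  also have "\<dots> = (\<Sum>i<m. complex_of_real (?L i))"
  proof (rule sum.cong[OF refl])
    fix i
    have "(\<Sum>j<n i. c i j * (cnj (c i j) / of_real (?L i))) =
        (\<Sum>j<n i. complex_of_real ((cmod (c i j))\<^sup>2)) / of_real (?L i)"
      by (simp only: complex_norm_square sum_divide_distrib times_divide_eq_right)
    also have "(\<Sum>j<n i. complex_of_real ((cmod (c i j))\<^sup>2)) = complex_of_real ((?L i)\<^sup>2)"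
      unfolding L2[symmetric] by simp
    finally show "(\<Sum>j<n i. c i j * (cnj (c i j) / of_real (?L i))) = complex_of_real (?L i)"
      by (simp add: power2_eq_square)
  qed
  also have "cmod \<dots> = (\<Sum>i<m. ?L i)"
    unfolding of_real_sum[symmetric] norm_of_real by (simp add: sum_nonneg)
  finally show "(\<Sum>i<m. ?L i) \<le> norm (lin_comb c)"
    using char_norm[OF uoa \<kappa>(1) lin_comb_mem, of c] by simp
qed

end

section \<open>Moebius automorphisms\<close>

lemma adjoint_op_compose:
  assumes "S \<in> clinear_ops" "T \<in> clinear_ops"
  shows "adjoint_op (S o\<^sub>L T) = adjoint_op T o\<^sub>L adjoint_op S"
  by (rule adjoint_op_eqI) (simp add: cinner_adjoint_op assms)

lemma adjoint_op_scale:
  assumes "T \<in> clinear_ops" shows "adjoint_op (scale_op c T) = scale_op (cnj c) (adjoint_op T)"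
  by (rule adjoint_op_eqI)
    (simp add: scale_op_apply cinner_scaleC_left cinner_scaleC_right cinner_adjoint_op assms)

lemma adjoint_op_diff:
  assumes "S \<in> clinear_ops" "T \<in> clinear_ops"
  shows "adjoint_op (S - T) = adjoint_op S - adjoint_op T"
  by (rule adjoint_op_eqI)
    (simp add: blinfun.diff_left cinner_diff_left cinner_diff_right cinner_adjoint_op assms)

lemma adjoint_op_id: "adjoint_op id_blinfun = id_blinfun"
  by (rule adjoint_op_eqI) simp

text \<open>The right and left inverses are fixed points of the contractions sending
  \<open>X\<close> to \<open>1 + h X\<close> and to \<open>1 + X h\<close> on the closed, hence
  complete, algebra \<open>B\<close>; this keeps the inverse inside \<open>B\<close>. The two agree
  by associativity.\<close>

lemma ex_resolvent:
  fixes B :: "'h::complex_hilbert_space op set"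
  assumes B: "unital_operator_algebra B" and g: "g \<in> B" and small: "cmod c * norm g < 1"
  shows "\<exists>R\<in>B. (id_blinfun - scale_op c g) o\<^sub>L R = id_blinfun \<and> R o\<^sub>L (id_blinfun - scale_op c g) = id_blinfun"
proof -
  let ?h = "scale_op c g"
  note mem = uoa_id[OF B] uoa_add[OF B] uoa_compose[OF B] uoa_scale[OF B] g
  have h: "norm ?h < 1" using small by (simp add: norm_scale_op)
  have cB: "complete B" using uoa_closed[OF B] by (simp add: complete_eq_closed)
  have ne: "B \<noteq> {}" using uoa_id[OF B] by blast
  have "\<exists>!X\<in>B. id_blinfun + (?h o\<^sub>L X) = X"
  proof (rule Banach_fix[OF cB ne norm_ge_zero h])
    show "(\<lambda>X. id_blinfun + (?h o\<^sub>L X)) ` B \<subseteq> B" using mem by blast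
    show "dist (id_blinfun + (?h o\<^sub>L X)) (id_blinfun + (?h o\<^sub>L Y)) \<le> norm ?h * dist X Y" for X Y
      using norm_blinfun_compose[of ?h "X - Y"] by (simp add: dist_norm compose_algebra)
  qed
  then obtain R where R: "R \<in> B" "id_blinfun + (?h o\<^sub>L R) = R" by blast
  have "\<exists>!X\<in>B. id_blinfun + (X o\<^sub>L ?h) = X"
  proof (rule Banach_fix[OF cB ne norm_ge_zero h])
    show "(\<lambda>X. id_blinfun + (X o\<^sub>L ?h)) ` B \<subseteq> B" using mem by blast
    show "dist (id_blinfun + (X o\<^sub>L ?h)) (id_blinfun + (Y o\<^sub>L ?h)) \<le> norm ?h * dist X Y" for X Y
      using norm_blinfun_compose[of "X - Y" ?h] by (simp add: dist_norm compose_algebra mult.commute)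
  qed
  then obtain R' where R': "id_blinfun + (R' o\<^sub>L ?h) = R'" by blast
  have right: "(id_blinfun - ?h) o\<^sub>L R = id_blinfun"
    unfolding compose_algebra blinfun_compose_id using R(2) by (metis add_diff_cancel_right')
  have left: "R' o\<^sub>L (id_blinfun - ?h) = id_blinfun"
    unfolding compose_algebra blinfun_compose_id using R' by (metis add_diff_cancel_right')
  have "R' = R' o\<^sub>L ((id_blinfun - ?h) o\<^sub>L R)" by (simp add: right)
  also have "\<dots> = (R' o\<^sub>L (id_blinfun - ?h)) o\<^sub>L R" by (rule blinfun_eqI) simp
  also have "\<dots> = R" by (simp add: left)
  finally show ?thesis using R(1) right left by blast
qed

text \<open>The scalar identity \<open>|1 - a z|^2 - |z - cnj a|^2 = (1 - |a|^2)(1 - |z|^2)\<close>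
  made homogeneous, with \<open>y\<close> in place of 1 and \<open>p\<close> in place of
  \<open>z\<close>.\<close>

lemma norm_moebius_identity:
  fixes p y :: "'h::complex_hilbert_space"
  shows "(norm (p - cnj a *\<^sub>C y))\<^sup>2 + (1 - (cmod a)\<^sup>2) * ((norm y)\<^sup>2 - (norm p)\<^sup>2) = (norm (y - a *\<^sub>C p))\<^sup>2"
proof -
  have expand: "(norm (u - v))\<^sup>2 = (norm u)\<^sup>2 - 2 * inner u v + (norm v)\<^sup>2" for u v :: 'h
    by (simp add: power2_norm_eq_inner inner_diff_left inner_diff_right inner_commute)
  have "inner p (cnj a *\<^sub>C y) = Re (cnj a * cinner p y)"
    by (simp add: inner_eq_Re_cinner cinner_scaleC_right)
  also have "cnj a * cinner p y = cnj (a * cinner y p)" by (simp flip: cinner_commute)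
  also have "Re \<dots> = inner y (a *\<^sub>C p)" by (simp add: inner_eq_Re_cinner cinner_scaleC_right)
  finally show ?thesis
    unfolding expand by (simp add: norm_scaleC power_mult_distrib algebra_simps)
qed

context free_rows
begin

definition unit_coeff :: "nat \<Rightarrow> nat \<Rightarrow> nat \<Rightarrow> nat \<Rightarrow> complex" where
  "unit_coeff i j i' j' = (if i' = i \<and> j' = j then 1 else 0)"

lemma L2_set_unit_coeff:
  assumes "j < n i"
  shows "L2_set (\<lambda>j'. cmod (unit_coeff i j i' j')) {..<n i'} = (if i' = i then 1 else 0)"
proof -
  have "(\<Sum>j'<n i'. (cmod (unit_coeff i j i' j'))\<^sup>2) = (\<Sum>j'<n i'. if j' = j then (if i' = i then 1 else 0) else 0)"
    by (rule sum.cong) (auto simp: unit_coeff_def)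
  then show ?thesis using assms by (auto simp: L2_set_def)
qed

lemma lin_comb_unit_coeff:
  assumes "i < m" "j < n i" shows "lin_comb (unit_coeff i j) = s i j"
proof -
  have "lin_comb (unit_coeff i j) = (\<Sum>i'<m. if i' = i then (\<Sum>j'<n i. if j' = j then s i j else 0) else 0)"
    unfolding lin_comb_def
  proof (rule sum.cong[OF refl])
    fix i'
    have "(\<Sum>j'<n i'. scale_op (unit_coeff i j i' j') (s i' j')) =
        (\<Sum>j'<n i'. if j' = j then (if i' = i then s i j else 0) else 0)"
      by (rule sum.cong) (auto simp: unit_coeff_def)
    then show "(\<Sum>j'<n i'. scale_op (unit_coeff i j i' j') (s i' j')) =
        (if i' = i then (\<Sum>j'<n i. if j' = j then s i j else 0) else 0)"
      by auto
  qed
  then show ?thesis using assms by simp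
qed

lemma norm_gen: "i < m \<Longrightarrow> j < n i \<Longrightarrow> norm (s i j) = 1"
  using norm_lin_comb[of "unit_coeff i j"] by (simp add: lin_comb_unit_coeff L2_set_unit_coeff)

lemma factor_uoa: "i < m \<Longrightarrow> unital_operator_algebra (free_factor n s i)"
  unfolding free_factor_def by (rule unital_operator_algebra_generated) (use gen_clinear in auto)

lemma factor_gen: "j < n i \<Longrightarrow> s i j \<in> free_factor n s i"
  unfolding free_factor_def using generated_algebra_subset[of "{s i j | j. j < n i}"] by blast

lemma factor_subset:
  assumes "unital_operator_algebra V" "\<And>j. j < n i \<Longrightarrow> s i j \<in> V"
  shows "free_factor n s i \<subseteq> V"
  unfolding free_factor_def by (rule generated_algebra_minimal[OF assms(1)]) (use assms(2) in auto)

lemma factor_subset_A: "i < m \<Longrightarrow> free_factor n s i \<subseteq> A"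
  by (rule factor_subset[OF uoa]) (rule gen_mem)

text \<open>
  For \<open>n i = 1\<close> this is the Moebius transformation \<open>z \<mapsto> (z - a) / (1 - cnj a z)\<close> of the disc,
  with \<open>R\<close> as the resolvent \<open>(1 - cnj a s)\<^sup>-\<^sup>1\<close>.
\<close>

lemma row_contraction_moebius:
  assumes i: "i < m" and j: "j0 < n i" and a: "cmod a < 1" and R: "R \<in> A"
    and RL: "R o\<^sub>L (id_blinfun - scale_op (cnj a) (s i j0)) = id_blinfun"
  shows "row_contraction (n i) (\<lambda>j. if j = j0 then R o\<^sub>L (s i j0 - scale_op a id_blinfun)
      else scale_op (complex_of_real (sqrt (1 - (cmod a)\<^sup>2))) (R o\<^sub>L s i j))" (is "row_contraction _ ?M")
proof -
  have lin: "s i j \<in> clinear_ops" if "j < n i" for j by (rule gen_clinear[OF i that])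
  have R': "R \<in> clinear_ops" by (rule A_clinear[OF R])
  note mem = uoa_id[OF unital_operator_algebra_clinear_ops] uoa_diff[OF unital_operator_algebra_clinear_ops]
    uoa_scale[OF unital_operator_algebra_clinear_ops] uoa_compose[OF unital_operator_algebra_clinear_ops] lin R' j
  have a1: "0 \<le> 1 - (cmod a)\<^sup>2" using a by (simp add: power_le_one_iff)
  have "(\<Sum>j<n i. (norm (adjoint_op (?M j) x))\<^sup>2) \<le> (norm x)\<^sup>2" for x
  proof -
    \<comment> \<open>With these variables \<open>x = y - a p\<close>. The entries other than
      \<open>j0\<close> contribute \<open>1 - |a|^2\<close> times the remaining part of the column
      at \<open>y\<close>, which is at most \<open>(1 - |a|^2)(|y|^2 - |p|^2)\<close>, the very term
      in \<open>norm_moebius_identity\<close>. This explains the square root in the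
      statement.\<close>
    define y where "y = adjoint_op R x"
    define p where "p = adjoint_op (s i j0) y"
    have "adjoint_op (R o\<^sub>L (id_blinfun - scale_op (cnj a) (s i j0))) x = x"
      unfolding RL adjoint_op_id by simp
    then have x: "y - a *\<^sub>C p = x"
      by (simp add: mem adjoint_op_compose adjoint_op_diff adjoint_op_scale adjoint_op_id blinfun.diff_left
          scale_op_apply y_def p_def)
    have M0: "adjoint_op (?M j0) x = p - cnj a *\<^sub>C y"
      by (simp add: mem adjoint_op_compose adjoint_op_diff adjoint_op_scale adjoint_op_id blinfun.diff_left
          scale_op_apply y_def p_def)
    have M: "(norm (adjoint_op (?M j) x))\<^sup>2 = (1 - (cmod a)\<^sup>2) * (norm (adjoint_op (s i j) y))\<^sup>2"
      if "j < n i" "j \<noteq> j0" for j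
      using that a1
      by (simp add: mem adjoint_op_compose adjoint_op_scale scale_op_apply y_def norm_scaleC power_mult_distrib)
    have "(\<Sum>j<n i. (norm (adjoint_op (?M j) x))\<^sup>2) =
        (norm (adjoint_op (?M j0) x))\<^sup>2 + (\<Sum>j\<in>{..<n i} - {j0}. (norm (adjoint_op (?M j) x))\<^sup>2)"
      using j by (intro sum.remove) auto
    also have "(\<Sum>j\<in>{..<n i} - {j0}. (norm (adjoint_op (?M j) x))\<^sup>2) =
        (1 - (cmod a)\<^sup>2) * (\<Sum>j\<in>{..<n i} - {j0}. (norm (adjoint_op (s i j) y))\<^sup>2)"
      unfolding sum_distrib_left by (rule sum.cong) (use M in auto)
    also have "(\<Sum>j\<in>{..<n i} - {j0}. (norm (adjoint_op (s i j) y))\<^sup>2) =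
        (\<Sum>j<n i. (norm (adjoint_op (s i j) y))\<^sup>2) - (norm p)\<^sup>2"
      unfolding p_def using j by (subst sum_diff1) auto
    also have "(1 - (cmod a)\<^sup>2) * ((\<Sum>j<n i. (norm (adjoint_op (s i j) y))\<^sup>2) - (norm p)\<^sup>2)
        \<le> (1 - (cmod a)\<^sup>2) * ((norm y)\<^sup>2 - (norm p)\<^sup>2)"
      using row[OF i] by (intro mult_left_mono[OF _ a1] diff_right_mono) (simp add: row_contraction_iff)
    finally show ?thesis
      unfolding M0 using norm_moebius_identity[of p a y] x by simp
  qed
  moreover have "?M j \<in> clinear_ops" if "j < n i" for j
    using that by (simp add: mem)
  ultimately show ?thesis unfolding row_contraction_iff by blast
qed

text \<open>The tuple for \<open>a\<close> lies in the factors and is a family of row contractions,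
  so universality turns it into an endomorphism; the tuple for \<open>- a\<close> gives the inverse.
  The last clause is what the correction of the base point uses: a character with value
  \<open>a\<close> at the chosen generator is made to vanish there, and zeros at other generators
  survive.\<close>

lemma ex_moebius:
  assumes i: "i < m" and j: "j < n i" and a: "cmod a < 1"
  shows "\<exists>\<mu> \<mu>'. contractive_hom A \<mu> \<and> \<mu> ` A \<subseteq> A \<and> contractive_hom A \<mu>' \<and> \<mu>' ` A \<subseteq> A \<and>
    (\<forall>x\<in>A. \<mu> (\<mu>' x) = x) \<and> (\<forall>x\<in>A. \<mu>' (\<mu> x) = x) \<and>
    (\<forall>p<m. \<mu>' ` free_factor n s p \<subseteq> free_factor n s p) \<and>
    (\<forall>\<kappa>. character A \<kappa> \<longrightarrow> (\<kappa> (s i j) = a \<longrightarrow> \<kappa> (\<mu> (s i j)) = 0) \<and>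
       (\<forall>p<m. \<forall>q<n p. (p, q) \<noteq> (i, j) \<longrightarrow> \<kappa> (s p q) = 0 \<longrightarrow> \<kappa> (\<mu> (s p q)) = 0))"
proof -
  \<comment> \<open>The weight depends on \<open>cmod a\<close> only, so the tuples
    \<open>M a\<close> and \<open>M (- a)\<close> share it, and its square is the factor
    \<open>r\<close> below.\<close>
  define \<sigma> where "\<sigma> = complex_of_real (sqrt (1 - (cmod a)\<^sup>2))"
  let ?g = "s i j"
  let ?F = "free_factor n s i"
  note F = factor_uoa[OF i]
  have "\<exists>R\<in>?F. (id_blinfun - scale_op (cnj b) ?g) o\<^sub>L R = id_blinfun \<and> R o\<^sub>L (id_blinfun - scale_op (cnj b) ?g) = id_blinfun"
    if "cmod b < 1" for b
    by (rule ex_resolvent[OF F factor_gen[OF j]]) (use that norm_gen[OF i j] in simp)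
  then obtain R where R: "\<And>b. cmod b < 1 \<Longrightarrow> R b \<in> ?F"
    "\<And>b. cmod b < 1 \<Longrightarrow> (id_blinfun - scale_op (cnj b) ?g) o\<^sub>L R b = id_blinfun"
    "\<And>b. cmod b < 1 \<Longrightarrow> R b o\<^sub>L (id_blinfun - scale_op (cnj b) ?g) = id_blinfun" by metis
  have RA: "R b \<in> A" if "cmod b < 1" for b using R(1)[OF that] factor_subset_A[OF i] by blast
  define M where "M b p q = (if p = i then
      (if q = j then R b o\<^sub>L (?g - scale_op b id_blinfun) else scale_op \<sigma> (R b o\<^sub>L s i q)) else s p q)" for b p q
  have M_F: "M b p q \<in> free_factor n s p" if "cmod b < 1" "p < m" "q < n p" for b p q
    using that R(1)[OF that(1)] factor_gen[of q p] factor_gen[OF j] factor_uoa[OF that(2)]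
    by (auto simp: M_def intro!: uoa_compose uoa_diff uoa_scale uoa_id)
  have M_A: "M b p q \<in> A" if "cmod b < 1" "p < m" "q < n p" for b p q
    using M_F[OF that] factor_subset_A[OF that(2)] by blast
  have M_row: "row_contraction (n p) (M b p)" if b: "cmod b = cmod a" and p: "p < m" for b p
  proof (cases "p = i")
    case True
    have "cmod b < 1" using a b by simp
    from row_contraction_moebius[OF i j this RA[OF this] R(3)[OF this]]
    show ?thesis unfolding True M_def \<sigma>_def b[symmetric] by simp
  next
    case False
    then have "M b p = s p" by (simp add: M_def fun_eq_iff)
    then show ?thesis using row[OF p] by simp
  qed
  have ex: "\<exists>\<pi>. contractive_hom A \<pi> \<and> \<pi> ` A \<subseteq> A \<and> (\<forall>p<m. \<forall>q<n p. \<pi> (s p q) = M b p q)"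
    if b: "cmod b = cmod a" for b
    by (rule ex_endo[OF M_row[OF b] M_A]) (use a b in auto)
  have inverse: "\<pi> (M b p q) = s p q"
    if \<pi>: "contractive_hom A \<pi>" "\<forall>p<m. \<forall>q<n p. \<pi> (s p q) = M (- b) p q" and b: "cmod b = cmod a"
      and p: "p < m" "q < n p" for \<pi> b p q
  proof (cases "p = i")
    case False
    then show ?thesis using \<pi>(2) p by (simp add: M_def)
  next
    case True
    have b1: "cmod b < 1" "cmod (- b) < 1" using a b by auto
    note simps = hom_compose[OF uoa \<pi>(1)] hom_diff[OF uoa \<pi>(1)] hom_scale[OF uoa \<pi>(1)] hom_id[OF uoa \<pi>(1)]
    define r where "r = 1 - b * cnj b"
    have r: "r = complex_of_real (1 - (cmod b)\<^sup>2)" by (simp only: r_def of_real_diff of_real_1 complex_norm_square)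
    have r\<sigma>: "\<sigma> * \<sigma> = r"
    proof -
      have "sqrt (1 - (cmod a)\<^sup>2) * sqrt (1 - (cmod a)\<^sup>2) = 1 - (cmod a)\<^sup>2"
        using a by (simp add: power_le_one_iff)
      then show ?thesis unfolding r \<sigma>_def b of_real_mult[symmetric] by simp
    qed
    have "(cmod b)\<^sup>2 < 1" using b1(1) by (simp add: abs_square_less_1)
    then have r0: "r \<noteq> 0" unfolding r of_real_eq_0_iff by simp
    let ?R = "R (- b)" and ?L = "id_blinfun + scale_op (cnj b) ?g"
    have L: "?L o\<^sub>L ?R = id_blinfun" "?R o\<^sub>L ?L = id_blinfun"
      using R(2,3)[OF b1(2)] by (simp_all add: scale_op_minus_left)
    have Rg: "?R + scale_op (cnj b) (?R o\<^sub>L ?g) = id_blinfun"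
      using L(2) RA[OF b1(2)] by (simp add: compose_algebra scale_op_compose_right A_clinear)
    have M': "M (- b) i j = (?R o\<^sub>L ?g) + scale_op b ?R"
      using RA[OF b1(2)]
      by (simp add: M_def compose_algebra scale_op_compose_right A_clinear scale_op_minus_left)
    \<comment> \<open>These two identities are the cancellation behind inverting a Moebius map, with
      \<open>r = 1 - |b|^2\<close>. Applying \<open>\<pi>\<close> to the resolvent equation, the
      first gives \<open>r \<pi>(R b) = ?L\<close>, the inverse of \<open>?R\<close>; the second
      then returns the generator \<open>?g\<close>.\<close>
    have 1: "id_blinfun - scale_op (cnj b) (M (- b) i j) = scale_op r ?R"
      unfolding M' r_def Rg[symmetric]
      by (simp add: scale_op_add_right scale_op_diff_left mult.commute)
    have 2: "M (- b) i j - scale_op b id_blinfun = scale_op r (?R o\<^sub>L ?g)"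
      unfolding M' r_def Rg[symmetric]
      by (simp add: scale_op_add_right scale_op_diff_left)
    have "(id_blinfun - scale_op (cnj b) (M (- b) i j)) o\<^sub>L \<pi> (R b) = \<pi> ((id_blinfun - scale_op (cnj b) ?g) o\<^sub>L R b)"
      using \<pi>(2) i j b1 by (simp add: simps A_mem gen_mem RA)
    then have "scale_op r (?R o\<^sub>L \<pi> (R b)) = id_blinfun"
      unfolding 1 R(2)[OF b1(1)] by (simp add: simps)
    then have "?L o\<^sub>L scale_op r (?R o\<^sub>L \<pi> (R b)) = ?L" by simp
    moreover have "?L o\<^sub>L scale_op r (?R o\<^sub>L \<pi> (R b)) = scale_op r ((?L o\<^sub>L ?R) o\<^sub>L \<pi> (R b))"
    proof -
      have "?L \<in> clinear_ops" by (intro A_clinear A_mem gen_mem i j)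
      then have "?L o\<^sub>L scale_op r (?R o\<^sub>L \<pi> (R b)) = scale_op r (?L o\<^sub>L (?R o\<^sub>L \<pi> (R b)))"
        by (rule scale_op_compose_right)
      also have "?L o\<^sub>L (?R o\<^sub>L \<pi> (R b)) = (?L o\<^sub>L ?R) o\<^sub>L \<pi> (R b)" by (rule blinfun_eqI) simp
      finally show ?thesis .
    qed
    ultimately have \<pi>R: "scale_op r (\<pi> (R b)) = ?L" unfolding L(1) by simp
    have \<pi>R_lin: "\<pi> (R b) \<in> clinear_ops" by (rule hom_clinear[OF uoa \<pi>(1) RA[OF b1(1)]])
    have cancel: "scale_op r (\<pi> (R b)) o\<^sub>L (?R o\<^sub>L x) = x" for x
    proof -
      have "?L o\<^sub>L (?R o\<^sub>L x) = (?L o\<^sub>L ?R) o\<^sub>L x" by (rule blinfun_eqI) simp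
      then show ?thesis unfolding \<pi>R L(1) by simp
    qed
    show ?thesis
    proof (cases "q = j")
      case True
      have "\<pi> (M b i j) = \<pi> (R b) o\<^sub>L (M (- b) i j - scale_op b id_blinfun)"
        using \<pi>(2) i j b1 by (simp add: M_def[of b] simps A_mem gen_mem RA)
      also have "\<dots> = scale_op r (\<pi> (R b)) o\<^sub>L (?R o\<^sub>L ?g)"
        unfolding 2 by (simp add: scale_op_compose_right[OF \<pi>R_lin])
      finally show ?thesis using cancel[of ?g] True \<open>p = i\<close> by simp
    next
      case False
      have "\<pi> (M b i q) = scale_op \<sigma> (\<pi> (R b) o\<^sub>L M (- b) i q)"
        using \<pi>(2) i j b1 p \<open>p = i\<close> False by (simp add: M_def[of b] simps A_mem gen_mem RA)
      also have "M (- b) i q = scale_op \<sigma> (?R o\<^sub>L s i q)" using False by (simp add: M_def)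
      also have "scale_op \<sigma> (\<pi> (R b) o\<^sub>L scale_op \<sigma> (?R o\<^sub>L s i q)) = scale_op r (\<pi> (R b)) o\<^sub>L (?R o\<^sub>L s i q)"
        by (simp add: scale_op_compose_right[OF \<pi>R_lin] r\<sigma>)
      finally show ?thesis using cancel[of "s i q"] \<open>p = i\<close> by simp
    qed
  qed
  obtain \<mu> where \<mu>: "contractive_hom A \<mu>" "\<mu> ` A \<subseteq> A" "\<forall>p<m. \<forall>q<n p. \<mu> (s p q) = M a p q"
    using ex[of a] by blast
  obtain \<mu>' where \<mu>': "contractive_hom A \<mu>'" "\<mu>' ` A \<subseteq> A" "\<forall>p<m. \<forall>q<n p. \<mu>' (s p q) = M (- a) p q"
    using ex[of "- a"] by auto
  have id: "contractive_hom A (\<lambda>x. x)"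
    using A_clinear by (auto simp: contractive_hom_def unital_hom_def)
  have inv1: "\<mu> (\<mu>' x) = x" if "x \<in> A" for x
    by (rule hom_eqI[OF contractive_hom_comp[OF \<mu>'(1,2) \<mu>(1)] id _ that])
      (use \<mu>'(3) inverse[OF \<mu>(1), of "- a"] \<mu>(3) in simp)
  have inv2: "\<mu>' (\<mu> x) = x" if "x \<in> A" for x
    by (rule hom_eqI[OF contractive_hom_comp[OF \<mu>(1,2) \<mu>'(1)] id _ that])
      (use \<mu>(3) inverse[OF \<mu>'(1), of a] \<mu>'(3) in simp)
  have factor: "\<mu>' ` free_factor n s p \<subseteq> free_factor n s p" if p: "p < m" for p
  proof -
    have "free_factor n s p \<subseteq> {x \<in> A. \<mu>' x \<in> free_factor n s p}"
      by (rule factor_subset[OF hom_preimage_uoa[OF uoa \<mu>'(1) factor_uoa[OF p]]])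
        (use \<mu>'(3) M_F[of "- a"] a p gen_mem in auto)
    then show ?thesis by blast
  qed
  have chars: "(\<kappa> (s i j) = a \<longrightarrow> \<kappa> (\<mu> (s i j)) = 0) \<and>
       (\<forall>p<m. \<forall>q<n p. (p, q) \<noteq> (i, j) \<longrightarrow> \<kappa> (s p q) = 0 \<longrightarrow> \<kappa> (\<mu> (s p q)) = 0)"
    if \<kappa>: "character A \<kappa>" for \<kappa>
    using \<mu>(3) i j RA[OF a]
    by (auto simp: M_def char_compose[OF uoa \<kappa>] char_diff[OF uoa \<kappa>] char_scale[OF uoa \<kappa>] char_id[OF uoa \<kappa>]
        A_mem gen_mem)
  show ?thesis
    by (rule exI[of _ \<mu>], rule exI[of _ \<mu>'], intro conjI \<mu>(1,2) \<mu>'(1,2) ballI inv1 inv2)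
      (use factor chars in blast)+
qed

section \<open>The maximum modulus principle\<close>

lemma gauge_1: "x \<in> A \<Longrightarrow> gauge 1 x = x"
proof -
  have id: "contractive_hom A (\<lambda>x. x)"
    using A_clinear by (auto simp: contractive_hom_def unital_hom_def)
  show "x \<in> A \<Longrightarrow> gauge 1 x = x"
    by (rule hom_eqI[OF gauge(1) id]) (auto simp: gauge(3))
qed

text \<open>The function \<open>f z = \<kappa> (gauge z X)\<close> is a uniform limit of polynomials
  on the closed disc, is bounded there by 1, and joins \<open>f 0 = eps X\<close> to
  \<open>f 1 = \<kappa> X = 0\<close>. If the bound were attained at the centre, \<open>f\<close>
  would be constant.\<close>

lemma cmod_eps_less_1:
  assumes X: "X \<in> A" "norm X \<le> 1" and \<kappa>: "character A \<kappa>" "\<kappa> X = 0"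
  shows "cmod (eps X) < 1"
proof (rule ccontr)
  assume "\<not> cmod (eps X) < 1"
  then have ge: "1 \<le> cmod (eps X)" by simp
  define f where "f z = \<kappa> (gauge z X)" for z
  have "\<exists>N P. (\<forall>e. P e \<in> homog e) \<and> norm ((\<Sum>e<N. P e) - X) < inverse (real (Suc k))" for k
    using tail_approx[of X 0 "inverse (real (Suc k))"] X closure_tail_0 by (metis inverse_positive_iff_positive of_nat_0_less_iff zero_less_Suc)
  then obtain N P where P: "\<And>k e. P k e \<in> homog e"
    "\<And>k. norm ((\<Sum>e<N k. P k e) - X) < inverse (real (Suc k))" by metis
  define q where "q k = (\<Sum>e<N k. P k e)" for k
  define g where "g k z = (\<Sum>e<N k. z ^ e * \<kappa> (P k e))" for k and z :: complex
  have qA: "q k \<in> A" for k unfolding q_def by (intro A_mem homog_mem[OF P(1)])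
  have g: "g k z = \<kappa> (gauge z (q k))" if "cmod z \<le> 1" for k z
    unfolding g_def q_def gauge_graded[OF P(1) that]
    by (subst char_sum[OF uoa \<kappa>(1)]) (auto simp: char_scale[OF uoa \<kappa>(1)] A_mem homog_mem[OF P(1)])
  have diff: "cmod (g k z - f z) < inverse (real (Suc k))" if z: "cmod z \<le> 1" for k z
  proof -
    have "cmod (g k z - f z) \<le> norm (gauge z (q k) - gauge z X)"
      unfolding g[OF z] f_def by (intro char_norm_diff[OF uoa \<kappa>(1)] gauge(2)[OF z] qA X)
    also have "\<dots> \<le> norm (q k - X)" by (rule hom_norm_diff[OF uoa gauge(1)[OF z] qA X(1)])
    finally show ?thesis using P(2)[of k] by (simp add: q_def)
  qed
  have "uniform_limit (cball 0 1) g f sequentially"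
  proof (rule uniform_limitI)
    fix \<epsilon> :: real assume "0 < \<epsilon>"
    then obtain K :: nat where K: "inverse (real (Suc K)) < \<epsilon>" using reals_Archimedean by blast
    have "\<forall>z\<in>cball 0 1. dist (g k z) (f z) < \<epsilon>" if "k \<ge> K" for k
    proof
      fix z :: complex assume "z \<in> cball 0 1"
      then have "dist (g k z) (f z) < inverse (real (Suc k))" using diff by (simp add: dist_norm)
      also have "\<dots> \<le> inverse (real (Suc K))" using that by (intro le_imp_inverse_le) auto
      finally show "dist (g k z) (f z) < \<epsilon>" using K by simp
    qed
    then show "\<forall>\<^sub>F k in sequentially. \<forall>z\<in>cball 0 1. dist (g k z) (f z) < \<epsilon>"
      unfolding eventually_sequentially by blast
  qed
  moreover have "\<forall>\<^sub>F k in sequentially. continuous_on (cball 0 1) (g k) \<and> g k holomorphic_on ball 0 1"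
    unfolding g_def by (intro always_eventually allI conjI continuous_intros holomorphic_intros)
  ultimately have cont: "continuous_on (cball 0 1) f" and hol: "f holomorphic_on ball 0 1"
    using holomorphic_uniform_limit[of 0 1 g sequentially f] by auto
  \<comment> \<open>\<open>gauge 0\<close> sends every generator to 0, so its composite with any
    character agrees with \<open>eps\<close> on generators.\<close>
  have f0: "f 0 = eps X"
    unfolding f_def
    by (rule character_eqI[OF character_comp[OF gauge(1) _ \<kappa>(1)] eps _ X(1)])
      (auto simp: gauge(2,3) eps_gen char_zero[OF uoa \<kappa>(1)])
  have "f constant_on ball 0 1"
  proof (rule maximum_modulus_principle[OF hol, of "ball 0 1" 0])
    fix z :: complex assume "z \<in> ball 0 1"
    then have z: "cmod z \<le> 1" by simp
    have "cmod (f z) \<le> norm (gauge z X)"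
      unfolding f_def by (rule char_norm[OF uoa \<kappa>(1) gauge(2)[OF z X(1)]])
    also have "\<dots> \<le> norm X" by (rule hom_norm[OF uoa gauge(1)[OF z] X(1)])
    finally show "cmod (f z) \<le> cmod (f 0)" using X(2) ge f0 by simp
  qed auto
  then obtain c where c: "\<And>z. z \<in> ball 0 1 \<Longrightarrow> f z = c" unfolding constant_on_def by blast
  then have "c = eps X" using f0 by force
  have "f 1 = c"
    by (rule continuous_constant_on_closure[of "ball 0 1"]) (use cont c in auto)
  then show False
    using \<open>c = eps X\<close> \<kappa>(2) ge by (simp add: f_def gauge_1[OF X(1)])
qed

end

section \<open>Powers of the augmentation ideal and Cartan's uniqueness theorem\<close>

context free_rows
begin

definition aug :: "'h op set" where
  "aug = {a \<in> A. eps a = 0}"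

lemma aug_mem: "a \<in> aug \<Longrightarrow> a \<in> A"
  by (simp add: aug_def)

lemma aug_closed: "closed aug"
  unfolding closed_sequential_limits
proof (intro allI impI)
  fix x a assume x: "(\<forall>k. x k \<in> aug) \<and> x \<longlonglongrightarrow> a"
  then have xA: "x k \<in> A" for k by (simp add: aug_def)
  then have a: "a \<in> A" using closed_sequentially[OF A_closed] x by blast
  have "(\<lambda>k. eps (x k)) \<longlonglongrightarrow> eps a" using x xA a by (intro char_tendsto[OF uoa eps]) auto
  moreover have "(\<lambda>k. eps (x k)) = (\<lambda>k. 0)" using x by (simp add: aug_def)
  ultimately show "a \<in> aug" using a by (simp add: aug_def LIMSEQ_const_iff)
qed

lemma aug_subspace: "subspace aug"
  by (simp add: subspace_def aug_def A_mem char_zero[OF uoa eps] char_add[OF uoa eps]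
      char_scale[OF uoa eps] scaleR_eq_scale_op)

lemma aug_ideal: "a \<in> aug \<Longrightarrow> b \<in> A \<Longrightarrow> a o\<^sub>L b \<in> aug"
  by (simp add: aug_def A_mem char_compose[OF uoa eps])

lemma aug_scale: "a \<in> aug \<Longrightarrow> scale_op c a \<in> aug"
  by (simp add: aug_def A_mem char_scale[OF uoa eps])

lemma aug_part: "a \<in> A \<Longrightarrow> a - scale_op (eps a) id_blinfun \<in> aug"
  by (simp add: aug_def A_mem char_diff[OF uoa eps] char_scale[OF uoa eps] char_id[OF uoa eps])

text \<open>The closed powers of the augmentation ideal, shifted by one: \<open>ipow d\<close> is
  the power with exponent \<open>d + 1\<close>. Only \<open>eps\<close>, products, spans and
  closures enter, so \<open>eps\<close>-preserving contractive homomorphisms respect it.\<close>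

primrec ipow :: "nat \<Rightarrow> 'h op set" where
  "ipow 0 = aug"
| "ipow (Suc d) = closure (span {x o\<^sub>L y | x y. x \<in> aug \<and> y \<in> ipow d})"

lemma ipow_closed: "closed (ipow d)"
  by (cases d) (auto simp: aug_closed)

lemma ipow_subspace: "subspace (ipow d)"
  by (cases d) (auto simp: aug_subspace intro: subspace_closure)

text \<open>Serves as the induction principle for the ideal powers: a property that is closed and
  linear need only be checked on products.\<close>

lemma ipow_minimal:
  assumes "closed V" "subspace V" "\<And>x y. x \<in> aug \<Longrightarrow> y \<in> ipow d \<Longrightarrow> x o\<^sub>L y \<in> V"
  shows "ipow (Suc d) \<subseteq> V"
  unfolding ipow.simps by (intro closure_minimal span_minimal assms(1,2)) (use assms(3) in auto)

lemma ipow_mult_aug: "x \<in> aug \<Longrightarrow> y \<in> ipow d \<Longrightarrow> x o\<^sub>L y \<in> ipow (Suc d)"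
  unfolding ipow.simps by (rule subsetD[OF closure_subset], rule span_base) blast

lemma ipow_antimono: "ipow (Suc d) \<subseteq> ipow d"
proof (induction d)
  case 0
  then show ?case by (intro ipow_minimal) (auto simp: aug_closed aug_subspace intro: aug_ideal aug_mem)
next
  case (Suc d)
  then show ?case by (intro ipow_minimal ipow_closed ipow_subspace ipow_mult_aug) auto
qed

lemma ipow_subset_aug: "ipow d \<subseteq> aug"
  by (induction d) (use ipow_antimono in \<open>auto simp del: ipow.simps(2)\<close>)

lemma ipow_subset_A: "x \<in> ipow d \<Longrightarrow> x \<in> A"
  using ipow_subset_aug aug_mem by blast

lemma ipow_mono: "d \<le> e \<Longrightarrow> ipow e \<subseteq> ipow d"
  by (induction rule: dec_induct) (use ipow_antimono in \<open>auto simp del: ipow.simps\<close>)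

lemma ipow_scale: "x \<in> ipow d \<Longrightarrow> scale_op c x \<in> ipow d"
proof (cases d)
  case 0
  then show "x \<in> ipow d \<Longrightarrow> scale_op c x \<in> ipow d" by (simp add: aug_scale)
next
  case (Suc e)
  have "ipow (Suc e) \<subseteq> {x. scale_op c x \<in> ipow (Suc e)}"
  proof (rule ipow_minimal)
    show "closed {x. scale_op c x \<in> ipow (Suc e)}"
      using continuous_closed_vimage[OF ipow_closed linear_continuous_at[OF bounded_linear_scale_op]]
      by (simp add: vimage_def del: ipow.simps)
    show "subspace {x. scale_op c x \<in> ipow (Suc e)}"
      by (rule linear_subspace_vimage[OF bounded_linear.linear[OF bounded_linear_scale_op] ipow_subspace,
          unfolded vimage_def])
    show "x o\<^sub>L y \<in> {x. scale_op c x \<in> ipow (Suc e)}" if "x \<in> aug" "y \<in> ipow e" for x y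
      using ipow_mult_aug[OF aug_scale[OF that(1)] that(2), of c] by simp
  qed
  then show "x \<in> ipow d \<Longrightarrow> scale_op c x \<in> ipow d" using Suc by blast
qed

text \<open>The shift in the indexing accounts for \<open>Suc\<close>: exponents
  \<open>d + 1\<close> and \<open>e + 1\<close> add up to \<open>(d + e + 1) + 1\<close>.\<close>

lemma ipow_mult: "x \<in> ipow d \<Longrightarrow> y \<in> ipow e \<Longrightarrow> x o\<^sub>L y \<in> ipow (Suc (d + e))"
proof (induction d arbitrary: x)
  case 0
  then show ?case using ipow_mult_aug by simp
next
  case (Suc d)
  let ?V = "{x. x o\<^sub>L y \<in> ipow (Suc (Suc d + e))}"
  have lin: "bounded_linear (\<lambda>x. x o\<^sub>L y)"
    by (rule bounded_bilinear.bounded_linear_left[OF bounded_bilinear_blinfun_compose])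
  have "ipow (Suc d) \<subseteq> ?V"
  proof (rule ipow_minimal)
    show "closed ?V"
      using continuous_closed_vimage[OF ipow_closed linear_continuous_at[OF lin]]
      by (simp add: vimage_def del: ipow.simps)
    show "subspace ?V"
      by (rule linear_subspace_vimage[OF bounded_linear.linear[OF lin] ipow_subspace, unfolded vimage_def])
    show "x o\<^sub>L z \<in> ?V" if "x \<in> aug" "z \<in> ipow d" for x z
    proof -
      have "(x o\<^sub>L z) o\<^sub>L y = x o\<^sub>L (z o\<^sub>L y)" by (rule blinfun_eqI) simp
      then show ?thesis
        using ipow_mult_aug[OF that(1) Suc.IH[OF that(2) Suc.prems(2)]] by simp
    qed
  qed
  then show ?case using Suc.prems(1) by blast
qed

lemma eps_homog: "h \<in> homog (Suc d) \<Longrightarrow> eps h = 0"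
proof -
  have "homog (Suc d) \<subseteq> aug"
    unfolding homog.simps
  proof (rule span_minimal[OF _ aug_subspace], safe)
    fix i j h assume "i < m" "j < n i" "h \<in> homog d"
    then show "s i j o\<^sub>L h \<in> aug" by (intro aug_ideal homog_mem) (auto simp: aug_def gen_mem eps_gen)
  qed
  then show "h \<in> homog (Suc d) \<Longrightarrow> eps h = 0" by (auto simp: aug_def)
qed

text \<open>Approximants of an element of \<open>aug\<close> may have small constant terms; these
  converge to 0 by continuity of \<open>eps\<close> and can be subtracted.\<close>

lemma aug_subset_closure_tail: "aug \<subseteq> closure (tail 1)"
proof
  fix a assume a: "a \<in> aug"
  then have aA: "a \<in> A" by (rule aug_mem)
  then have "a \<in> closure (tail 0)" by (simp add: closure_tail_0)
  then obtain x where x: "\<And>k. x k \<in> tail 0" "x \<longlonglongrightarrow> a"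
    unfolding closure_sequential by blast
  have "tail 0 \<subseteq> {q \<in> A. q - scale_op (eps q) id_blinfun \<in> tail 1}" (is "_ \<subseteq> ?V")
    unfolding tail_def[of 0]
  proof (rule span_minimal)
    show "subspace ?V"
    proof -
      have 1: "q + r - scale_op (eps q + eps r) id_blinfun =
          (q - scale_op (eps q) id_blinfun) + (r - scale_op (eps r) id_blinfun)" for q r
        by (simp add: scale_op_add_left)
      have 2: "scale_op c q - scale_op (c * eps q) id_blinfun =
          scale_op c (q - scale_op (eps q) id_blinfun)" for c q
        by (simp add: scale_op_diff_right)
      have 3: "scale_op (complex_of_real c) x \<in> tail 1" if "x \<in> tail 1" for c x
        using subspace_scale[OF tail_subspace that, of c] by (simp add: scaleR_eq_scale_op)
      show ?thesis
        by (simp add: 1 2 3[unfolded One_nat_def] subspace_def A_mem char_zero[OF uoa eps] char_add[OF uoa eps] char_scale[OF uoa eps]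
            scaleR_eq_scale_op subspace_0[OF tail_subspace] subspace_add[OF tail_subspace])
    qed
    show "(\<Union>e\<in>{0..}. homog e) \<subseteq> ?V"
    proof safe
      fix e h assume h: "h \<in> homog e"
      show "h \<in> A" by (rule homog_mem[OF h])
      show "h - scale_op (eps h) id_blinfun \<in> tail 1"
      proof (cases e)
        case 0
        then show ?thesis
          using h subspace_0[OF tail_subspace] by (auto simp: char_scale[OF uoa eps] char_id[OF uoa eps] A_mem)
      next
        case (Suc d)
        then show ?thesis using h eps_homog[of h d] homog_subset_tail[of 1 e h] by simp
      qed
    qed
  qed
  then have xA: "x k \<in> A" and "x k - scale_op (eps (x k)) id_blinfun \<in> tail 1" for k using x(1) by blast+
  moreover have "(\<lambda>k. x k - scale_op (eps (x k)) id_blinfun) \<longlonglongrightarrow> a - scale_op (eps a) id_blinfun"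
    by (intro tendsto_diff x(2) bounded_linear.tendsto[OF bounded_linear_scale_op_left]
        char_tendsto[OF uoa eps xA aA])
  moreover have "a - scale_op (eps a) id_blinfun = a" using a by (simp add: aug_def)
  ultimately show "a \<in> closure (tail 1)"
    unfolding closure_sequential by (intro exI[of _ "\<lambda>k. x k - scale_op (eps (x k)) id_blinfun"]) auto
qed

text \<open>A product of \<open>d + 1\<close> elements without constant term has no terms of degree
  below \<open>d + 1\<close>. This transfers separation from the grading, where it rests on norm
  estimates, to the ideal powers.\<close>

lemma ipow_subset_closure_tail: "ipow d \<subseteq> closure (tail (Suc d))"
proof (induction d)
  case 0
  then show ?case using aug_subset_closure_tail by simp
next
  case (Suc d)
  show ?case
  proof (rule ipow_minimal[OF closed_closure subspace_closure[OF tail_subspace]])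
    fix x y assume "x \<in> aug" "y \<in> ipow d"
    then have "x \<in> closure (tail 1)" "y \<in> closure (tail (Suc d))"
      using aug_subset_closure_tail Suc by blast+
    then show "x o\<^sub>L y \<in> closure (tail (Suc (Suc d)))"
      by (rule compose_closure[rotated]) (use tail_mult[of _ 1 _ "Suc d"] in simp)
  qed
qed

lemma ipow_separated:
  assumes "\<And>d. a \<in> ipow d" shows "a = 0"
proof (rule closure_tail_separated)
  fix d
  have "tail (Suc d) \<subseteq> tail d" unfolding tail_def by (intro span_mono UN_mono) auto
  then show "a \<in> closure (tail d)"
    using assms[of d] ipow_subset_closure_tail[of d] closure_mono by blast
qed

lemma homog_subset_ipow: "homog (Suc d) \<subseteq> ipow d"
proof (induction d)
  case 0
  then show ?case using eps_homog homog_mem by (auto simp: aug_def simp del: homog.simps)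
next
  case (Suc d)
  have "span {s i j o\<^sub>L h | i j h. i < m \<and> j < n i \<and> h \<in> homog (Suc d)} \<subseteq> ipow (Suc d)"
  proof (rule span_minimal[OF _ ipow_subspace], safe)
    fix i j h assume "i < m" "j < n i" "h \<in> homog (Suc d)"
    then show "s i j o\<^sub>L h \<in> ipow (Suc d)"
      using Suc by (intro ipow_mult_aug) (auto simp: aug_def gen_mem eps_gen simp del: homog.simps)
  qed
  then show ?case unfolding homog.simps(2)[of "Suc d"] .
qed

text \<open>To first order at the base point the gauge map is multiplication by \<open>z\<close>:
  degree one is scaled exactly, and the degrees from 2 on lie in \<open>ipow 1\<close>.\<close>

lemma gauge_mod_ipow_1:
  assumes z: "cmod z \<le> 1" and a: "a \<in> aug"
  shows "gauge z a - scale_op z a \<in> ipow 1"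
proof -
  let ?D = "\<lambda>a. gauge z a - scale_op z a"
  have "tail 1 \<subseteq> {a \<in> A. ?D a \<in> ipow 1}" (is "_ \<subseteq> ?V")
    unfolding tail_def
  proof (rule span_minimal)
    show "subspace ?V"
    proof -
      have 1: "scale_op c (gauge z x) - scale_op (z * c) x = scale_op c (?D x)" for c x
        by (simp add: scale_op_diff_right mult.commute)
      have 2: "gauge z x + gauge z y - (scale_op z x + scale_op z y) = ?D x + ?D y" for x y by simp
      show ?thesis
        by (simp add: 1 2 subspace_def A_mem gauge_simps z subspace_0[OF ipow_subspace] scaleR_eq_scale_op
          subspace_add[OF ipow_subspace] ipow_scale scale_op_add_right del: ipow.simps)
    qed
    show "(\<Union>e\<in>{1..}. homog e) \<subseteq> ?V"
    proof safe
      fix e h assume e: "1 \<le> e" and h: "h \<in> homog e"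
      show "h \<in> A" by (rule homog_mem[OF h])
      have D: "?D h = scale_op (z ^ e - z) h"
        by (simp add: gauge_homog[OF z h] scale_op_diff_left)
      show "?D h \<in> ipow 1"
      proof (cases "e = 1")
        case True
        then show ?thesis unfolding D using subspace_0[OF ipow_subspace, of 1] by simp
      next
        case False
        then obtain d where "e = Suc (Suc d)" using e by (metis One_nat_def Suc_le_D le_antisym not_less_eq_eq)
        then have "h \<in> ipow (Suc d)" using h homog_subset_ipow by blast
        then have "h \<in> ipow 1" using ipow_mono[of 1 "Suc d"] by auto
        then show ?thesis unfolding D by (rule ipow_scale)
      qed
    qed
  qed
  moreover have "a \<in> closure (tail 1)" using a aug_subset_closure_tail by blast
  then obtain x where x: "\<And>k. x k \<in> tail 1" "x \<longlonglongrightarrow> a"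
    unfolding closure_sequential by blast
  ultimately have xA: "x k \<in> A" and xD: "?D (x k) \<in> ipow 1" for k by blast+
  show ?thesis
  proof (rule closed_sequentially[OF ipow_closed])
    show "?D (x k) \<in> ipow 1" for k by (rule xD)
    show "(\<lambda>k. ?D (x k)) \<longlonglongrightarrow> ?D a"
      by (intro tendsto_diff hom_tendsto[OF uoa gauge(1)[OF z] xA aug_mem[OF a]]
          bounded_linear.tendsto[OF bounded_linear_scale_op] x(2))
  qed
qed

end

text \<open>Preserving the base character suffices for preserving \<open>aug\<close>, and
  multiplicativity, linearity and continuity carry this to all its closed powers. The grading itself
  need not be preserved.\<close>

lemma hom_ipow:
  assumes A: "free_rows m1 n s A" and B: "free_rows m2 k t B"
    and \<theta>: "contractive_hom A \<theta>" "\<theta> ` A \<subseteq> B"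
    and eps: "\<And>a. a \<in> A \<Longrightarrow> free_rows.eps m2 k t B (\<theta> a) = free_rows.eps m1 n s A a"
  shows "a \<in> free_rows.ipow m1 n s A d \<Longrightarrow> \<theta> a \<in> free_rows.ipow m2 k t B d"
proof (induction d arbitrary: a)
  interpret A: free_rows m1 n s A by (rule A)
  interpret B: free_rows m2 k t B by (rule B)
  case 0
  then show ?case using \<theta>(2) eps by (auto simp: A.aug_def B.aug_def)
next
  interpret A: free_rows m1 n s A by (rule A)
  interpret B: free_rows m2 k t B by (rule B)
  case (Suc d)
  have aug: "\<theta> a \<in> B.aug" if "a \<in> A.aug" for a
    using that \<theta>(2) eps by (auto simp: A.aug_def B.aug_def)
  have "A.ipow (Suc d) \<subseteq> {a \<in> A. \<theta> a \<in> B.ipow (Suc d)}"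
  proof (rule A.ipow_minimal)
    show "closed {a \<in> A. \<theta> a \<in> B.ipow (Suc d)}"
      by (rule hom_closed_preimage[OF A.uoa \<theta>(1) B.ipow_closed])
    show "subspace {a \<in> A. \<theta> a \<in> B.ipow (Suc d)}"
      by (rule hom_preimage_subspace[OF A.uoa \<theta>(1) B.ipow_subspace])
    fix x y assume xy: "x \<in> A.aug" "y \<in> A.ipow d"
    then have "x \<in> A" "y \<in> A" by (auto intro: A.aug_mem A.ipow_subset_A)
    moreover have "\<theta> x o\<^sub>L \<theta> y \<in> B.ipow (Suc d)"
      by (rule B.ipow_mult_aug[OF aug[OF xy(1)] Suc.IH[OF xy(2)]])
    ultimately show "x o\<^sub>L y \<in> {a \<in> A. \<theta> a \<in> B.ipow (Suc d)}"
      by (simp add: A.A_mem hom_compose[OF A.uoa \<theta>(1)] del: B.ipow.simps)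
  qed
  then show ?case using Suc.prems by blast
qed

text \<open>
  If \<open>\<kappa> a = a + q\<close> modulo \<open>ipow (Suc d)\<close> with \<open>q \<in> ipow d\<close>, then \<open>\<kappa>\<^sup>N a = a + N q\<close> modulo
  \<open>ipow (Suc d)\<close>; the iterates are contractive, so \<open>q\<close> vanishes modulo \<open>ipow (Suc d)\<close>.
\<close>

lemma (in free_rows) cartan_uniqueness:
  assumes \<kappa>: "contractive_hom A \<kappa>" "\<kappa> ` A \<subseteq> A"
    and eps\<kappa>: "\<And>a. a \<in> A \<Longrightarrow> eps (\<kappa> a) = eps a"
    and tangent: "\<And>a. a \<in> aug \<Longrightarrow> \<kappa> a - a \<in> ipow 1"
    and a: "a \<in> A"
  shows "\<kappa> a = a"
proof -
  note hom = hom_add[OF uoa \<kappa>(1)] hom_compose[OF uoa \<kappa>(1)] hom_scale[OF uoa \<kappa>(1)] hom_diff[OF uoa \<kappa>(1)]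
    hom_id[OF uoa \<kappa>(1)] hom_zero[OF uoa \<kappa>(1)] hom_scaleR[OF uoa \<kappa>(1)]
  have \<kappa>A: "\<kappa> a \<in> A" if "a \<in> A" for a using \<kappa>(2) that by blast
  have \<kappa>_ipow: "\<kappa> a \<in> ipow d" if "a \<in> ipow d" for a d
    by (rule hom_ipow[OF free_rows_axioms free_rows_axioms \<kappa> eps\<kappa> that])
  \<comment> \<open>From \<open>\<kappa> (x y) - x y = (\<kappa> x - x) \<kappa> y + x (\<kappa> y -
    y)\<close>, by induction on \<open>e\<close>: if \<kappa> moves elements of \<open>aug\<close>
    by \<open>ipow d\<close>, it moves elements of \<open>ipow e\<close> by
    \<open>ipow (d + e)\<close>.\<close>
  have shift: "\<kappa> a - a \<in> ipow (d + e)" if d: "\<And>a. a \<in> aug \<Longrightarrow> \<kappa> a - a \<in> ipow d" and "a \<in> ipow e" for d e a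
    using that(2)
  proof (induction e arbitrary: a)
    case 0
    then show ?case using d by simp
  next
    case (Suc e)
    let ?V = "{a \<in> A. \<kappa> a - a \<in> ipow (d + Suc e)}"
    have "ipow (Suc e) \<subseteq> ?V"
    proof (rule ipow_minimal)
      show "closed ?V"
        unfolding closed_sequential_limits
      proof (intro allI impI)
        fix x a assume x: "(\<forall>k. x k \<in> ?V) \<and> x \<longlonglongrightarrow> a"
        then have xA: "x k \<in> A" "\<kappa> (x k) - x k \<in> ipow (d + Suc e)" and xa: "x \<longlonglongrightarrow> a" for k by auto
        have aA: "a \<in> A" by (rule closed_sequentially[OF A_closed xA(1) xa])
        have "\<kappa> a - a \<in> ipow (d + Suc e)"
        proof (rule closed_sequentially[OF ipow_closed])
          show "\<kappa> (x k) - x k \<in> ipow (d + Suc e)" for k by (rule xA(2))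
          show "(\<lambda>k. \<kappa> (x k) - x k) \<longlonglongrightarrow> \<kappa> a - a"
            by (intro tendsto_diff hom_tendsto[OF uoa \<kappa>(1) xA(1) aA] xa)
        qed
        then show "a \<in> ?V" using aA by blast
      qed
      have add: "\<kappa> x + \<kappa> y - (x + y) = (\<kappa> x - x) + (\<kappa> y - y)" for x y by simp
      have scale: "r *\<^sub>R \<kappa> x - r *\<^sub>R x = r *\<^sub>R (\<kappa> x - x)" for r x by (simp add: scaleR_diff_right)
      show "subspace ?V"
        by (simp add: subspace_def A_mem hom subspace_0[OF ipow_subspace] add scale
            subspace_add[OF ipow_subspace] subspace_scale[OF ipow_subspace] subspace_scale[OF uoa_subspace[OF uoa]]
            del: ipow.simps)
      fix x y assume xy: "x \<in> aug" "y \<in> ipow e"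
      have mem: "x \<in> A" "y \<in> A" using xy aug_mem ipow_subset_A by blast+
      have "(\<kappa> x - x) o\<^sub>L \<kappa> y \<in> ipow (Suc (d + e))"
        by (rule ipow_mult[OF d[OF xy(1)] \<kappa>_ipow[OF xy(2)]])
      moreover have "x o\<^sub>L (\<kappa> y - y) \<in> ipow (Suc (d + e))"
        by (rule ipow_mult_aug[OF xy(1) Suc.IH[OF xy(2)]])
      moreover have "\<kappa> (x o\<^sub>L y) - (x o\<^sub>L y) = ((\<kappa> x - x) o\<^sub>L \<kappa> y) + (x o\<^sub>L (\<kappa> y - y))"
        by (simp add: hom mem compose_algebra)
      ultimately show "x o\<^sub>L y \<in> ?V"
        using subspace_add[OF ipow_subspace] mem by (simp add: A_mem del: ipow.simps)
    qed
    then show ?case using Suc.prems by blast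
  qed
  have order: "\<kappa> a - a \<in> ipow (Suc d)" if "a \<in> aug" for a d
    using that
  proof (induction d arbitrary: a)
    case 0
    then show ?case using tangent by simp
  next
    case (Suc d)
    define q where "q = \<kappa> a - a"
    have aA: "a \<in> A" by (rule aug_mem[OF Suc.prems])
    have q: "q \<in> ipow (Suc d)" unfolding q_def by (rule Suc.IH[OF Suc.prems])
    have qA: "q \<in> A" by (rule ipow_subset_A[OF q])
    \<comment> \<open>The depth \<open>Suc d + Suc d\<close> exceeds \<open>Suc d\<close>, so
      \<kappa> fixes \<open>q\<close> modulo \<open>ipow (Suc (Suc d))\<close>. This is why the
      increments of the iterates accumulate to a multiple of \<open>q\<close>.\<close>
    have "\<kappa> q - q \<in> ipow (Suc d + Suc d)" by (rule shift[OF Suc.IH q])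
    then have \<kappa>q: "\<kappa> q - q \<in> ipow (Suc (Suc d))" using ipow_mono[of "Suc (Suc d)" "Suc d + Suc d"] by auto
    have iter: "(\<kappa> ^^ N) a \<in> A \<and> norm ((\<kappa> ^^ N) a) \<le> norm a \<and> (\<kappa> ^^ N) a - a - real N *\<^sub>R q \<in> ipow (Suc (Suc d))" for N
    proof (induction N)
      case 0
      then show ?case using aA subspace_0[OF ipow_subspace] by (simp del: ipow.simps)
    next
      case (Suc N)
      define b where "b = (\<kappa> ^^ N) a"
      have b: "b \<in> A" "norm b \<le> norm a" "b - a - real N *\<^sub>R q \<in> ipow (Suc (Suc d))"
        using Suc by (simp_all add: b_def)
      have NqA: "real N *\<^sub>R q \<in> A" by (rule subspace_scale[OF uoa_subspace[OF uoa] qA])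
      have "\<kappa> b - a - real (Suc N) *\<^sub>R q = \<kappa> (b - a - real N *\<^sub>R q) + real N *\<^sub>R (\<kappa> q - q)"
      proof -
        have "\<kappa> (b - a - real N *\<^sub>R q) = \<kappa> b - \<kappa> a - real N *\<^sub>R \<kappa> q"
          using b(1) aA qA NqA by (simp add: hom A_mem)
        moreover have "\<kappa> a = a + q" by (simp add: q_def)
        ultimately show ?thesis by (simp add: algebra_simps)
      qed
      also have "\<dots> \<in> ipow (Suc (Suc d))"
        by (intro subspace_add[OF ipow_subspace] subspace_scale[OF ipow_subspace] \<kappa>_ipow b(3) \<kappa>q)
      finally show ?case
        using \<kappa>A[OF b(1)] hom_norm[OF uoa \<kappa>(1) b(1)] b(2) by (simp add: b_def)
    qed
    \<comment> \<open>The difference \<open>(\<kappa> ^^ N) a - a\<close> has norm at most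
      \<open>2 * norm a\<close> for all \<open>N\<close>. Dividing it by \<open>N\<close> shows that
      \<open>- u / N\<close>, an element of \<open>ipow (Suc (Suc d))\<close>, tends to
      \<open>q\<close>.\<close>
    have "q \<in> closure (ipow (Suc (Suc d)))"
      unfolding closure_approachable
    proof (intro allI impI)
      fix \<epsilon> :: real assume "0 < \<epsilon>"
      obtain N :: nat where N: "2 * norm a / \<epsilon> < real N" using reals_Archimedean2 by blast
      have "0 \<le> 2 * norm a / \<epsilon>" using \<open>0 < \<epsilon>\<close> by simp
      then have N0: "0 < real N" using N by linarith
      define u where "u = (\<kappa> ^^ N) a - a - real N *\<^sub>R q"
      have u: "u \<in> ipow (Suc (Suc d))" and "norm ((\<kappa> ^^ N) a) \<le> norm a" using iter[of N] by (simp_all add: u_def)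
      then have "norm (u + real N *\<^sub>R q) \<le> 2 * norm a"
        unfolding u_def using norm_triangle_ineq4[of "(\<kappa> ^^ N) a" a] by simp
      moreover have "real N *\<^sub>R ((1 / real N) *\<^sub>R u + q) = u + real N *\<^sub>R q"
        using N0 by (simp add: scaleR_add_right)
      then have "norm (u + real N *\<^sub>R q) = real N * norm ((1 / real N) *\<^sub>R u + q)"
        using norm_scaleR[of "real N" "(1 / real N) *\<^sub>R u + q"] by simp
      ultimately have "norm ((1 / real N) *\<^sub>R u + q) \<le> 2 * norm a / real N"
        using N0 by (simp add: field_simps)
      also have "\<dots> < \<epsilon>" using N N0 \<open>0 < \<epsilon>\<close> by (simp add: field_simps)
      finally have "dist ((- 1 / real N) *\<^sub>R u) q < \<epsilon>"
        by (simp add: dist_norm) (metis add.commute minus_add_distrib norm_minus_cancel uminus_add_conv_diff)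
      then show "\<exists>y\<in>ipow (Suc (Suc d)). dist y q < \<epsilon>"
        using subspace_scale[OF ipow_subspace u] by blast
    qed
    then show ?case using ipow_closed[of "Suc (Suc d)"] by (simp add: q_def closure_closed del: ipow.simps)
  qed
  have fixed: "\<kappa> a = a" if "a \<in> aug" for a
  proof -
    have "\<kappa> a - a = 0"
      by (rule ipow_separated) (use order[OF that] ipow_antimono in blast)
    then show ?thesis by simp
  qed
  have "\<kappa> (a - scale_op (eps a) id_blinfun) = a - scale_op (eps a) id_blinfun"
    by (rule fixed[OF aug_part[OF a]])
  then show ?thesis using a by (simp add: hom A_mem)
qed

section \<open>Isometric isomorphisms\<close>

definition isometric_iso ::
    "'h::complex_hilbert_space op set \<Rightarrow> 'g::complex_hilbert_space op set \<Rightarrow> ('h op \<Rightarrow> 'g op) \<Rightarrow> bool" where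
  "isometric_iso A B \<phi> \<longleftrightarrow> unital_hom A \<phi> \<and> (\<forall>a\<in>A. norm (\<phi> a) = norm a) \<and> \<phi> ` A = B"

lemma isometric_isoD:
  assumes "isometric_iso A B \<phi>"
  shows "contractive_hom A \<phi>" "\<phi> ` A \<subseteq> B" "a \<in> A \<Longrightarrow> \<phi> a \<in> B" "a \<in> A \<Longrightarrow> norm (\<phi> a) = norm a"
  using assms by (auto simp: isometric_iso_def contractive_hom_def)

lemma isometric_iso_inverse:
  assumes A: "unital_operator_algebra A" and \<phi>: "isometric_iso A B \<phi>"
  obtains \<psi> where "isometric_iso B A \<psi>" "\<And>a. a \<in> A \<Longrightarrow> \<psi> (\<phi> a) = a" "\<And>b. b \<in> B \<Longrightarrow> \<phi> (\<psi> b) = b"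
proof -
  note D = isometric_isoD[OF \<phi>]
  note hom = hom_add[OF A D(1)] hom_compose[OF A D(1)] hom_scale[OF A D(1)] hom_id[OF A D(1)]
  have inj: "inj_on \<phi> A"
  proof (rule inj_onI)
    fix a b assume ab: "a \<in> A" "b \<in> A" "\<phi> a = \<phi> b"
    then have "norm (a - b) = norm (\<phi> (a - b))" by (simp add: D(4) uoa_diff[OF A])
    then show "a = b" using ab by (simp add: hom_diff[OF A D(1)])
  qed
  define \<psi> where "\<psi> = the_inv_into A \<phi>"
  have \<psi>\<phi>: "\<psi> (\<phi> a) = a" if "a \<in> A" for a
    unfolding \<psi>_def by (rule the_inv_into_f_f[OF inj that])
  have img: "\<phi> ` A = B" using \<phi> by (simp add: isometric_iso_def)
  have \<phi>\<psi>: "\<phi> (\<psi> b) = b" and \<psi>A: "\<psi> b \<in> A" if "b \<in> B" for b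
    using that \<psi>\<phi> img by auto
  have "isometric_iso B A \<psi>"
    unfolding isometric_iso_def unital_hom_def
  proof (intro conjI ballI allI)
    show "\<psi> ` B \<subseteq> clinear_ops" using \<psi>A uoa_clinear[OF A] by blast
    show "\<psi> id_blinfun = id_blinfun" using \<psi>\<phi>[OF uoa_id[OF A]] by (simp add: hom)
    show "norm (\<psi> b) = norm b" if "b \<in> B" for b using D(4)[OF \<psi>A[OF that]] \<phi>\<psi>[OF that] by simp
    show "\<psi> ` B = A" using \<psi>\<phi> \<psi>A img by force
    show "\<psi> (scale_op c b) = scale_op c (\<psi> b)" if "b \<in> B" for c b
      using \<psi>\<phi>[OF uoa_scale[OF A \<psi>A[OF that]], of c] by (simp add: hom \<psi>A[OF that] \<phi>\<psi>[OF that])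
    fix b b' assume b: "b \<in> B" "b' \<in> B"
    show "\<psi> (b + b') = \<psi> b + \<psi> b'"
      using \<psi>\<phi>[OF uoa_add[OF A \<psi>A[OF b(1)] \<psi>A[OF b(2)]]] by (simp add: hom \<psi>A b \<phi>\<psi>)
    show "\<psi> (b o\<^sub>L b') = \<psi> b o\<^sub>L \<psi> b'"
      using \<psi>\<phi>[OF uoa_compose[OF A \<psi>A[OF b(1)] \<psi>A[OF b(2)]]] by (simp add: hom \<psi>A b \<phi>\<psi>)
  qed
  then show ?thesis using that \<psi>\<phi> \<phi>\<psi> by blast
qed

text \<open>Two contractions inverse to each other are isometric and onto.\<close>

lemma isometric_iso_comp_automorphism:
  assumes A: "unital_operator_algebra A" and \<phi>: "isometric_iso A B \<phi>"
    and \<mu>: "contractive_hom A \<mu>" "\<mu> ` A \<subseteq> A" "contractive_hom A \<mu>'" "\<mu>' ` A \<subseteq> A"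
    and inv: "\<And>a. a \<in> A \<Longrightarrow> \<mu> (\<mu>' a) = a" "\<And>a. a \<in> A \<Longrightarrow> \<mu>' (\<mu> a) = a"
  shows "isometric_iso A B (\<lambda>a. \<phi> (\<mu> a))"
proof -
  have mem: "\<mu> a \<in> A" "\<mu>' a \<in> A" if "a \<in> A" for a using \<mu> that by blast+
  have "norm (\<mu> a) = norm a" if "a \<in> A" for a
    using hom_norm[OF A \<mu>(1) that] hom_norm[OF A \<mu>(3) mem(1)[OF that]] inv(2)[OF that] by simp
  moreover have "\<mu> ` A = A"
  proof
    show "A \<subseteq> \<mu> ` A" using inv(1) mem(2) by (metis imageI subsetI)
  qed (rule \<mu>(2))
  moreover have "unital_hom A (\<lambda>a. \<phi> (\<mu> a))"
    using contractive_hom_comp[OF \<mu>(1,2) isometric_isoD(1)[OF \<phi>]] by (simp add: contractive_hom_def)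
  ultimately show ?thesis
    using \<phi> mem unfolding isometric_iso_def by (simp add: image_image[symmetric, of \<phi> \<mu>])
qed

section \<open>The degree-one part as a normed space, and the separation of the factors\<close>

context free_rows
begin

lemma lin_comb_add: "lin_comb c + lin_comb d = lin_comb (\<lambda>i j. c i j + d i j)"
  by (simp add: lin_comb_def scale_op_add_left sum.distrib)

lemma lin_comb_diff: "lin_comb c - lin_comb d = lin_comb (\<lambda>i j. c i j - d i j)"
  by (simp add: lin_comb_def scale_op_diff_left sum_subtractf)

lemma scale_lin_comb: "scale_op z (lin_comb c) = lin_comb (\<lambda>i j. z * c i j)"
  by (simp add: lin_comb_def scale_op_sum_right)

lemma sum_lin_comb: "finite S \<Longrightarrow> (\<And>x. x \<in> S \<Longrightarrow> \<exists>c. f x = lin_comb c) \<Longrightarrow> \<exists>c. sum f S = lin_comb c"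
proof (induction S rule: finite_induct)
  case empty
  then show ?case by (intro exI[of _ "\<lambda>_ _. 0"]) (simp add: lin_comb_def)
next
  case (insert x S)
  then obtain c d where "f x = lin_comb c" "sum f S = lin_comb d" by blast
  then show ?case using insert(1,2) lin_comb_add by auto
qed

definition row_norm :: "nat \<Rightarrow> (nat \<Rightarrow> nat \<Rightarrow> complex) \<Rightarrow> real" where
  "row_norm i c = L2_set (\<lambda>j. cmod (c i j)) {..<n i}"

lemma norm_lin_comb_row_norm: "norm (lin_comb c) = (\<Sum>i<m. row_norm i c)"
  by (simp add: norm_lin_comb row_norm_def)

lemma row_norm_nonneg [simp]: "0 \<le> row_norm i c"
  by (simp add: row_norm_def)

lemma row_norm_eq_0_iff: "row_norm i c = 0 \<longleftrightarrow> (\<forall>j<n i. c i j = 0)"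
  by (auto simp: row_norm_def L2_set_eq_0_iff)

lemma coeff_le_row_norm: "j < n i \<Longrightarrow> cmod (c i j) \<le> row_norm i c"
  unfolding row_norm_def by (rule member_le_L2_set) auto

lemma row_norm_le: "i < m \<Longrightarrow> row_norm i c \<le> norm (lin_comb c)"
  unfolding norm_lin_comb_row_norm by (rule member_le_sum) auto

lemma lin_comb_eqD:
  assumes "lin_comb c = lin_comb d" "i < m" "j < n i" shows "c i j = d i j"
proof -
  have "norm (lin_comb (\<lambda>i j. c i j - d i j)) = 0"
    unfolding lin_comb_diff[symmetric] using assms(1) by simp
  then have "row_norm i (\<lambda>i j. c i j - d i j) = 0"
    using row_norm_le[OF assms(2), of "\<lambda>i j. c i j - d i j"]
      row_norm_nonneg[of i "\<lambda>i j. c i j - d i j"] by linarith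
  then show ?thesis using assms(3) by (simp add: row_norm_eq_0_iff)
qed

lemma lin_comb_cong: "(\<And>i j. i < m \<Longrightarrow> j < n i \<Longrightarrow> c i j = d i j) \<Longrightarrow> lin_comb c = lin_comb d"
  unfolding lin_comb_def by (intro sum.cong refl) simp

text \<open>The coordinate \<open>(i, j)\<close> alone exhausts the norm:
  \<open>1 \<le> |u i j| + |1 - u i j|\<close>, and the right-hand side is at most the given sum of
  norms. Hence \<open>norm (lin_comb u) \<le> |u i j|\<close>, and the other coordinates vanish,
  those of row \<open>i\<close> by Pythagoras and the other rows because row norms add.\<close>

lemma generator_extremal:
  assumes i: "i < m" and j: "j < n i"
    and split: "norm (lin_comb u) + norm (s i j - lin_comb u) \<le> 1"
  shows "lin_comb u = scale_op (u i j) (s i j)"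
proof -
  let ?e = "unit_coeff i j"
  have "s i j - lin_comb u = lin_comb (\<lambda>i' j'. ?e i' j' - u i' j')"
    unfolding lin_comb_diff[symmetric] lin_comb_unit_coeff[OF i j] ..
  then have "cmod (1 - u i j) \<le> norm (s i j - lin_comb u)"
    using order.trans[OF coeff_le_row_norm[of j i "\<lambda>i' j'. ?e i' j' - u i' j'"] row_norm_le] i j
    by (simp add: unit_coeff_def)
  moreover have "1 \<le> cmod (u i j) + cmod (1 - u i j)"
    using norm_triangle_ineq[of "u i j" "1 - u i j"] by simp
  ultimately have N: "norm (lin_comb u) \<le> cmod (u i j)" using split by linarith
  have zero: "u i' j' = 0" if i': "i' < m" "j' < n i'" "(i', j') \<noteq> (i, j)" for i' j'
  proof (cases "i' = i")
    case True
    then have j': "j' < n i" "j' \<noteq> j" using i' by auto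
    have "row_norm i u \<le> cmod (u i j)" using N row_norm_le[OF i, of u] by simp
    then have "(row_norm i u)\<^sup>2 \<le> (cmod (u i j))\<^sup>2" by (intro power_mono) auto
    moreover have "(row_norm i u)\<^sup>2 = (\<Sum>q<n i. (cmod (u i q))\<^sup>2)"
      by (simp add: row_norm_def L2_set_def sum_nonneg)
    moreover have "(\<Sum>q\<in>{j, j'}. (cmod (u i q))\<^sup>2) \<le> (\<Sum>q<n i. (cmod (u i q))\<^sup>2)"
      using j j' by (intro sum_mono2) auto
    moreover have "(\<Sum>q\<in>{j, j'}. (cmod (u i q))\<^sup>2) = (cmod (u i j))\<^sup>2 + (cmod (u i j'))\<^sup>2"
      using j' by simp
    ultimately have "(cmod (u i j'))\<^sup>2 \<le> 0" by linarith
    then show ?thesis using True by simp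
  next
    case False
    have "(\<Sum>p\<in>{i, i'}. row_norm p u) \<le> norm (lin_comb u)"
      unfolding norm_lin_comb_row_norm using i i' by (intro sum_mono2) auto
    then have "row_norm i' u \<le> 0"
      using N coeff_le_row_norm[OF j, of u] False by simp
    then have "row_norm i' u = 0" by (simp add: order_antisym)
    then show ?thesis using i' by (simp add: row_norm_eq_0_iff)
  qed
  have "lin_comb u = lin_comb (\<lambda>i' j'. u i j * ?e i' j')"
    by (rule lin_comb_cong) (use zero in \<open>auto simp: unit_coeff_def\<close>)
  then show ?thesis by (simp add: scale_lin_comb[symmetric] lin_comb_unit_coeff i j)
qed

text \<open>Tells whether two generators share a row: within a row the norm is Hilbertian and the
  sum has norm \<open>sqrt 2\<close>, across rows the norms add to 2.\<close>

lemma norm_add_gens: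
  assumes "i < m" "j < n i" "j' < n i" "j \<noteq> j'" shows "norm (s i j + s i j') = sqrt 2"
proof -
  let ?c = "\<lambda>i' q. unit_coeff i j i' q + unit_coeff i j' i' q"
  have "s i j + s i j' = lin_comb ?c"
    using assms by (simp add: lin_comb_add[symmetric] lin_comb_unit_coeff)
  moreover have "row_norm i' ?c = (if i' = i then sqrt 2 else 0)" for i'
  proof -
    have "(\<Sum>q<n i. (cmod (?c i q))\<^sup>2) = (\<Sum>q\<in>{j, j'}. 1)"
      using assms by (intro sum.mono_neutral_cong_right) (auto simp: unit_coeff_def)
    then show ?thesis using assms by (auto simp: row_norm_def L2_set_def unit_coeff_def)
  qed
  ultimately show ?thesis using assms by (simp add: norm_lin_comb_row_norm)
qed

text \<open>The character that is 1 at \<open>s i 0\<close> and 0 at the other generators agrees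
  with \<open>eps\<close> on every other factor but not on factor \<open>i\<close>. The assumption
  \<open>0 < n i\<close> supplies this generator; an empty row would generate only scalars.\<close>

lemma factor_inject:
  assumes "i < m" "i' < m" "0 < n i" "free_factor n s i \<subseteq> free_factor n s i'"
  shows "i = i'"
proof (rule ccontr)
  assume ne: "i \<noteq> i'"
  have "\<exists>\<kappa>. character A \<kappa> \<and> (\<forall>p<m. \<forall>q<n p. \<kappa> (s p q) = unit_coeff i 0 p q)"
  proof (rule ex_character)
    fix p
    have "(\<Sum>q<n p. (cmod (unit_coeff i 0 p q))\<^sup>2) = (L2_set (\<lambda>q. cmod (unit_coeff i 0 p q)) {..<n p})\<^sup>2"
      by (simp add: L2_set_def sum_nonneg)
    then show "(\<Sum>q<n p. (cmod (unit_coeff i 0 p q))\<^sup>2) \<le> 1"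
      using L2_set_unit_coeff[of 0 i p] assms(3) by simp
  qed
  then obtain \<kappa> where \<kappa>: "character A \<kappa>" "\<forall>p<m. \<forall>q<n p. \<kappa> (s p q) = unit_coeff i 0 p q" by blast
  have "free_factor n s i' \<subseteq> {a \<in> A. \<kappa> a = eps a}"
    by (rule factor_subset[OF char_equalizer_uoa[OF uoa \<kappa>(1) eps char_tendsto[OF uoa eps]]])
      (use \<kappa>(2) ne assms(2) gen_mem eps_gen in \<open>auto simp: unit_coeff_def\<close>)
  then have "\<kappa> (s i 0) = eps (s i 0)" using factor_gen[OF assms(3)] assms(4) by blast
  then show False using \<kappa>(2) assms eps_gen by (simp add: unit_coeff_def)
qed

end

section \<open>Isomorphisms between two free products\<close>

locale free_rows_pair = A: free_rows m1 n s A + B: free_rows m2 k t B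
  for m1 n and s :: "nat \<Rightarrow> nat \<Rightarrow> 'h::complex_hilbert_space op" and A
    and m2 k and t :: "nat \<Rightarrow> nat \<Rightarrow> 'g::complex_hilbert_space op" and B
begin

text \<open>For unimodular \<open>w\<close>, the composite of \<open>gauge (cnj w)\<close>,
  \<theta>, \<open>gauge w\<close> and the inverse of \<theta> is tangent to the identity, hence
  equal to it by \<open>cartan_uniqueness\<close>. So \<theta> commutes with the gauge action, and
  the image of a generator is an eigenvector of weight one.\<close>

lemma based_iso_generator_linear:
  assumes \<theta>: "isometric_iso A B \<theta>" and based: "\<And>a. a \<in> A \<Longrightarrow> B.eps (\<theta> a) = A.eps a"
    and i: "i < m1" and j: "j < n i"
  shows "\<exists>c. \<theta> (s i j) = B.lin_comb c"
proof (rule B.closure_homog_1, rule B.gauge_eigenvector_closure_homog)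
  note T = isometric_isoD[OF \<theta>]
  obtain \<eta> where \<eta>: "isometric_iso B A \<eta>" and \<eta>\<theta>: "\<And>a. a \<in> A \<Longrightarrow> \<eta> (\<theta> a) = a"
    and \<theta>\<eta>: "\<And>b. b \<in> B \<Longrightarrow> \<theta> (\<eta> b) = b" using isometric_iso_inverse[OF A.uoa \<theta>] by metis
  note E = isometric_isoD[OF \<eta>]
  have \<eta>_eps: "A.eps (\<eta> b) = B.eps b" if "b \<in> B" for b
    using based[OF E(3)[OF that]] \<theta>\<eta>[OF that] by simp
  have sA: "s i j \<in> A" by (rule A.gen_mem[OF i j])
  show "\<theta> (s i j) \<in> B" by (rule T(3)[OF sA])
  fix w :: complex assume w: "cmod w = 1"
  define v where "v = cnj w"
  have v1: "cmod v \<le> 1" and w1: "cmod w \<le> 1" and vw: "v * w = 1"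
    using w complex_norm_square[of w] by (simp_all add: v_def mult.commute)
  define \<kappa> where "\<kappa> a = \<eta> (B.gauge w (\<theta> (A.gauge v a)))" for a
  have gA: "A.gauge v ` A \<subseteq> A" and gB: "B.gauge w ` B \<subseteq> B" using A.gauge(2)[OF v1] B.gauge(2)[OF w1] by auto
  have c1: "contractive_hom A (\<lambda>a. \<theta> (A.gauge v a))" by (rule contractive_hom_comp[OF A.gauge(1)[OF v1] gA T(1)])
  have m1: "(\<lambda>a. \<theta> (A.gauge v a)) ` A \<subseteq> B" using gA T(3) by blast
  have c2: "contractive_hom A (\<lambda>a. B.gauge w (\<theta> (A.gauge v a)))"
    by (rule contractive_hom_comp[OF c1 m1 B.gauge(1)[OF w1]])
  have m2: "(\<lambda>a. B.gauge w (\<theta> (A.gauge v a))) ` A \<subseteq> B" using m1 gB by blast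
  have \<kappa>: "contractive_hom A \<kappa>" unfolding \<kappa>_def by (rule contractive_hom_comp[OF c2 m2 E(1)])
  have \<kappa>A: "\<kappa> ` A \<subseteq> A" unfolding \<kappa>_def using m2 E(3) by blast
  have gA_eps: "A.eps (A.gauge v a) = A.eps a" if "a \<in> A" for a
    by (rule A.character_eqI[OF character_comp[OF A.gauge(1)[OF v1] gA A.eps] A.eps _ that])
      (simp add: A.gauge(3)[OF v1] char_scale[OF A.uoa A.eps] A.gen_mem A.eps_gen)
  have gB_eps: "B.eps (B.gauge w b) = B.eps b" if "b \<in> B" for b
    by (rule B.character_eqI[OF character_comp[OF B.gauge(1)[OF w1] gB B.eps] B.eps _ that])
      (simp add: B.gauge(3)[OF w1] char_scale[OF B.uoa B.eps] B.gen_mem B.eps_gen)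
  have \<kappa>_eps: "A.eps (\<kappa> a) = A.eps a" if "a \<in> A" for a
    using that gA m1 m2 by (auto simp: \<kappa>_def \<eta>_eps gB_eps based gA_eps image_subset_iff)
  \<comment> \<open>Modulo \<open>ipow 1\<close> the two gauge maps act as the scalars
    \<open>v\<close> and \<open>w\<close>, whose product is 1. The errors \<open>x\<close> and
    \<open>y\<close> are kept in \<open>ipow 1\<close> by \<theta>, \<open>B.gauge w\<close> and
    \<eta>.\<close>
  have tangent: "\<kappa> a - a \<in> A.ipow 1" if a: "a \<in> A.aug" for a
  proof -
    have aA: "a \<in> A" by (rule A.aug_mem[OF a])
    define x where "x = A.gauge v a - scale_op v a"
    have x: "x \<in> A.ipow 1" unfolding x_def by (rule A.gauge_mod_ipow_1[OF v1 a])
    have xA: "x \<in> A" by (rule A.ipow_subset_A[OF x])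
    have \<theta>x: "\<theta> x \<in> B.ipow 1"
      by (rule hom_ipow[OF A.free_rows_axioms B.free_rows_axioms T(1,2) based x])
    have \<theta>a: "\<theta> a \<in> B.aug" using based[OF aA] T(3)[OF aA] a by (simp add: A.aug_def B.aug_def)
    define y where "y = B.gauge w (\<theta> a) - scale_op w (\<theta> a)"
    have y: "y \<in> B.ipow 1" unfolding y_def by (rule B.gauge_mod_ipow_1[OF w1 \<theta>a])
    have gx: "B.gauge w (\<theta> x) \<in> B.ipow 1"
      by (rule hom_ipow[OF B.free_rows_axioms B.free_rows_axioms B.gauge(1)[OF w1] gB gB_eps \<theta>x])
    define r where "r = scale_op v y + B.gauge w (\<theta> x)"
    have r: "r \<in> B.ipow 1" unfolding r_def
      by (rule subspace_add[OF B.ipow_subspace B.ipow_scale[OF y] gx])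
    have "A.gauge v a = scale_op v a + x" by (simp add: x_def)
    then have "\<theta> (A.gauge v a) = scale_op v (\<theta> a) + \<theta> x"
      using aA xA by (simp add: hom_add[OF A.uoa T(1)] hom_scale[OF A.uoa T(1)] A.A_mem)
    then have "B.gauge w (\<theta> (A.gauge v a)) = scale_op v (B.gauge w (\<theta> a)) + B.gauge w (\<theta> x)"
      using T(3)[OF aA] T(3)[OF xA] by (simp add: B.gauge_simps w1 B.A_mem)
    also have "B.gauge w (\<theta> a) = scale_op w (\<theta> a) + y" by (simp add: y_def)
    finally have "B.gauge w (\<theta> (A.gauge v a)) = \<theta> a + r" by (simp add: r_def scale_op_add_right vw)
    then have "\<kappa> a = a + \<eta> r"
      using T(3)[OF aA] B.ipow_subset_A[OF r] by (simp add: \<kappa>_def hom_add[OF B.uoa E(1)] \<eta>\<theta>[OF aA])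
    moreover have "\<eta> r \<in> A.ipow 1"
      by (rule hom_ipow[OF B.free_rows_axioms A.free_rows_axioms E(1,2) \<eta>_eps r])
    ultimately show ?thesis by simp
  qed
  have "\<kappa> (s i j) = s i j" by (rule A.cartan_uniqueness[OF \<kappa> \<kappa>A \<kappa>_eps tangent sA])
  moreover have "A.gauge v (s i j) = scale_op v (s i j)" by (rule A.gauge(3)[OF v1 i j])
  ultimately have "\<eta> (scale_op v (B.gauge w (\<theta> (s i j)))) = s i j"
    using T(3)[OF sA] by (simp add: \<kappa>_def hom_scale[OF A.uoa T(1)] sA B.gauge_simps w1)
  then have "scale_op v (B.gauge w (\<theta> (s i j))) = \<theta> (s i j)"
    using \<theta>\<eta>[of "scale_op v (B.gauge w (\<theta> (s i j)))"] T(3)[OF sA] by (simp add: B.A_mem B.gauge(2)[OF w1])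
  then have "scale_op w (scale_op v (B.gauge w (\<theta> (s i j)))) = scale_op w (\<theta> (s i j))" by simp
  then show "B.gauge w (\<theta> (s i j)) = scale_op w (\<theta> (s i j))" using vw by (simp add: mult.commute)
qed

text \<open>Splitting the image of \<open>s i j\<close> into its part \<open>d1\<close> in one row
  and the rest is a decomposition with additive norms. Its pullback under the inverse splits
  \<open>s i j\<close> in the same way, so \<open>generator_extremal\<close> makes \<open>d1\<close>
  a multiple of the whole image. Linearity of the inverse on generators ensures that the pullback is
  again a linear combination.\<close>

lemma linear_iso_generator_in_row:
  assumes \<theta>: "isometric_iso A B \<theta>" and \<eta>: "isometric_iso B A \<eta>"
    and inv: "\<And>b. b \<in> B \<Longrightarrow> \<theta> (\<eta> b) = b"
    and lin: "\<And>i j. i < m1 \<Longrightarrow> j < n i \<Longrightarrow> \<exists>c. \<theta> (s i j) = B.lin_comb c"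
      "\<And>p q. p < m2 \<Longrightarrow> q < k p \<Longrightarrow> \<exists>c. \<eta> (t p q) = A.lin_comb c"
    and i: "i < m1" and j: "j < n i"
  shows "\<exists>p<m2. \<exists>c. \<theta> (s i j) = B.lin_comb c \<and> (\<forall>p'<m2. \<forall>q<k p'. p' \<noteq> p \<longrightarrow> c p' q = 0)"
proof -
  note T = isometric_isoD[OF \<theta>] and E = isometric_isoD[OF \<eta>]
  have sA: "s i j \<in> A" by (rule A.gen_mem[OF i j])
  obtain d where d: "\<theta> (s i j) = B.lin_comb d" using lin(1)[OF i j] by blast
  have "norm (B.lin_comb d) = 1" using T(4)[OF sA] A.norm_gen[OF i j] d by simp
  then have "(\<Sum>p<m2. B.row_norm p d) \<noteq> 0" by (simp add: B.norm_lin_comb_row_norm)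
  then obtain p where p: "p < m2" "B.row_norm p d \<noteq> 0" by (metis lessThan_iff sum.neutral)
  then obtain q where q: "q < k p" "d p q \<noteq> 0" by (auto simp: B.row_norm_eq_0_iff)
  define d1 where "d1 p' q = (if p' = p then d p' q else 0)" for p' q
  define d2 where "d2 p' q = d p' q - d1 p' q" for p' q
  have row1: "B.row_norm p' d1 = (if p' = p then B.row_norm p d else 0)" for p'
    by (simp add: B.row_norm_def d1_def L2_set_def)
  have row2: "B.row_norm p' d2 = (if p' = p then 0 else B.row_norm p' d)" for p'
    by (simp add: B.row_norm_def d1_def d2_def L2_set_def)
  have "norm (B.lin_comb d1) + norm (B.lin_comb d2) = (\<Sum>p'<m2. B.row_norm p' d1 + B.row_norm p' d2)"
    by (simp add: B.norm_lin_comb_row_norm sum.distrib)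
  also have "\<dots> = (\<Sum>p'<m2. B.row_norm p' d)" by (rule sum.cong) (simp_all add: row1 row2)
  finally have norms: "norm (B.lin_comb d1) + norm (B.lin_comb d2) = 1"
    using \<open>norm (B.lin_comb d) = 1\<close> by (simp add: B.norm_lin_comb_row_norm)
  have "\<exists>u. \<eta> (B.lin_comb d1) = A.lin_comb u"
  proof -
    have "\<exists>u. scale_op z (A.lin_comb c) = A.lin_comb u" for z c using A.scale_lin_comb by blast
    then have "\<exists>u. \<eta> (scale_op (d1 p' q) (t p' q)) = A.lin_comb u" if "p' < m2" "q < k p'" for p' q
      using lin(2)[OF that] by (metis hom_scale[OF B.uoa E(1)] B.gen_mem[OF that])
    then have "\<exists>u. (\<Sum>p'<m2. \<Sum>q<k p'. \<eta> (scale_op (d1 p' q) (t p' q))) = A.lin_comb u"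
      by (intro A.sum_lin_comb) auto
    moreover have "\<eta> (B.lin_comb d1) = (\<Sum>p'<m2. \<eta> (\<Sum>q<k p'. scale_op (d1 p' q) (t p' q)))"
      unfolding B.lin_comb_def by (intro hom_sum[OF B.uoa E(1)] B.A_mem B.gen_mem) auto
    moreover have "\<dots> = (\<Sum>p'<m2. \<Sum>q<k p'. \<eta> (scale_op (d1 p' q) (t p' q)))"
      by (intro sum.cong hom_sum[OF B.uoa E(1)] B.A_mem B.gen_mem) auto
    ultimately show ?thesis by metis
  qed
  then obtain u where u: "\<eta> (B.lin_comb d1) = A.lin_comb u" by blast
  have \<theta>u: "\<theta> (A.lin_comb u) = B.lin_comb d1" unfolding u[symmetric] by (rule inv[OF B.lin_comb_mem])
  have "norm (A.lin_comb u) = norm (B.lin_comb d1)" using T(4)[OF A.lin_comb_mem, of u] \<theta>u by simp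
  moreover have "norm (s i j - A.lin_comb u) = norm (B.lin_comb d2)"
  proof -
    have "norm (s i j - A.lin_comb u) = norm (\<theta> (s i j - A.lin_comb u))"
      using sA A.lin_comb_mem by (intro T(4)[symmetric] A.A_mem)
    also have "\<theta> (s i j - A.lin_comb u) = B.lin_comb d - B.lin_comb d1"
      by (simp add: hom_diff[OF A.uoa T(1)] sA A.lin_comb_mem d \<theta>u)
    also have "\<dots> = B.lin_comb d2" unfolding B.lin_comb_diff d2_def ..
    finally show ?thesis .
  qed
  ultimately have "A.lin_comb u = scale_op (u i j) (s i j)"
    using norms by (intro A.generator_extremal[OF i j]) simp
  then have "B.lin_comb d1 = B.lin_comb (\<lambda>p' q. u i j * d p' q)"
    using \<theta>u d by (simp add: hom_scale[OF A.uoa T(1)] sA B.scale_lin_comb)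
  then have eq: "d1 p' q' = u i j * d p' q'" if "p' < m2" "q' < k p'" for p' q'
    by (rule B.lin_comb_eqD[OF _ that])
  \<comment> \<open>The coefficient \<open>d p q\<close> is nonzero and unchanged in
    \<open>d1\<close>, which forces the multiple to be 1; every coefficient outside row
    \<open>p\<close> is then 0.\<close>
  have "u i j = 1" using eq[OF p(1) q(1)] q(2) by (simp add: d1_def)
  then have "d p' q' = 0" if "p' < m2" "q' < k p'" "p' \<noteq> p" for p' q'
    using eq[OF that(1,2)] that(3) by (simp add: d1_def)
  then show ?thesis using p(1) d by blast
qed

text \<open>All generators of row \<open>i\<close> go to the same row: two of them in different rows
  would have a sum of norm 2, while the sum in row \<open>i\<close> has norm \<open>sqrt 2\<close>.
  The generator \<open>s i 0\<close> serves as reference.\<close>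

lemma linear_iso_factor:
  assumes \<theta>: "isometric_iso A B \<theta>" and \<eta>: "isometric_iso B A \<eta>"
    and inv: "\<And>b. b \<in> B \<Longrightarrow> \<theta> (\<eta> b) = b"
    and lin: "\<And>i j. i < m1 \<Longrightarrow> j < n i \<Longrightarrow> \<exists>c. \<theta> (s i j) = B.lin_comb c"
      "\<And>p q. p < m2 \<Longrightarrow> q < k p \<Longrightarrow> \<exists>c. \<eta> (t p q) = A.lin_comb c"
    and i: "i < m1" "0 < n i"
  shows "\<exists>p<m2. \<theta> ` free_factor n s i \<subseteq> free_factor k t p"
proof -
  note T = isometric_isoD[OF \<theta>]
  have "\<forall>j\<in>{..<n i}. \<exists>p c. p < m2 \<and> \<theta> (s i j) = B.lin_comb c \<and> (\<forall>p'<m2. \<forall>q<k p'. p' \<noteq> p \<longrightarrow> c p' q = 0)"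
    using linear_iso_generator_in_row[OF \<theta> \<eta> inv lin i(1)] by blast
  then obtain p c where p: "\<And>j. j < n i \<Longrightarrow> p j < m2" and c: "\<And>j. j < n i \<Longrightarrow> \<theta> (s i j) = B.lin_comb (c j)"
    and supp: "\<And>j p' q. j < n i \<Longrightarrow> p' < m2 \<Longrightarrow> q < k p' \<Longrightarrow> p' \<noteq> p j \<Longrightarrow> c j p' q = 0"
    by (metis lessThan_iff)
  have row_c: "B.row_norm p' (c j) = (if p' = p j then 1 else 0)" if j: "j < n i" and p': "p' < m2" for j p'
  proof -
    have z: "B.row_norm p'' (c j) = 0" if "p'' < m2" "p'' \<noteq> p j" for p''
      using supp[OF j that(1) _ that(2)] by (simp add: B.row_norm_eq_0_iff)
    have "1 = norm (B.lin_comb (c j))" using T(4)[OF A.gen_mem[OF i(1) j]] A.norm_gen[OF i(1) j] c[OF j] by simp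
    also have "\<dots> = (\<Sum>p''<m2. if p'' = p j then B.row_norm (p j) (c j) else 0)"
      unfolding B.norm_lin_comb_row_norm by (rule sum.cong) (use z in auto)
    finally have "B.row_norm (p j) (c j) = 1" using p[OF j] by simp
    then show ?thesis using z[OF p'] by auto
  qed
  have same: "p j = p 0" if j: "j < n i" for j
  proof (rule ccontr)
    assume ne: "p j \<noteq> p 0"
    let ?d = "\<lambda>p' q. c j p' q + c 0 p' q"
    have row_d: "B.row_norm p' ?d = B.row_norm p' (c j) + B.row_norm p' (c 0)" if p': "p' < m2" for p'
    proof (cases "p' = p j")
      case True
      then have z: "c 0 p' q = 0" if "q < k p'" for q using supp[OF i(2) p' that] ne by simp
      have "B.row_norm p' ?d = B.row_norm p' (c j)"
        unfolding B.row_norm_def by (rule L2_set_cong) (use z in auto)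
      moreover have "B.row_norm p' (c 0) = 0" using z by (simp add: B.row_norm_eq_0_iff)
      ultimately show ?thesis by simp
    next
      case False
      then have z: "c j p' q = 0" if "q < k p'" for q using supp[OF j p' that] by simp
      have "B.row_norm p' ?d = B.row_norm p' (c 0)"
        unfolding B.row_norm_def by (rule L2_set_cong) (use z in auto)
      moreover have "B.row_norm p' (c j) = 0" using z by (simp add: B.row_norm_eq_0_iff)
      ultimately show ?thesis by simp
    qed
    have "norm (B.lin_comb ?d) = norm (B.lin_comb (c j)) + norm (B.lin_comb (c 0))"
      unfolding B.norm_lin_comb_row_norm sum.distrib[symmetric] by (rule sum.cong) (use row_d in auto)
    moreover have "norm (B.lin_comb (c j')) = 1" if "j' < n i" for j'
      using T(4)[OF A.gen_mem[OF i(1) that]] A.norm_gen[OF i(1) that] c[OF that] by simp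
    ultimately have "norm (B.lin_comb ?d) = 2" using j i(2) by simp
    moreover have "B.lin_comb ?d = \<theta> (s i j + s i 0)"
      using c j i A.gen_mem by (simp add: hom_add[OF A.uoa T(1)] B.lin_comb_add)
    moreover have "norm (\<theta> (s i j + s i 0)) = norm (s i j + s i 0)"
      using j i A.gen_mem by (intro T(4) A.A_mem) auto
    moreover have "j \<noteq> 0" using ne by metis
    then have "norm (s i j + s i 0) = sqrt 2" using A.norm_add_gens[OF i(1) j i(2)] by simp
    ultimately have "sqrt 2 = 2" by simp
    then have "sqrt 2 * sqrt 2 = 2 * (2::real)" by simp
    then show False by simp
  qed
  let ?p = "p 0"
  have p0: "?p < m2" by (rule p[OF i(2)])
  note F = B.factor_uoa[OF p0]
  have "\<theta> (s i j) \<in> free_factor k t ?p" if j: "j < n i" for j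
  proof -
    have "B.lin_comb (c j) = (\<Sum>p'<m2. \<Sum>q<k p'. if p' = ?p then scale_op (c j ?p q) (t ?p q) else 0)"
      unfolding B.lin_comb_def
      by (intro sum.cong refl) (use supp[OF j] same[OF j] in auto)
    also have "\<dots> \<in> free_factor k t ?p"
      by (intro uoa_sum[OF F]) (auto intro: uoa_scale[OF F] uoa_zero[OF F] B.factor_gen)
    finally show ?thesis using c[OF j] by simp
  qed
  then have "free_factor n s i \<subseteq> {a \<in> A. \<theta> a \<in> free_factor k t ?p}"
    using A.gen_mem[OF i(1)] by (intro A.factor_subset hom_preimage_uoa[OF A.uoa T(1) F]) auto
  then show ?thesis using p0 by blast
qed

text \<open>Induction on the set of generators where the pulled-back character has been made to
  vanish, with one Moebius map for each. The inclusions of images of factors are carried along so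
  that a conclusion about \<theta> can be read back for \<phi>.\<close>

lemma ex_based_iso:
  assumes \<phi>: "isometric_iso A B \<phi>" and C: "finite C" "C \<subseteq> {(i, j). i < m1 \<and> j < n i}"
  shows "\<exists>\<theta>. isometric_iso A B \<theta> \<and> (\<forall>i<m1. \<phi> ` free_factor n s i \<subseteq> \<theta> ` free_factor n s i) \<and>
     (\<forall>(i, j)\<in>C. B.eps (\<theta> (s i j)) = 0)"
  using C
proof (induction C rule: finite_induct)
  case empty
  then show ?case using \<phi> by blast
next
  case (insert x C)
  obtain i j where x: "x = (i, j)" by (cases x)
  then have ij: "i < m1" "j < n i" using insert.prems by auto
  obtain \<theta> where \<theta>: "isometric_iso A B \<theta>" and fac: "\<forall>i<m1. \<phi> ` free_factor n s i \<subseteq> \<theta> ` free_factor n s i"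
    and zero: "\<forall>(i, j)\<in>C. B.eps (\<theta> (s i j)) = 0" using insert by auto
  note T = isometric_isoD[OF \<theta>]
  obtain \<eta> where \<eta>: "isometric_iso B A \<eta>" and \<eta>\<theta>: "\<And>a. a \<in> A \<Longrightarrow> \<eta> (\<theta> a) = a"
    using isometric_iso_inverse[OF A.uoa \<theta>] by metis
  note E = isometric_isoD[OF \<eta>]
  have sA: "s i j \<in> A" by (rule A.gen_mem[OF ij])
  define \<kappa> where "\<kappa> a = B.eps (\<theta> a)" for a
  have \<kappa>: "character A \<kappa>" unfolding \<kappa>_def by (rule character_comp[OF T(1,2) B.eps])
  have "cmod (\<kappa> (s i j)) < 1"
    unfolding \<kappa>_def
  proof (rule B.cmod_eps_less_1[OF T(3)[OF sA]])
    show "norm (\<theta> (s i j)) \<le> 1" using T(4)[OF sA] A.norm_gen[OF ij] by simp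
    \<comment> \<open>The base character of \<open>A\<close>, pulled back to \<open>B\<close>, kills
      the image of the generator; this provides the zero required by the maximum modulus
      argument.\<close>
    show "character B (\<lambda>b. A.eps (\<eta> b))" by (rule character_comp[OF E(1,2) A.eps])
    show "A.eps (\<eta> (\<theta> (s i j))) = 0" by (simp add: \<eta>\<theta>[OF sA] A.eps_gen ij)
  qed
  from A.ex_moebius[OF ij this] obtain \<mu> \<mu>' where \<mu>: "contractive_hom A \<mu>" "\<mu> ` A \<subseteq> A"
    "contractive_hom A \<mu>'" "\<mu>' ` A \<subseteq> A" and inv: "\<forall>x\<in>A. \<mu> (\<mu>' x) = x" "\<forall>x\<in>A. \<mu>' (\<mu> x) = x"
    and \<mu>_fac: "\<forall>p<m1. \<mu>' ` free_factor n s p \<subseteq> free_factor n s p"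
    and \<mu>_char: "\<forall>\<kappa>'. character A \<kappa>' \<longrightarrow> (\<kappa>' (s i j) = \<kappa> (s i j) \<longrightarrow> \<kappa>' (\<mu> (s i j)) = 0) \<and>
       (\<forall>p<m1. \<forall>q<n p. (p, q) \<noteq> (i, j) \<longrightarrow> \<kappa>' (s p q) = 0 \<longrightarrow> \<kappa>' (\<mu> (s p q)) = 0)"
    by - (elim exE conjE, rule that)
  have "isometric_iso A B (\<lambda>a. \<theta> (\<mu> a))"
    by (rule isometric_iso_comp_automorphism[OF A.uoa \<theta> \<mu>]) (use inv in auto)
  moreover have "\<phi> ` free_factor n s p \<subseteq> (\<lambda>a. \<theta> (\<mu> a)) ` free_factor n s p" if p: "p < m1" for p
  proof
    fix y assume "y \<in> \<phi> ` free_factor n s p"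
    then obtain a where a: "a \<in> free_factor n s p" "y = \<theta> a" using fac p by blast
    then have "\<mu>' a \<in> free_factor n s p" "\<mu> (\<mu>' a) = a"
      using \<mu>_fac p inv(1) A.factor_subset_A[OF p] by blast+
    then show "y \<in> (\<lambda>a. \<theta> (\<mu> a)) ` free_factor n s p" using a(2) by (metis imageI)
  qed
  moreover have "B.eps (\<theta> (\<mu> (s p q))) = 0" if "(p, q) \<in> insert x C" for p q
  proof -
    have pq: "p < m1" "q < n p" using that insert.prems by auto
    have "\<kappa> (\<mu> (s p q)) = 0"
    proof (cases "(p, q) = (i, j)")
      case True
      then show ?thesis using \<mu>_char \<kappa> by blast
    next
      case False
      then have "(p, q) \<in> C" using that x by auto
      then have "\<kappa> (s p q) = 0" using zero by (auto simp: \<kappa>_def)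
      then show ?thesis using \<mu>_char \<kappa> pq False by blast
    qed
    then show ?thesis by (simp add: \<kappa>_def)
  qed
  ultimately show ?case by (intro exI[of _ "\<lambda>a. \<theta> (\<mu> a)"]) blast
qed

end

lemma isometric_iso_factor:
  assumes fA: "free_rows m1 n s A" and fB: "free_rows m2 k t B" and \<phi>: "isometric_iso A B \<phi>"
    and i: "i < m1" "0 < n i"
  shows "\<exists>p<m2. \<phi> ` free_factor n s i \<subseteq> free_factor k t p"
proof -
  interpret AB: free_rows_pair m1 n s A m2 k t B
    by (intro free_rows_pair.intro fA fB)
  interpret BA: free_rows_pair m2 k t B m1 n s A
    by (intro free_rows_pair.intro fA fB)
  have "{(i, j). i < m1 \<and> j < n i} = (SIGMA i:{..<m1}. {..<n i})" by auto
  then have "finite {(i, j). i < m1 \<and> j < n i}" by simp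
  from AB.ex_based_iso[OF \<phi> this order.refl]
  obtain \<theta> where \<theta>: "isometric_iso A B \<theta>" and fac: "\<forall>i<m1. \<phi> ` free_factor n s i \<subseteq> \<theta> ` free_factor n s i"
    and zero: "\<forall>(i, j)\<in>{(i, j). i < m1 \<and> j < n i}. AB.B.eps (\<theta> (s i j)) = 0"
    by blast
  note T = isometric_isoD[OF \<theta>]
  obtain \<eta> where \<eta>: "isometric_iso B A \<eta>" and \<eta>\<theta>: "\<And>a. a \<in> A \<Longrightarrow> \<eta> (\<theta> a) = a"
    and \<theta>\<eta>: "\<And>b. b \<in> B \<Longrightarrow> \<theta> (\<eta> b) = b" using isometric_iso_inverse[OF AB.A.uoa \<theta>] by metis
  note E = isometric_isoD[OF \<eta>]
  \<comment> \<open>Both sides are characters of \<open>A\<close> that vanish at all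
    generators.\<close>
  have \<theta>_eps: "AB.B.eps (\<theta> a) = AB.A.eps a" if "a \<in> A" for a
    by (rule AB.A.character_eqI[OF character_comp[OF T(1,2) AB.B.eps] AB.A.eps _ that])
      (use zero in \<open>simp add: AB.A.eps_gen\<close>)
  have \<eta>_eps: "AB.A.eps (\<eta> b) = AB.B.eps b" if "b \<in> B" for b
    using \<theta>_eps[OF E(3)[OF that]] \<theta>\<eta>[OF that] by simp
  have "\<exists>p<m2. \<theta> ` free_factor n s i \<subseteq> free_factor k t p"
    by (rule AB.linear_iso_factor[OF \<theta> \<eta> \<theta>\<eta> AB.based_iso_generator_linear[OF \<theta> \<theta>_eps]
          BA.based_iso_generator_linear[OF \<eta> \<eta>_eps] i])
  then show ?thesis using fac i(1) by blast
qed

section \<open>The permutation of the factors\<close>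

lemma completely_isometric_iso_imp_isometric_iso:
  assumes "completely_isometric_iso A B \<phi>" shows "isometric_iso A B \<phi>"
proof -
  have "norm (\<phi> a) = norm a" if "a \<in> A" for a
    using assms[unfolded completely_isometric_iso_def completely_isometric_def, THEN conjunct2, THEN conjunct1,
        rule_format, of 1 "\<lambda>_ _. a"] that
    by (simp only: matrix_norm_1)
  then show ?thesis using assms by (simp add: isometric_iso_def completely_isometric_iso_def bij_betw_def)
qed

theorem corollary2p8:
  fixes m1 m2 :: nat and n k :: "nat \<Rightarrow> nat"
    and s :: "nat \<Rightarrow> nat \<Rightarrow> 'h::complex_hilbert_space op"
    and t :: "nat \<Rightarrow> nat \<Rightarrow> 'g::complex_hilbert_space op"
    and A :: "'h op set" and B :: "'g op set"
    and \<phi> :: "'h op \<Rightarrow> 'g op"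
  assumes "m1 \<ge> 1" and "m2 \<ge> 1"
    and "\<forall>i<m1. n i \<ge> 1" and "\<forall>j<m2. k j \<ge> 1"
    and infinite_dim: "\<forall>S::'k::complex_hilbert_space set. finite S \<longrightarrow> span S \<noteq> UNIV"
    and "is_disc_free_product TYPE('k) m1 n s A"
    and "is_disc_free_product TYPE('k) m2 k t B"
    and "completely_isometric_iso A B \<phi>"
  shows "m1 = m2 \<and>
    (\<exists>\<alpha> \<phi>'. \<alpha> permutes {..<m1} \<and>
       (\<forall>i<m1. completely_isometric_iso (free_factor n s i) (free_factor k t (\<alpha> i)) (\<phi>' i) \<and>
               (\<forall>a\<in>free_factor n s i. \<phi> a = \<phi>' i a)))"
proof -
  have fA: "free_rows m1 n s A" and fB: "free_rows m2 k t B"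
    using free_rows_disc_free_product[OF infinite_dim] assms by blast+
  interpret A: free_rows m1 n s A by (rule fA)
  interpret B: free_rows m2 k t B by (rule fB)
  have \<phi>: "isometric_iso A B \<phi>" by (rule completely_isometric_iso_imp_isometric_iso[OF assms(8)])
  obtain \<psi> where \<psi>: "isometric_iso B A \<psi>" and \<psi>\<phi>: "\<And>a. a \<in> A \<Longrightarrow> \<psi> (\<phi> a) = a"
    and \<phi>\<psi>: "\<And>b. b \<in> B \<Longrightarrow> \<phi> (\<psi> b) = b" using isometric_iso_inverse[OF A.uoa \<phi>] by metis
  have n: "0 < n i" if "i < m1" for i using assms(3) that by (simp add: Suc_le_eq)
  have k: "0 < k j" if "j < m2" for j using assms(4) that by (simp add: Suc_le_eq)
  obtain \<alpha> where \<alpha>: "\<And>i. i < m1 \<Longrightarrow> \<alpha> i < m2"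
    "\<And>i. i < m1 \<Longrightarrow> \<phi> ` free_factor n s i \<subseteq> free_factor k t (\<alpha> i)"
    using isometric_iso_factor[OF fA fB \<phi> _ n] by metis
  obtain \<beta> where \<beta>: "\<And>j. j < m2 \<Longrightarrow> \<beta> j < m1"
    "\<And>j. j < m2 \<Longrightarrow> \<psi> ` free_factor k t j \<subseteq> free_factor n s (\<beta> j)"
    using isometric_iso_factor[OF fB fA \<psi> _ k] by metis
  \<comment> \<open>So far only inclusions of factors are known. Following \<phi> by its inverse
    puts factor \<open>i\<close> into factor \<open>\<beta> (\<alpha> i)\<close>, and distinct
    factors are never nested.\<close>
  have \<beta>\<alpha>: "\<beta> (\<alpha> i) = i" if i: "i < m1" for i
  proof -
    have "free_factor n s i \<subseteq> free_factor n s (\<beta> (\<alpha> i))"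
    proof
      fix a assume a: "a \<in> free_factor n s i"
      then have "\<psi> (\<phi> a) \<in> free_factor n s (\<beta> (\<alpha> i))" using \<alpha>[OF i] \<beta>(2)[OF \<alpha>(1)[OF i]] by blast
      moreover have "\<psi> (\<phi> a) = a" using a A.factor_subset_A[OF i] \<psi>\<phi> by blast
      ultimately show "a \<in> free_factor n s (\<beta> (\<alpha> i))" by simp
    qed
    from A.factor_inject[OF i \<beta>(1)[OF \<alpha>(1)[OF i]] n[OF i] this] show ?thesis by simp
  qed
  have \<alpha>\<beta>: "\<alpha> (\<beta> j) = j" if j: "j < m2" for j
  proof -
    have "free_factor k t j \<subseteq> free_factor k t (\<alpha> (\<beta> j))"
    proof
      fix b assume b: "b \<in> free_factor k t j"
      then have "\<phi> (\<psi> b) \<in> free_factor k t (\<alpha> (\<beta> j))" using \<beta>[OF j] \<alpha>(2)[OF \<beta>(1)[OF j]] by blast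
      moreover have "\<phi> (\<psi> b) = b" using b B.factor_subset_A[OF j] \<phi>\<psi> by blast
      ultimately show "b \<in> free_factor k t (\<alpha> (\<beta> j))" by simp
    qed
    from B.factor_inject[OF j \<alpha>(1)[OF \<beta>(1)[OF j]] k[OF j] this] show ?thesis by simp
  qed
  have bij: "bij_betw \<alpha> {..<m1} {..<m2}"
    by (rule bij_betw_byWitness[where f' = \<beta>]) (use \<alpha>(1) \<beta>(1) \<alpha>\<beta> \<beta>\<alpha> in auto)
  then have m: "m1 = m2" using bij_betw_same_card by fastforce
  \<comment> \<open>\<open>permutes\<close> demands the identity outside the index set, where
    \<alpha> is arbitrary.\<close>
  define \<alpha>' where "\<alpha>' i = (if i \<in> {..<m1} then \<alpha> i else i)" for i
  have "\<alpha>' permutes {..<m1}"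
  proof (rule bij_imp_permutes)
    show "bij_betw \<alpha>' {..<m1} {..<m1}"
      using bij bij_betw_cong[of "{..<m1}" \<alpha>' \<alpha>] by (simp add: \<alpha>'_def m)
  qed (simp add: \<alpha>'_def)
  moreover have "completely_isometric_iso (free_factor n s i) (free_factor k t (\<alpha>' i)) \<phi>" if i: "i < m1" for i
  proof -
    have sub: "free_factor n s i \<subseteq> A" by (rule A.factor_subset_A[OF i])
    have inj: "inj_on \<phi> (free_factor n s i)"
      using \<psi>\<phi> sub by (intro inj_on_inverseI[of _ \<psi>]) blast
    have "free_factor k t (\<alpha> i) \<subseteq> \<phi> ` free_factor n s i"
    proof
      fix b assume b: "b \<in> free_factor k t (\<alpha> i)"
      then have "\<psi> b \<in> free_factor n s i" using \<beta>(2)[OF \<alpha>(1)[OF i]] \<beta>\<alpha>[OF i] by auto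
      moreover have "\<phi> (\<psi> b) = b" using b B.factor_subset_A[OF \<alpha>(1)[OF i]] \<phi>\<psi> by blast
      ultimately show "b \<in> \<phi> ` free_factor n s i" by (metis imageI)
    qed
    then have "bij_betw \<phi> (free_factor n s i) (free_factor k t (\<alpha> i))"
      using \<alpha>(2)[OF i] inj by (auto simp: bij_betw_def)
    moreover have "unital_hom (free_factor n s i) \<phi>"
      using isometric_isoD(1)[OF \<phi>] sub unfolding contractive_hom_def unital_hom_def by blast
    moreover have "completely_isometric (free_factor n s i) \<phi>"
      using assms(8) sub unfolding completely_isometric_iso_def completely_isometric_def by blast
    ultimately show ?thesis using i by (simp add: completely_isometric_iso_def \<alpha>'_def)
  qed
  \<comment> \<open>Each \<open>\<phi>' i\<close> is \<phi> itself, since only its values on the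
    \<open>i\<close>-th factor matter.\<close>
  ultimately show ?thesis
    using m by (intro conjI exI[of _ \<alpha>'] exI[of _ "\<lambda>_. \<phi>"]) auto
qed

end
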